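(* Let $G$ be a compact Lie group, let $\rho\colon G\to O(2)$ be an orthogonal representation, let $S(\rho)$ be the unit circle of the corresponding $G$-module, and let $H=\rho^{-1}(1)$. A complex $H$-module is (up to isomorphism) the fiber $H$-module of a complex $G$-vector bundle over $S(\rho)$ if and only if its character is $G$-invariant.
   Context: Modules are finite-dimensional continuous complex representations. Since $H=\ker\rho$ acts trivially on the connected space $S(\rho)$, each fiber of a complex $G$-vector bundle over $S(\rho)$ is an $H$-module, and all these fibers are isomorphic as $H$-modules; their common isomorphism class is called the fiber $H$-module of the bundle. For a character $\chi$ of $H$ and $g\in G$, the character ${}^{g}\chi$ of $H$ is defined by ${}^{g}\chi(h)=\chi(g^{-1}hg)$ for $h\in H$. The character $\chi$ is called $G$-invariant if ${}^{g}\chi=\chi$ for all $g\in G$. *)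

theory Defs
  imports
    "HOL-Analysis.Analysis"
    "HOL-Library.Equipollence"
    "HOL-Algebra.Coset"
    "Jordan_Normal_Form.VS_Connect"
begin

hide_const (open) Matrix.mat

fun Ck_on :: "nat \<Rightarrow> ('a::real_normed_vector \<Rightarrow> 'b::real_normed_vector) \<Rightarrow> 'a set \<Rightarrow> bool" where
  "Ck_on 0 f S = continuous_on S f"
| "Ck_on (Suc k) f S =
     ((\<forall>x\<in>S. f differentiable (at x)) \<and>
      (\<forall>v. Ck_on k (\<lambda>x. frechet_derivative f (at x) v) S))"

text \<open>Only used for open \<open>S\<close> in finite-dimensional spaces, where it is the usual notion of
  a \<open>C\<^sup>\<infinity>\<close> map.\<close>

definition smooth_on :: "('a::real_normed_vector \<Rightarrow> 'b::real_normed_vector) \<Rightarrow> 'a set \<Rightarrow> bool" where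
  "smooth_on f S \<longleftrightarrow> (\<forall>k. Ck_on k f S)"

text \<open>
  The Lie group structure is given by an atlas \<open>A\<close> of pairs of an open set and a chart on it. The
  model space \<open>'m\<close> is a finite-dimensional real vector space; the class \<^class>\<open>real_normed_vector\<close>,
  unlike \<^class>\<open>euclidean_space\<close>, admits the zero space, so that finite groups are included.
\<close>

locale compact_lie_group = group G for G :: "('g, 'r) monoid_scheme" (structure) +
  fixes T :: "'g topology"
    and A :: "('g set \<times> ('g \<Rightarrow> 'm::real_normed_vector)) set"
  assumes finite_dimensional_model: "\<exists>B::'m set. finite B \<and> span B = UNIV"
    and topspace_eq: "topspace T = carrier G"
    and hausdorff: "Hausdorff_space T"
    and compact: "compact_space T"
    and chart: "\<And>U \<phi>. (U, \<phi>) \<in> A \<Longrightarrow>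
      openin T U \<and> open (\<phi> ` U) \<and>
      homeomorphic_map (subtopology T U) (top_of_set (\<phi> ` U)) \<phi>"
    and charts_cover: "(\<Union>(U, \<phi>)\<in>A. U) = carrier G"
    and transition_smooth: "\<And>U \<phi> V \<psi>. (U, \<phi>) \<in> A \<Longrightarrow> (V, \<psi>) \<in> A \<Longrightarrow>
      smooth_on (\<lambda>a. \<psi> (inv_into U \<phi> a)) (\<phi> ` (U \<inter> V))"
    and mult_continuous: "continuous_map (prod_topology T T) T (\<lambda>(g, h). g \<otimes> h)"
    and inv_continuous: "continuous_map T T (\<lambda>g. inv g)"
    and mult_smooth: "\<And>U \<phi> V \<psi> W \<omega>. (U, \<phi>) \<in> A \<Longrightarrow> (V, \<psi>) \<in> A \<Longrightarrow> (W, \<omega>) \<in> A \<Longrightarrow>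
      smooth_on (\<lambda>(a, b). \<omega> (inv_into U \<phi> a \<otimes> inv_into V \<psi> b))
        {(a, b). a \<in> \<phi> ` U \<and> b \<in> \<psi> ` V \<and> inv_into U \<phi> a \<otimes> inv_into V \<psi> b \<in> W}"
    and inv_smooth: "\<And>U \<phi> V \<psi>. (U, \<phi>) \<in> A \<Longrightarrow> (V, \<psi>) \<in> A \<Longrightarrow>
      smooth_on (\<lambda>a. \<psi> (inv (inv_into U \<phi> a))) {a \<in> \<phi> ` U. inv (inv_into U \<phi> a) \<in> V}"

definition O2 :: "(real^2^2) monoid" where
  "O2 = \<lparr>carrier = {M. orthogonal_matrix M}, mult = (**), one = mat 1\<rparr>"

definition orthogonal_rep ::
    "('g, 'r) monoid_scheme \<Rightarrow> 'g topology \<Rightarrow> ('g \<Rightarrow> real^2^2) \<Rightarrow> bool" where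
  "orthogonal_rep G T \<rho> \<longleftrightarrow> \<rho> \<in> hom G O2 \<and> continuous_map T euclidean \<rho>"

text \<open>A finite-dimensional continuous complex representation of the group \<open>K\<close> with topology \<open>S\<close>, in
  matrix form: the module is \<open>\<complex>\<^sup>n\<close>, with \<open>n = 0\<close> allowed.\<close>

definition complex_rep ::
    "('g, 'r) monoid_scheme \<Rightarrow> 'g topology \<Rightarrow> nat \<Rightarrow> ('g \<Rightarrow> complex mat) \<Rightarrow> bool" where
  "complex_rep K S n \<sigma> \<longleftrightarrow>
     (\<forall>h\<in>carrier K. \<sigma> h \<in> carrier_mat n n) \<and>
     \<sigma> \<one>\<^bsub>K\<^esub> = 1\<^sub>m n \<and>
     (\<forall>h\<in>carrier K. \<forall>k\<in>carrier K. \<sigma> (h \<otimes>\<^bsub>K\<^esub> k) = \<sigma> h * \<sigma> k) \<and>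
     (\<forall>i<n. \<forall>j<n. continuous_map S euclidean (\<lambda>h. \<sigma> h $$ (i, j)))"

definition character :: "('g \<Rightarrow> complex mat) \<Rightarrow> 'g \<Rightarrow> complex" where
  "character \<sigma> h = (\<Sum>i<dim_row (\<sigma> h). \<sigma> h $$ (i, i))"

definition conj_character ::
    "('g, 'r) monoid_scheme \<Rightarrow> 'g \<Rightarrow> ('g \<Rightarrow> complex) \<Rightarrow> 'g \<Rightarrow> complex" where
  "conj_character G g c h = c (inv\<^bsub>G\<^esub> g \<otimes>\<^bsub>G\<^esub> h \<otimes>\<^bsub>G\<^esub> g)"

definition invariant_character ::
    "('g, 'r) monoid_scheme \<Rightarrow> 'g set \<Rightarrow> ('g \<Rightarrow> complex) \<Rightarrow> bool" where
  "invariant_character G H c \<longleftrightarrow> (\<forall>g\<in>carrier G. \<forall>h\<in>H. conj_character G g c h = c h)"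

definition circle :: "(real^2) topology" where
  "circle = top_of_set (sphere 0 1)"

definition cvec_topology :: "nat \<Rightarrow> complex vec topology" where
  "cvec_topology n =
     pullback_topology (carrier_vec n) (\<lambda>v. \<lambda>i\<in>{..<n}. v $ i) (product_topology (\<lambda>_. euclidean) {..<n})"

text \<open>
  The points of the total space are drawn from a type \<open>'e\<close>. Over the circle every total space of a
  complex vector bundle has exactly the cardinality of the continuum, so each type with at least
  that many elements contains a copy of every such bundle, and quantifying over the bundles in
  one such type is quantifying over all bundles up to isomorphism.

  The field \<open>fiber\<close> carries the vector space structure of each fiber; the ring components
  \<open>mult\<close> and \<open>one\<close> of its module record are irrelevant.
\<close>

record ('g, 'e) equivariant_bundle =
  total_space :: "'e topology"
  proj :: "'e \<Rightarrow> real^2"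
  fiber :: "real^2 \<Rightarrow> (complex, 'e) module"
  act :: "'g \<Rightarrow> 'e \<Rightarrow> 'e"

definition complex_vector_bundle :: "('g, 'e) equivariant_bundle \<Rightarrow> bool" where
  "complex_vector_bundle E \<longleftrightarrow>
     continuous_map (total_space E) circle (proj E) \<and>
     (\<forall>x\<in>topspace circle.
        carrier (fiber E x) = {e \<in> topspace (total_space E). proj E e = x} \<and>
        vectorspace class_ring (fiber E x)) \<and>
     (\<forall>x\<in>topspace circle. \<exists>U n \<phi>. openin circle U \<and> x \<in> U \<and>
        homeomorphic_map (prod_topology (subtopology circle U) (cvec_topology n))
          (subtopology (total_space E) {e. proj E e \<in> U}) \<phi> \<and>
        (\<forall>y\<in>U. linear_map class_ring (module_vec TYPE(complex) n) (fiber E y) (\<lambda>v. \<phi> (y, v))))"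

definition G_vector_bundle ::
    "('g, 'r) monoid_scheme \<Rightarrow> 'g topology \<Rightarrow> ('g \<Rightarrow> real^2^2) \<Rightarrow> ('g, 'e) equivariant_bundle \<Rightarrow> bool"
  where
  "G_vector_bundle G T \<rho> E \<longleftrightarrow>
     complex_vector_bundle E \<and>
     continuous_map (prod_topology T (total_space E)) (total_space E) (\<lambda>(g, e). act E g e) \<and>
     (\<forall>e\<in>topspace (total_space E). act E \<one>\<^bsub>G\<^esub> e = e) \<and>
     (\<forall>g\<in>carrier G. \<forall>h\<in>carrier G. \<forall>e\<in>topspace (total_space E).
        act E (g \<otimes>\<^bsub>G\<^esub> h) e = act E g (act E h e)) \<and>
     (\<forall>g\<in>carrier G. \<forall>e\<in>topspace (total_space E). proj E (act E g e) = \<rho> g *v proj E e) \<and>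
     (\<forall>g\<in>carrier G. \<forall>x\<in>topspace circle.
        linear_map class_ring (fiber E x) (fiber E (\<rho> g *v x)) (act E g))"

text \<open>Every fiber of \<open>E\<close> is isomorphic, as an \<open>H\<close>-module, to \<open>\<complex>\<^sup>n\<close> with action \<open>\<sigma>\<close>.\<close>

definition is_fiber_module ::
    "'g set \<Rightarrow> ('g, 'e) equivariant_bundle \<Rightarrow> nat \<Rightarrow> ('g \<Rightarrow> complex mat) \<Rightarrow> bool" where
  "is_fiber_module H E n \<sigma> \<longleftrightarrow>
     (\<forall>x\<in>topspace circle. \<exists>f.
        linear_map class_ring (module_vec TYPE(complex) n) (fiber E x) f \<and>
        bij_betw f (carrier_vec n) (carrier (fiber E x)) \<and>
        (\<forall>h\<in>H. \<forall>v\<in>carrier_vec n. f (\<sigma> h *\<^sub>v v) = act E h (f v)))"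

end

theory Submission
  imports Defs "Jordan_Normal_Form.Schur_Decomposition" "HOL-Library.Function_Algebras"
begin

hide_const (open) Determinants.det

text \<open>
  An element \<open>g\<close> of the group maps the fiber over \<open>x\<close> onto the fiber over \<open>\<rho> g *v x\<close> and twists the
  action of \<open>H\<close> by conjugation; since all fibers are isomorphic, the character is invariant.

  Conversely, let the character of \<open>\<sigma>\<close> be invariant. Representations of a compact group with equal
  characters are equivalent, by averaging over the group. (A mean obtained from convex combinations of
  translates suffices, so no Haar measure is needed, nor is the smooth structure of \<open>G\<close>.) Hence \<open>\<sigma>\<close> is
  intertwined with each of its conjugates. The stabiliser \<open>K\<close> of a point of the circle contains \<open>H\<close>
  with index at most 2, and \<open>\<sigma>\<close> extends to a representation \<open>\<tau>\<close> of \<open>K\<close>: correct an intertwiner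
  belonging to an element of \<open>K - H\<close> by the square root of a matrix commuting with it. Finitely many
  continuous functions \<open>A i\<close> on \<open>G\<close> with values in the square matrices satisfy
  \<open>A i (g \<otimes> k) = A i g * \<tau> k\<close> and embed the bundle over the orbit \<open>G / K\<close> induced by \<open>\<tau>\<close> into a trivial
  bundle. The image of \<open>\<rho>\<close> is transitive on the circle, or it acts as a cyclic or dihedral group with an
  arc as fundamental domain. In the latter cases the functions belonging to the end points of the arc
  are joined along it, and the bundle is obtained as a subspace of the product of the circle with
  \<open>(\<complex>\<^sup>n)\<^sup>m\<close>.
\<close>

section \<open>Invariant means on compact groups\<close>

text \<open>A representation of a normal subgroup that is isomorphic to all its conjugates need not
  extend to the whole group. The construction never asks for that. Only stabilisers act on fibers,
  and a nontrivial orthogonal map of the plane that fixes a point of the circle is the reflection in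
  the line through it. So the quotient of a stabiliser by \<open>H\<close> is cyclic of order at
  most 2, and for such a quotient a square root removes the obstruction. If there are reflections,
  the ends of a fundamental arc may carry unrelated extensions, because no element of
  \<open>G\<close> moves one end to the other. Without reflections a rotation does so, and any
  invertible intertwiner for it closes up the bundle.

  Frames are multiplied from the right: \<open>F i (g \<otimes> k) = F i g * C\<close> with
  \<open>C\<close> invertible and independent of \<open>i\<close> says that the stacked matrices
  have the same column space, and this column space is the fiber.

  The mean works because left and right averages commute: a constant approached by right averages
  equals every constant approached by left ones. Uniqueness and additivity of the mean follow from
  this.\<close>

lemma compact_tube:
  assumes "compact_space Y" "openin (prod_topology X Y) W" "x \<in> topspace X" "{x} \<times> topspace Y \<subseteq> W"
  obtains U where "openin X U" "x \<in> U" "U \<times> topspace Y \<subseteq> W"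
proof -
  let ?C = "topspace (prod_topology X Y) - W"
  have "closedin (prod_topology X Y) ?C" using assms(2) by blast
  then have "closedin X (fst ` ?C)"
    using closed_map_fst[OF assms(1)] by (auto simp: closed_map_def)
  moreover have "x \<notin> fst ` ?C" using assms(4) by auto
  moreover have "(topspace X - fst ` ?C) \<times> topspace Y \<subseteq> W" by force
  ultimately show ?thesis using that[of "topspace X - fst ` ?C"] assms(3) by blast
qed

section \<open>Compact groups and averages over right translates\<close>

locale compact_group = group G for G :: "('g, 'r) monoid_scheme" (structure) +
  fixes T :: "'g topology"
  assumes topspace_eq: "topspace T = carrier G"
    and compact: "compact_space T"
    and mult_cont: "continuous_map (prod_topology T T) T (\<lambda>(g, h). g \<otimes> h)"
    and inv_cont: "continuous_map T T (\<lambda>g. inv g)"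
begin

lemma continuous_map_mult [continuous_intros]:
  assumes "continuous_map X T f" "continuous_map X T g"
  shows "continuous_map X T (\<lambda>x. f x \<otimes> g x)"
  using continuous_map_compose[OF continuous_map_pairedI[OF assms] mult_cont] by (simp add: o_def)

lemma continuous_map_inv [continuous_intros]:
  assumes "continuous_map X T f"
  shows "continuous_map X T (\<lambda>x. inv (f x))"
  using continuous_map_compose[OF assms inv_cont] by (simp add: o_def)

lemma continuous_map_const_carrier [continuous_intros]:
  "a \<in> carrier G \<Longrightarrow> continuous_map X T (\<lambda>x. a)"
  by (simp add: topspace_eq)

text \<open>Operators instead of averaged functions, so that one average can be applied to the
  outcome of another. Equal weights are enough: the argument that shrinks the oscillation only
  averages over a finite family of translates and composes.\<close>

inductive ravg :: "(('g \<Rightarrow> real) \<Rightarrow> 'g \<Rightarrow> real) \<Rightarrow> bool" where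
  translate: "a \<in> carrier G \<Longrightarrow> ravg (\<lambda>f x. f (x \<otimes> a))"
| compose: "ravg P \<Longrightarrow> ravg Q \<Longrightarrow> ravg (\<lambda>f. P (Q f))"
| average: "(\<And>i. i < N \<Longrightarrow> ravg (P i)) \<Longrightarrow> (N::nat) > 0 \<Longrightarrow> ravg (\<lambda>f x. (\<Sum>i<N. P i f x) / real N)"

text \<open>Functions are controlled only on the carrier, so rewriting below an operator needs this
  congruence in place of extensionality.\<close>

lemma ravg_cong:
  "ravg P \<Longrightarrow> (\<And>x. x \<in> carrier G \<Longrightarrow> f x = g x) \<Longrightarrow> x \<in> carrier G \<Longrightarrow> P f x = P g x"
proof (induction arbitrary: f g x rule: ravg.induct)
  case (compose P Q) then show ?case by blast
next
  case (average N P)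
  have "\<And>i. i < N \<Longrightarrow> P i f x = P i g x" using average by blast
  then show ?case by simp
qed auto

lemma ravg_add:
  "ravg P \<Longrightarrow> x \<in> carrier G \<Longrightarrow> P (\<lambda>x. f x + g x) x = P f x + P g x"
proof (induction arbitrary: f g x rule: ravg.induct)
  case (compose P Q)
  have "P (Q (\<lambda>x. f x + g x)) x = P (\<lambda>x. Q f x + Q g x) x"
    by (rule ravg_cong) (use compose in auto)
  then show ?case using compose by simp
next
  case (average N P)
  have "\<And>i. i < N \<Longrightarrow> P i (\<lambda>x. f x + g x) x = P i f x + P i g x" using average by blast
  then show ?case by (simp add: sum.distrib add_divide_distrib)
qed auto

lemma ravg_scale:
  "ravg P \<Longrightarrow> x \<in> carrier G \<Longrightarrow> P (\<lambda>x. c * f x) x = c * P f x"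
proof (induction arbitrary: f x rule: ravg.induct)
  case (compose P Q)
  have "P (Q (\<lambda>x. c * f x)) x = P (\<lambda>x. c * Q f x) x"
    by (rule ravg_cong) (use compose in auto)
  then show ?case using compose by simp
next
  case (average N P)
  have "\<And>i. i < N \<Longrightarrow> P i (\<lambda>x. c * f x) x = c * P i f x" using average by blast
  then show ?case by (simp add: sum_distrib_left)
qed auto

lemma ravg_ge:
  "ravg P \<Longrightarrow> (\<And>x. x \<in> carrier G \<Longrightarrow> c \<le> f x) \<Longrightarrow> x \<in> carrier G \<Longrightarrow> c \<le> P f x"
proof (induction arbitrary: f x rule: ravg.induct)
  case (compose P Q) then show ?case by blast
next
  case (average N P)
  have "\<And>i. i < N \<Longrightarrow> c \<le> P i f x" using average by blast
  then have "(\<Sum>i<N. c) \<le> (\<Sum>i<N. P i f x)" by (intro sum_mono) auto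
  then show ?case using average by (simp add: field_simps)
qed auto

lemma ravg_le:
  assumes "ravg P" "\<And>x. x \<in> carrier G \<Longrightarrow> f x \<le> c" "x \<in> carrier G" shows "P f x \<le> c"
  using ravg_ge[of P "-c" "\<lambda>x. -1 * f x" x] ravg_scale[of P x "-1" f] assms by auto

lemma ravg_continuous:
  "ravg P \<Longrightarrow> continuous_map T euclideanreal f \<Longrightarrow> continuous_map T euclideanreal (P f)"
proof (induction arbitrary: f rule: ravg.induct)
  case (translate a)
  then show ?case
    using continuous_map_compose[of T T "\<lambda>x. x \<otimes> a" _ f]
      continuous_map_mult[OF continuous_map_id[unfolded id_def] continuous_map_const_carrier]
    by (auto simp: o_def)
next
  case (average N P)
  have "continuous_map T euclideanreal (\<lambda>x. \<Sum>i<N. P i f x)"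
    by (rule continuous_map_sum) (use average in auto)
  then show ?case
    by (intro continuous_map_real_divide) (use average in auto)
qed auto

text \<open>Left and right translations commute by associativity, and this survives composition and
  averaging. It is the source of the left invariance of the mean.\<close>

lemma ravg_left_translate:
  "ravg P \<Longrightarrow> a \<in> carrier G \<Longrightarrow> x \<in> carrier G \<Longrightarrow> P (\<lambda>y. f (a \<otimes> y)) x = P f (a \<otimes> x)"
proof (induction arbitrary: f x rule: ravg.induct)
  case (compose P Q)
  have "P (Q (\<lambda>y. f (a \<otimes> y))) x = P (\<lambda>y. Q f (a \<otimes> y)) x"
    by (rule ravg_cong) (use compose in auto)
  then show ?case using compose by simp
next
  case (average N P)
  have "\<And>i. i < N \<Longrightarrow> P i (\<lambda>y. f (a \<otimes> y)) x = P i f (a \<otimes> x)" using average by blast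
  then show ?case by simp
qed (auto simp: m_assoc)

lemma ravg_sum:
  assumes P: "ravg P" and x: "x \<in> carrier G"
  shows "P (\<lambda>y. \<Sum>i<(N::nat). F i y) x = (\<Sum>i<N. P (F i) x)"
proof (induction N)
  case 0
  have "P (\<lambda>y. 0 * 0) x = 0 * P (\<lambda>y. 0) x" by (rule ravg_scale[OF P x])
  then show ?case by simp
next
  case (Suc N)
  then show ?case using ravg_add[OF P x, of "\<lambda>y. \<Sum>i<N. F i y" "F N"] by simp
qed

text \<open>Left averages are obtained from right averages by conjugating with the inversion.\<close>

definition lavg :: "(('g \<Rightarrow> real) \<Rightarrow> 'g \<Rightarrow> real) \<Rightarrow> ('g \<Rightarrow> real) \<Rightarrow> 'g \<Rightarrow> real" where
  "lavg P f x = P (\<lambda>z. f (inv z)) (inv x)"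

lemma lavg_cong:
  "ravg P \<Longrightarrow> (\<And>x. x \<in> carrier G \<Longrightarrow> f x = g x) \<Longrightarrow> x \<in> carrier G \<Longrightarrow> lavg P f x = lavg P g x"
  unfolding lavg_def by (erule ravg_cong) simp_all

lemma lavg_ge:
  "ravg P \<Longrightarrow> (\<And>x. x \<in> carrier G \<Longrightarrow> c \<le> f x) \<Longrightarrow> x \<in> carrier G \<Longrightarrow> c \<le> lavg P f x"
  unfolding lavg_def by (erule ravg_ge) simp_all

lemma lavg_le:
  "ravg P \<Longrightarrow> (\<And>x. x \<in> carrier G \<Longrightarrow> f x \<le> c) \<Longrightarrow> x \<in> carrier G \<Longrightarrow> lavg P f x \<le> c"
  unfolding lavg_def by (erule ravg_le) simp_all

text \<open>This takes the place of Fubini's theorem. In the base case the left operator is a left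
  translation, which commutes with every right average; the other cases use that \<open>P\<close> is
  linear and respects equality on the carrier.\<close>

lemma lavg_ravg_commute:
  assumes P: "ravg P"
  shows "ravg P' \<Longrightarrow> x \<in> carrier G \<Longrightarrow> P (lavg P' f) x = lavg P' (P f) x"
proof (induction arbitrary: f x rule: ravg.induct)
  case (translate a)
  have "P (\<lambda>y. f (inv (inv y \<otimes> a))) x = P (\<lambda>y. f (inv a \<otimes> y)) x"
    by (rule ravg_cong[OF P]) (use translate in \<open>auto simp: inv_mult_group\<close>)
  also have "\<dots> = P f (inv a \<otimes> x)" by (rule ravg_left_translate[OF P]) (use translate in auto)
  finally show ?case using translate by (simp add: lavg_def inv_mult_group)
next
  case (compose P1 P2)
  have 1: "lavg (\<lambda>f. P1 (P2 f)) h y = lavg P1 (lavg P2 h) y" if "y \<in> carrier G" for h y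
    unfolding lavg_def by (rule ravg_cong) (use that compose in auto)
  have "P (lavg (\<lambda>f. P1 (P2 f)) f) x = P (lavg P1 (lavg P2 f)) x"
    by (rule ravg_cong[OF P]) (use 1 compose in auto)
  also have "\<dots> = lavg P1 (P (lavg P2 f)) x" using compose by blast
  also have "\<dots> = lavg P1 (lavg P2 (P f)) x"
    by (rule lavg_cong) (use compose in auto)
  finally show ?case using 1 compose by simp
next
  case (average N Q)
  have "P (lavg (\<lambda>f x. (\<Sum>i<N. Q i f x) / real N) f) x
      = P (\<lambda>y. (1 / real N) * (\<Sum>i<N. lavg (Q i) f y)) x"
    by (rule ravg_cong[OF P]) (use average in \<open>auto simp: lavg_def\<close>)
  also have "\<dots> = (1 / real N) * (\<Sum>i<N. P (lavg (Q i) f) x)"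
    using average by (simp only: ravg_scale[OF P] ravg_sum[OF P])
  also have "(\<Sum>i<N. P (lavg (Q i) f) x) = (\<Sum>i<N. lavg (Q i) (P f) x)"
    by (rule sum.cong) (use average in auto)
  finally show ?case by (simp add: lavg_def)
qed

text \<open>The pairs \<open>(u, x)\<close> with small difference form an open set containing the
  slice over \<one>; compactness of the group yields a tube around the slice, hence a
  \<open>U\<close> that serves all \<open>x\<close> at once.\<close>

lemma uniform_left_continuity:
  assumes f: "continuous_map T euclideanreal f" and e: "e > 0"
  obtains U where "openin T U" "\<one> \<in> U"
    "\<And>u x. u \<in> U \<Longrightarrow> x \<in> carrier G \<Longrightarrow> \<bar>f (u \<otimes> x) - f x\<bar> < e"
proof -
  let ?F = "\<lambda>(u, x). \<bar>f (u \<otimes> x) - f x\<bar>"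
  have "continuous_map (prod_topology T T) euclideanreal (\<lambda>p. f (fst p \<otimes> snd p) - f (snd p))"
    using continuous_map_compose[OF mult_cont f] continuous_map_compose[OF continuous_map_snd f]
    by (intro continuous_map_diff) (auto simp: o_def case_prod_unfold)
  then have F: "continuous_map (prod_topology T T) euclideanreal ?F"
    unfolding case_prod_unfold by (rule continuous_map_real_abs)
  have "openin (prod_topology T T) {p \<in> topspace (prod_topology T T). ?F p \<in> {..<e}}"
    by (rule openin_continuous_map_preimage[OF F]) auto
  moreover have "{\<one>} \<times> topspace T \<subseteq> {p \<in> topspace (prod_topology T T). ?F p \<in> {..<e}}"
    using e by (auto simp: topspace_eq)
  ultimately obtain U where U: "openin T U" "\<one> \<in> U"
    "U \<times> topspace T \<subseteq> {p \<in> topspace (prod_topology T T). ?F p \<in> {..<e}}"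
    using compact_tube[OF compact, of T _ \<one>] by (metis (lifting) one_closed topspace_eq)
  show ?thesis
  proof (rule that[OF U(1,2)])
    fix u x assume "u \<in> U" "x \<in> carrier G"
    then have "(u, x) \<in> U \<times> topspace T" by (simp add: topspace_eq)
    with U(3) have "(u, x) \<in> {p \<in> topspace (prod_topology T T). ?F p \<in> {..<e}}" by blast
    then show "\<bar>f (u \<otimes> x) - f x\<bar> < e" by simp
  qed
qed

text \<open>Compactness, with the cover indexed by naturals and nonempty because averages divide by
  \<open>N\<close>. The same cover later selects finitely many translates of an equivariant
  frame.\<close>

lemma finite_translate_cover:
  assumes U: "openin T U" "\<one> \<in> U"
  obtains N b where "(N::nat) > 0" "\<And>i. i < N \<Longrightarrow> b i \<in> carrier G"
    "\<And>x. x \<in> carrier G \<Longrightarrow> \<exists>i<N. x \<otimes> inv (b i) \<in> U"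
proof -
  define V where "V a = {x \<in> carrier G. x \<otimes> inv a \<in> U}" for a
  have "openin T (V a)" if "a \<in> carrier G" for a
  proof -
    have "continuous_map T T (\<lambda>x. x \<otimes> inv a)"
      using that by (intro continuous_intros) auto
    from openin_continuous_map_preimage[OF this U(1)] show ?thesis by (simp add: V_def topspace_eq)
  qed
  moreover have "topspace T \<subseteq> \<Union> (V ` carrier G)"
    using U by (auto simp: V_def topspace_eq r_inv)
  ultimately have "\<exists>F. finite F \<and> F \<subseteq> V ` carrier G \<and> topspace T \<subseteq> \<Union> F"
    using compact[unfolded compact_space_alt, rule_format, of "V ` carrier G"] by blast
  then obtain F where F: "finite F" "F \<subseteq> V ` carrier G" "topspace T \<subseteq> \<Union> F"
    by blast
  then obtain S where S: "finite S" "S \<subseteq> carrier G" "carrier G \<subseteq> \<Union> (V ` S)"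
    using finite_subset_image[OF F(1,2)] by (auto simp: topspace_eq)
  obtain b where b: "bij_betw b {..<card S} S"
    using ex_bij_betw_nat_finite[OF S(1)] by (auto simp: atLeast0LessThan)
  have "S \<noteq> {}" using S(3) one_closed by blast
  show ?thesis
  proof (rule that[of "card S" b])
    show "card S > 0" using S \<open>S \<noteq> {}\<close> by (simp add: card_gt_0_iff)
    show "b i \<in> carrier G" if "i < card S" for i using b S that by (auto simp: bij_betw_def)
    show "\<exists>i<card S. x \<otimes> inv (b i) \<in> U" if x: "x \<in> carrier G" for x
    proof -
      obtain s where "s \<in> S" "x \<otimes> inv s \<in> U" using S x by (auto simp: V_def)
      moreover have "s \<in> b ` {..<card S}" using bij_betw_imp_surj_on[OF b] \<open>s \<in> S\<close> by simp
      ultimately show ?thesis by auto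
    qed
  qed
qed

text \<open>Right averaging does not worsen the modulus of left continuity. Hence one neighbourhood,
  chosen for \<open>f\<close>, serves every \<open>P f\<close>, and the number of translates
  covering the group stays fixed throughout the iteration.\<close>

lemma ravg_left_uniform:
  assumes "ravg P" "u \<in> carrier G" "x \<in> carrier G" "\<And>x. x \<in> carrier G \<Longrightarrow> \<bar>f (u \<otimes> x) - f x\<bar> < e"
  shows "P f (u \<otimes> x) \<le> P f x + e"
proof -
  have "P f (u \<otimes> x) - P f x = P (\<lambda>y. f (u \<otimes> y) + (-1) * f y) x"
    by (simp only: ravg_add[OF assms(1,3)] ravg_scale[OF assms(1,3)] ravg_left_translate[OF assms(1-3)])
  also have "\<dots> \<le> e"
  proof (rule ravg_le[OF assms(1) _ assms(3)])
    fix y assume "y \<in> carrier G"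
    from assms(4)[OF this] show "f (u \<otimes> y) + (-1) * f y \<le> e" by linarith
  qed
  finally show ?thesis by simp
qed

text \<open>If \<open>P f\<close> takes values in \<open>[m, m + d]\<close> with \<open>d > 2 e\<close>, then either the lower bound can be
  raised by \<open>e\<close>, or \<open>P f\<close> is small on a translate of \<open>U\<close>; since \<open>N\<close> translates of \<open>U\<close> cover the
  group, averaging over these translates lowers the upper bound by \<open>(d - 2 e) / N\<close>.\<close>

lemma ravg_oscillation:
  assumes f: "continuous_map T euclideanreal f" and e: "e > 0"
  shows "\<exists>P m. ravg P \<and> (\<forall>x\<in>carrier G. m \<le> P f x \<and> P f x \<le> m + e)"
proof -
  \<comment> \<open>\<open>D\<close> is the set of oscillation bounds that some average attains. The
    iteration is replaced by an argument about the infimum of \<open>D\<close>.\<close>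
  define D where "D = {d. d \<ge> 0 \<and> (\<exists>P m. ravg P \<and> (\<forall>x\<in>carrier G. m \<le> P f x \<and> P f x \<le> m + d))}"
  obtain U where U: "openin T U" "\<one> \<in> U"
    and Uf: "\<And>u x. u \<in> U \<Longrightarrow> x \<in> carrier G \<Longrightarrow> \<bar>f (u \<otimes> x) - f x\<bar> < e/4"
    using uniform_left_continuity[OF f, of "e/4"] e by auto
  obtain N b where N: "(N::nat) > 0" and b: "\<And>i. i < N \<Longrightarrow> b i \<in> carrier G"
    and cov: "\<And>x. x \<in> carrier G \<Longrightarrow> \<exists>i<N. x \<otimes> inv (b i) \<in> U"
    using finite_translate_cover[OF U] by blast
  have Uc: "U \<subseteq> carrier G" using U openin_subset topspace_eq by blast
  have step: "max (d - e/4) (d - (d - e/2)/N) \<in> D" if "d \<in> D" "d > e/2" for d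
  proof -
    from that obtain P m where P: "ravg P" and m: "\<And>x. x \<in> carrier G \<Longrightarrow> m \<le> P f x"
      and M: "\<And>x. x \<in> carrier G \<Longrightarrow> P f x \<le> m + d" by (auto simp: D_def)
    have nn: "max (d - e/4) (d - (d - e/2)/N) \<ge> 0" using that e by (intro max.coboundedI1) auto
    show ?thesis
    proof (cases "\<exists>x0\<in>carrier G. P f x0 \<le> m + e/4")
      case False
      have "m + e/4 \<le> P f x \<and> P f x \<le> (m + e/4) + max (d - e/4) (d - (d - e/2)/N)"
        if x: "x \<in> carrier G" for x
      proof -
        have "\<not> P f x \<le> m + e/4" using False x by blast
        then show ?thesis using M[OF x] by linarith
      qed
      then show ?thesis using P nn unfolding D_def mem_Collect_eq by (intro conjI exI[of _ P] exI[of _ "m + e/4"]) auto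
    next
      case True
      then obtain x0 where x0: "x0 \<in> carrier G" "P f x0 \<le> m + e/4" by blast
      \<comment> \<open>If \<open>x \<otimes> inv (b i)\<close> lies in \<open>U\<close>, then right
        translation by \<open>inv (b i) \<otimes> x0\<close> carries \<open>x\<close> into the
        translate of \<open>U\<close> through \<open>x0\<close>, where \<open>P f\<close> is at most
        \<open>m + e/2\<close>. For every \<open>x\<close> some \<open>i\<close> does this.\<close>
      define Q where "Q = (\<lambda>(h::'g \<Rightarrow> real) x. (\<Sum>i<N. h (x \<otimes> (inv (b i) \<otimes> x0))) / real N)"
      have Q: "ravg Q" unfolding Q_def
        by (rule ravg.average[of N "\<lambda>i h x. h (x \<otimes> (inv (b i) \<otimes> x0))"]) (use N b x0 in \<open>auto intro!: ravg.translate\<close>)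
      have "m \<le> Q (P f) x \<and> Q (P f) x \<le> m + (d - (d - e/2)/N)" if x: "x \<in> carrier G" for x
      proof
        show "m \<le> Q (P f) x" using ravg_ge[OF Q] m x by blast
        obtain i where i: "i < N" "x \<otimes> inv (b i) \<in> U" using cov x by blast
        have "P f ((x \<otimes> inv (b i)) \<otimes> x0) \<le> P f x0 + e/4"
          by (rule ravg_left_uniform[OF P]) (use i Uf Uc x0 in auto)
        then have small: "P f (x \<otimes> (inv (b i) \<otimes> x0)) \<le> m + e/2"
          using x0 x b i by (simp add: m_assoc)
        have "(\<Sum>j<N. P f (x \<otimes> (inv (b j) \<otimes> x0))) =
           P f (x \<otimes> (inv (b i) \<otimes> x0)) + (\<Sum>j\<in>{..<N}-{i}. P f (x \<otimes> (inv (b j) \<otimes> x0)))"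
          using i by (intro sum.remove) auto
        also have "\<dots> \<le> (m + e/2) + (\<Sum>j\<in>{..<N}-{i}. m + d)"
          by (intro add_mono small sum_mono M) (use b x x0 in auto)
        also have "\<dots> = (m + e/2) + (real N - 1) * (m + d)" using i by (simp add: of_nat_diff)
        also have "\<dots> = (m + (d - (d - e/2)/N)) * N" using N by (simp add: field_simps)
        finally show "Q (P f) x \<le> m + (d - (d - e/2)/N)" using N by (simp add: Q_def pos_divide_le_eq)
      qed
      then have "\<forall>x\<in>carrier G. m \<le> Q (P f) x \<and> Q (P f) x \<le> m + max (d - e/4) (d - (d - e/2)/N)"
        by (meson add_left_mono max.cobounded2 order_trans)
      then show ?thesis using ravg.compose[OF Q P] nn unfolding D_def mem_Collect_eq
        by (intro conjI exI[of _ "\<lambda>f. Q (P f)"] exI[of _ m]) auto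
    qed
  qed
  have "compactin euclideanreal (f ` topspace T)"
    using image_compactin[OF _ f] compact by (auto simp: compact_space_def)
  then have "bounded (f ` carrier G)" by (simp add: topspace_eq compact_imp_bounded)
  then obtain B where B: "\<And>x. x \<in> carrier G \<Longrightarrow> \<bar>f x\<bar> \<le> B" by (auto simp: bounded_iff)
  have "B \<ge> 0" using B[OF one_closed] by linarith
  have "ravg (\<lambda>f x. f (x \<otimes> \<one>))" by (rule ravg.translate) simp
  moreover have "- B \<le> f (x \<otimes> \<one>) \<and> f (x \<otimes> \<one>) \<le> - B + 2 * B" if "x \<in> carrier G" for x
    using B[of "x \<otimes> \<one>"] that by (simp add: abs_le_iff)
  ultimately have "\<exists>P m. ravg P \<and> (\<forall>x\<in>carrier G. m \<le> P f x \<and> P f x \<le> m + 2 * B)"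
    by (intro exI[of _ "\<lambda>f x. f (x \<otimes> \<one>)"] exI[of _ "- B"]) auto
  then have "2 * B \<in> D" using \<open>B \<ge> 0\<close> unfolding D_def by simp
  then have ne: "D \<noteq> {}" by blast
  have bdd: "bdd_below D" unfolding D_def by (rule bdd_belowI[of _ 0]) auto
  have "Inf D \<le> e/2"
  proof (rule ccontr)
    assume H: "\<not> Inf D \<le> e/2"
    \<comment> \<open>A lower bound for the gain of \<open>step\<close> that holds for all
      \<open>d \<ge> Inf D\<close>; an element of \<open>D\<close> within \<open>\<delta>\<close> of
      the infimum would thus be improved to one below the infimum.\<close>
    define \<delta> where "\<delta> = min (e/4) ((Inf D - e/2)/N)"
    have "\<delta> > 0" using H e N by (simp add: \<delta>_def)
    obtain d where d: "d \<in> D" "d < Inf D + \<delta>"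
      using cInf_lessD[OF ne, of "Inf D + \<delta>"] \<open>\<delta> > 0\<close> by auto
    have dI: "Inf D \<le> d" using cInf_lower[OF d(1) bdd] .
    have "Inf D \<le> max (d - e/4) (d - (d - e/2)/N)"
      using cInf_lower[OF step bdd] d dI H by auto
    moreover have "(Inf D - e/2)/N \<le> (d - e/2)/N" using dI by (simp add: divide_right_mono)
    moreover have "\<delta> \<le> e/4" "\<delta> \<le> (Inf D - e/2)/N"
      unfolding \<delta>_def by (rule min.cobounded1, rule min.cobounded2)
    ultimately show False using d unfolding le_max_iff_disj by linarith
  qed
  then obtain d where "d \<in> D" "d < e" using cInf_lessD[OF ne, of e] e by auto
  then obtain P m where "ravg P" "\<And>x. x \<in> carrier G \<Longrightarrow> m \<le> P f x \<and> P f x \<le> m + d"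
    by (auto simp: D_def)
  then show ?thesis using \<open>d < e\<close> by (intro exI[of _ P] exI[of _ m]) force
qed

lemma ravg_const:
  assumes f: "continuous_map T euclideanreal f" and e: "e > 0"
  shows "\<exists>P c. ravg P \<and> (\<forall>x\<in>carrier G. \<bar>P f x - c\<bar> \<le> e)"
proof -
  obtain P m where "ravg P" "\<And>x. x \<in> carrier G \<Longrightarrow> m \<le> P f x \<and> P f x \<le> m + e"
    using ravg_oscillation[OF f e] by blast
  moreover have "\<bar>P f x - m\<bar> \<le> e" if "m \<le> P f x \<and> P f x \<le> m + e" for x
    using that by linarith
  ultimately show ?thesis by blast
qed

section \<open>The invariant mean and its properties\<close>

lemma continuous_map_comp_inv:
  "continuous_map T Y f \<Longrightarrow> continuous_map T Y (\<lambda>x. f (inv x))"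
  using continuous_map_compose[OF inv_cont] by (auto simp: o_def)

lemma lavg_const:
  assumes f: "continuous_map T euclideanreal f" and e: "e > 0"
  shows "\<exists>P c. ravg P \<and> (\<forall>x\<in>carrier G. \<bar>lavg P f x - c\<bar> \<le> e)"
  using ravg_const[OF continuous_map_comp_inv[OF f] e] unfolding lavg_def by (meson inv_closed)

text \<open>Apply both operators and evaluate at \<one>. In one order the value is a left average of
  a function near \<open>c\<close>, in the other a right average of a function near
  \<open>d\<close>, and the two orders agree.\<close>

lemma ravg_lavg_const_close:
  assumes P: "ravg P" "\<And>x. x \<in> carrier G \<Longrightarrow> \<bar>P f x - c\<bar> \<le> e"
    and Q: "ravg Q" "\<And>x. x \<in> carrier G \<Longrightarrow> \<bar>lavg Q f x - d\<bar> \<le> e'"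
  shows "\<bar>c - d\<bar> \<le> e + e'"
proof -
  have "c - e \<le> lavg Q (P f) \<one>" "lavg Q (P f) \<one> \<le> c + e"
    by (rule lavg_ge[OF Q(1)] lavg_le[OF Q(1)]; use P(2) in \<open>force simp: abs_le_iff\<close>)+
  moreover have "d - e' \<le> P (lavg Q f) \<one>" "P (lavg Q f) \<one> \<le> d + e'"
    by (rule ravg_ge[OF P(1)] ravg_le[OF P(1)]; use Q(2) in \<open>force simp: abs_le_iff\<close>)+
  ultimately show ?thesis using lavg_ravg_commute[OF P(1) Q(1), of \<one> f] by auto
qed

text \<open>For continuous \<open>f\<close> this is the normalised invariant integral. The supremum
  only serves to name the constant that right averages approach.\<close>

definition haar_mean :: "('g \<Rightarrow> real) \<Rightarrow> real" where
  "haar_mean f = Sup {a. \<exists>P. ravg P \<and> (\<forall>x\<in>carrier G. a \<le> P f x)}"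

lemma haar_mean_ravg:
  assumes f: "continuous_map T euclideanreal f" and e: "e > 0"
  shows "\<exists>P. ravg P \<and> (\<forall>x\<in>carrier G. \<bar>P f x - haar_mean f\<bar> \<le> e)"
proof -
  let ?S = "{a. \<exists>P. ravg P \<and> (\<forall>x\<in>carrier G. a \<le> P f x)}"
  \<comment> \<open>Commuting the two kinds of averages bounds every attainable lower bound by any
    constant approached from the left; so the supremum exists and is squeezed between
    \<open>c - e/4\<close> and \<open>d + e/4\<close>.\<close>
  have ub: "a \<le> d + e'" if a: "a \<in> ?S" and Q: "ravg Q" "\<And>x. x \<in> carrier G \<Longrightarrow> \<bar>lavg Q f x - d\<bar> \<le> e'"
    for a Q d e'
  proof -
    obtain P where P: "ravg P" "\<And>x. x \<in> carrier G \<Longrightarrow> a \<le> P f x" using a by blast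
    have "a \<le> lavg Q (P f) \<one>" by (rule lavg_ge[OF Q(1)]) (use P in auto)
    moreover have "P (lavg Q f) \<one> \<le> d + e'"
      by (rule ravg_le[OF P(1)]; use Q(2) in \<open>force simp: abs_le_iff\<close>)
    ultimately show ?thesis using lavg_ravg_commute[OF P(1) Q(1), of \<one> f] by auto
  qed
  obtain P c where P: "ravg P" "\<And>x. x \<in> carrier G \<Longrightarrow> \<bar>P f x - c\<bar> \<le> e/4"
    using ravg_const[OF f, of "e/4"] e by auto
  obtain Q d where Q: "ravg Q" "\<And>x. x \<in> carrier G \<Longrightarrow> \<bar>lavg Q f x - d\<bar> \<le> e/4"
    using lavg_const[OF f, of "e/4"] e by auto
  have cd: "\<bar>c - d\<bar> \<le> e/4 + e/4" by (rule ravg_lavg_const_close[OF P Q])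
  have "c - e/4 \<le> P f x" if "x \<in> carrier G" for x using P(2)[OF that] by linarith
  then have "c - e/4 \<in> ?S" using P(1) by blast
  moreover have "bdd_above ?S" by (rule bdd_aboveI[of _ "d + e/4"]) (rule ub[OF _ Q])
  ultimately have "c - e/4 \<le> haar_mean f"
    unfolding haar_mean_def by (rule cSup_upper)
  moreover have "haar_mean f \<le> d + e/4"
    unfolding haar_mean_def by (rule cSup_least) (use ub[OF _ Q] \<open>c - e/4 \<in> ?S\<close> in auto)
  ultimately have "\<bar>P f x - haar_mean f\<bar> \<le> e" if "x \<in> carrier G" for x
    using P(2)[OF that] cd by linarith
  then show ?thesis using P(1) by blast
qed

lemma haar_mean_lavg:
  assumes f: "continuous_map T euclideanreal f" and e: "e > 0"
  shows "\<exists>P. ravg P \<and> (\<forall>x\<in>carrier G. \<bar>lavg P f x - haar_mean f\<bar> \<le> e)"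
proof -
  obtain P where P: "ravg P" "\<And>x. x \<in> carrier G \<Longrightarrow> \<bar>P f x - haar_mean f\<bar> \<le> e/4"
    using haar_mean_ravg[OF f, of "e/4"] e by auto
  obtain Q d where Q: "ravg Q" "\<And>x. x \<in> carrier G \<Longrightarrow> \<bar>lavg Q f x - d\<bar> \<le> e/4"
    using lavg_const[OF f, of "e/4"] e by auto
  have "\<bar>haar_mean f - d\<bar> \<le> e/4 + e/4" by (rule ravg_lavg_const_close[OF P Q])
  then have "\<bar>lavg Q f x - haar_mean f\<bar> \<le> e" if "x \<in> carrier G" for x
    using Q(2)[OF that] e by linarith
  then show ?thesis using Q(1) by blast
qed

text \<open>Compare right averages near \<open>c\<close> with left averages near the mean. The
  constants differ by at most \<open>2 e\<close>, which contradicts the choice of \<open>e\<close>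
  as a third of their distance.\<close>

lemma haar_mean_unique:
  assumes f: "continuous_map T euclideanreal f"
    and c: "\<And>e. e > 0 \<Longrightarrow> \<exists>P. ravg P \<and> (\<forall>x\<in>carrier G. \<bar>P f x - c\<bar> \<le> e)"
  shows "haar_mean f = c"
proof (rule ccontr)
  assume ne: "haar_mean f \<noteq> c"
  define e where "e = \<bar>c - haar_mean f\<bar> / 3"
  have e: "e > 0" using ne by (simp add: e_def)
  obtain P where P: "ravg P" "\<And>x. x \<in> carrier G \<Longrightarrow> \<bar>P f x - c\<bar> \<le> e" using c[OF e] by auto
  obtain Q where Q: "ravg Q" "\<And>x. x \<in> carrier G \<Longrightarrow> \<bar>lavg Q f x - haar_mean f\<bar> \<le> e"
    using haar_mean_lavg[OF f e] by auto
  have "\<bar>c - haar_mean f\<bar> \<le> e + e" by (rule ravg_lavg_const_close[OF P Q])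
  moreover have "\<bar>c - haar_mean f\<bar> = 3 * e" by (simp add: e_def)
  ultimately show False using e by simp
qed

lemma haar_mean_cong:
  assumes "\<And>x. x \<in> carrier G \<Longrightarrow> f x = g x"
  shows "haar_mean f = haar_mean g"
proof -
  have "(ravg P \<and> (\<forall>x\<in>carrier G. a \<le> P f x)) = (ravg P \<and> (\<forall>x\<in>carrier G. a \<le> P g x))" for P a
    using ravg_cong[of P f g] assms by auto
  then show ?thesis unfolding haar_mean_def by simp
qed

text \<open>A left average that makes \<open>f\<close> nearly constant does the same to
  \<open>Q f\<close>, with the same constant, since it commutes with \<open>Q\<close>.\<close>

lemma haar_mean_of_ravg:
  assumes f: "continuous_map T euclideanreal f" and Q: "ravg Q"
  shows "haar_mean (Q f) = haar_mean f"
proof (rule ccontr)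
  assume ne: "haar_mean (Q f) \<noteq> haar_mean f"
  define e where "e = \<bar>haar_mean (Q f) - haar_mean f\<bar> / 3"
  have e: "e > 0" using ne by (simp add: e_def)
  obtain P where P: "ravg P" "\<And>x. x \<in> carrier G \<Longrightarrow> \<bar>P (Q f) x - haar_mean (Q f)\<bar> \<le> e"
    using haar_mean_ravg[OF ravg_continuous[OF Q f] e] by auto
  obtain L where L: "ravg L" "\<And>x. x \<in> carrier G \<Longrightarrow> \<bar>lavg L f x - haar_mean f\<bar> \<le> e"
    using haar_mean_lavg[OF f e] by auto
  have "\<bar>lavg L (Q f) x - haar_mean f\<bar> \<le> e" if x: "x \<in> carrier G" for x
  proof -
    have "Q (lavg L f) x \<le> haar_mean f + e" by (rule ravg_le[OF Q _ x]; use L(2) in \<open>force simp: abs_le_iff\<close>)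
    moreover have "haar_mean f - e \<le> Q (lavg L f) x" by (rule ravg_ge[OF Q _ x]; use L(2) in \<open>force simp: abs_le_iff\<close>)
    ultimately show ?thesis using lavg_ravg_commute[OF Q L(1) x, of f] by (simp add: abs_le_iff)
  qed
  from ravg_lavg_const_close[OF P L(1) this] have "\<bar>haar_mean (Q f) - haar_mean f\<bar> \<le> e + e" by simp
  moreover have "\<bar>haar_mean (Q f) - haar_mean f\<bar> = 3 * e" by (simp add: e_def)
  ultimately show False using e by simp
qed

text \<open>One operator must serve both summands. \<open>P\<close> is chosen for \<open>f\<close>,
  then \<open>Q\<close> for \<open>P g\<close>, whose mean is that of \<open>g\<close>; applying
  \<open>Q\<close> cannot move \<open>P f\<close> away from its constant.\<close>

lemma haar_mean_add:
  assumes f: "continuous_map T euclideanreal f" and g: "continuous_map T euclideanreal g"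
  shows "haar_mean (\<lambda>x. f x + g x) = haar_mean f + haar_mean g"
proof (rule haar_mean_unique)
  show "continuous_map T euclideanreal (\<lambda>x. f x + g x)" by (intro continuous_map_add f g)
  fix e :: real assume e: "e > 0"
  obtain P where P: "ravg P" "\<And>x. x \<in> carrier G \<Longrightarrow> \<bar>P f x - haar_mean f\<bar> \<le> e/2"
    using haar_mean_ravg[OF f, of "e/2"] e by auto
  obtain Q where Q: "ravg Q" "\<And>x. x \<in> carrier G \<Longrightarrow> \<bar>Q (P g) x - haar_mean g\<bar> \<le> e/2"
    using haar_mean_ravg[OF ravg_continuous[OF P(1) g], of "e/2"] haar_mean_of_ravg[OF g P(1)] e by auto
  have "\<bar>Q (P (\<lambda>x. f x + g x)) x - (haar_mean f + haar_mean g)\<bar> \<le> e" if x: "x \<in> carrier G" for x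
  proof -
    have "Q (P (\<lambda>x. f x + g x)) x = Q (\<lambda>x. P f x + P g x) x"
      by (rule ravg_cong[OF Q(1) _ x]) (use ravg_add[OF P(1)] in auto)
    also have "\<dots> = Q (P f) x + Q (P g) x" by (rule ravg_add[OF Q(1) x])
    finally have eq: "Q (P (\<lambda>x. f x + g x)) x = Q (P f) x + Q (P g) x" .
    have P': "haar_mean f - e/2 \<le> P f y" "P f y \<le> haar_mean f + e/2" if "y \<in> carrier G" for y
      using P(2)[OF that] by linarith+
    have "Q (P f) x \<le> haar_mean f + e/2" by (rule ravg_le[OF Q(1) P'(2) x])
    moreover have "haar_mean f - e/2 \<le> Q (P f) x" by (rule ravg_ge[OF Q(1) P'(1) x])
    ultimately show ?thesis using Q(2)[OF x] unfolding eq by linarith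
  qed
  then show "\<exists>R. ravg R \<and> (\<forall>x\<in>carrier G. \<bar>R (\<lambda>x. f x + g x) x - (haar_mean f + haar_mean g)\<bar> \<le> e)"
    using ravg.compose[OF Q(1) P(1)] by blast
qed

lemma haar_mean_scale:
  assumes f: "continuous_map T euclideanreal f"
  shows "haar_mean (\<lambda>x. c * f x) = c * haar_mean f"
proof (rule haar_mean_unique)
  show "continuous_map T euclideanreal (\<lambda>x. c * f x)" by (intro continuous_map_real_mult_left f)
  fix e :: real assume e: "e > 0"
  obtain P where P: "ravg P" "\<And>x. x \<in> carrier G \<Longrightarrow> \<bar>P f x - haar_mean f\<bar> \<le> e / (\<bar>c\<bar> + 1)"
    using haar_mean_ravg[OF f, of "e / (\<bar>c\<bar> + 1)"] e by auto
  have "\<bar>P (\<lambda>x. c * f x) x - c * haar_mean f\<bar> \<le> e" if x: "x \<in> carrier G" for x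
  proof -
    have "\<bar>P (\<lambda>x. c * f x) x - c * haar_mean f\<bar> = \<bar>c\<bar> * \<bar>P f x - haar_mean f\<bar>"
      by (simp add: ravg_scale[OF P(1) x] abs_mult[symmetric] right_diff_distrib)
    also have "\<dots> \<le> (\<bar>c\<bar> + 1) * (e / (\<bar>c\<bar> + 1))" by (intro mult_mono P(2) x) (use e in auto)
    also have "\<dots> = e" by (simp add: field_simps add_nonneg_eq_0_iff)
    finally show ?thesis .
  qed
  then show "\<exists>P. ravg P \<and> (\<forall>x\<in>carrier G. \<bar>P (\<lambda>x. c * f x) x - c * haar_mean f\<bar> \<le> e)"
    using P(1) by blast
qed

lemma haar_mean_const: "haar_mean (\<lambda>x. c) = c"
proof (rule haar_mean_unique)
  fix e :: real assume "e > 0"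
  then show "\<exists>P. ravg P \<and> (\<forall>x\<in>carrier G. \<bar>P (\<lambda>x. c) x - c\<bar> \<le> e)"
    using ravg.translate[OF one_closed] by (intro exI[of _ "\<lambda>f x. f (x \<otimes> \<one>)"]) auto
qed simp

lemma haar_mean_left_invariant:
  assumes f: "continuous_map T euclideanreal f" and a: "a \<in> carrier G"
  shows "haar_mean (\<lambda>x. f (a \<otimes> x)) = haar_mean f"
proof (rule haar_mean_unique)
  have "continuous_map T T (\<lambda>x. a \<otimes> x)"
    using continuous_map_mult[OF continuous_map_const_carrier[OF a] continuous_map_id[unfolded id_def]] .
  from continuous_map_compose[OF this f]
  show "continuous_map T euclideanreal (\<lambda>x. f (a \<otimes> x))" by (simp add: o_def)
  fix e :: real assume e: "e > 0"
  obtain P where P: "ravg P" "\<And>x. x \<in> carrier G \<Longrightarrow> \<bar>P f x - haar_mean f\<bar> \<le> e"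
    using haar_mean_ravg[OF f e] by auto
  then show "\<exists>P. ravg P \<and> (\<forall>x\<in>carrier G. \<bar>P (\<lambda>x. f (a \<otimes> x)) x - haar_mean f\<bar> \<le> e)"
    using ravg_left_translate[OF P(1) a] a by (intro exI[of _ P]) auto
qed

lemma haar_mean_le:
  assumes f: "continuous_map T euclideanreal f" and le: "\<And>x. x \<in> carrier G \<Longrightarrow> f x \<le> c"
  shows "haar_mean f \<le> c"
proof (rule field_le_epsilon)
  fix e :: real assume e: "e > 0"
  obtain P where P: "ravg P" "\<And>x. x \<in> carrier G \<Longrightarrow> \<bar>P f x - haar_mean f\<bar> \<le> e"
    using haar_mean_ravg[OF f e] by auto
  have "P f \<one> \<le> c" by (rule ravg_le[OF P(1)]) (use le in auto)
  then show "haar_mean f \<le> c + e" using P(2)[OF one_closed] by linarith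
qed

lemma haar_mean_diff_le:
  assumes f: "continuous_map T euclideanreal f" and g: "continuous_map T euclideanreal g"
    and le: "\<And>x. x \<in> carrier G \<Longrightarrow> \<bar>f x - g x\<bar> \<le> e"
  shows "\<bar>haar_mean f - haar_mean g\<bar> \<le> e"
proof -
  have 1: "haar_mean f - haar_mean g \<le> e"
    if f: "continuous_map T euclideanreal f" and g: "continuous_map T euclideanreal g"
    and le: "\<And>x. x \<in> carrier G \<Longrightarrow> \<bar>f x - g x\<bar> \<le> e" for f g
  proof -
    have "haar_mean f - haar_mean g = haar_mean (\<lambda>x. f x + (-1) * g x)"
      using haar_mean_add[OF f continuous_map_real_mult_left[OF g, of "-1"]] haar_mean_scale[OF g, of "-1"] by simp
    also have "\<dots> \<le> e"
      by (rule haar_mean_le) (use le in \<open>auto intro!: continuous_map_diff f g simp: abs_le_iff\<close>)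
    finally show ?thesis .
  qed
  show ?thesis using 1[OF f g le] 1[OF g f] le by (auto simp: abs_le_iff abs_minus_commute)
qed

text \<open>By the tube argument \<open>F y\<close> is uniformly close to \<open>F x\<close> for
  \<open>y\<close> near \<open>x\<close>, and the mean is 1-Lipschitz for the supremum norm.\<close>

lemma haar_mean_continuous:
  assumes F: "continuous_map (prod_topology X T) euclideanreal (\<lambda>(x, h). F x h)"
  shows "continuous_map X euclideanreal (\<lambda>x. haar_mean (F x))"
proof -
  have Fx: "continuous_map T euclideanreal (F x)" if "x \<in> topspace X" for x
  proof -
    have "continuous_map T (prod_topology X T) (\<lambda>h. (x, h))"
      using that by (intro continuous_map_pairedI) auto
    from continuous_map_compose[OF this F] show ?thesis by (simp add: o_def)
  qed
  have "\<exists>U. openin X U \<and> x \<in> U \<and> (\<forall>y\<in>U. haar_mean (F y) \<in> ball (haar_mean (F x)) e)"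
    if x: "x \<in> topspace X" and e: "e > 0" for x e
  proof -
    let ?W = "{p \<in> topspace (prod_topology X T). \<bar>F (fst p) (snd p) - F x (snd p)\<bar> \<in> {..<e/2}}"
    have "continuous_map (prod_topology X T) euclideanreal (\<lambda>p. F x (snd p))"
      using continuous_map_compose[OF continuous_map_snd Fx[OF x], of X] by (simp add: o_def)
    moreover have "continuous_map (prod_topology X T) euclideanreal (\<lambda>p. F (fst p) (snd p))"
      using F by (simp add: case_prod_unfold)
    ultimately have "continuous_map (prod_topology X T) euclideanreal (\<lambda>p. \<bar>F (fst p) (snd p) - F x (snd p)\<bar>)"
      by (intro continuous_map_real_abs continuous_map_diff)
    then have W: "openin (prod_topology X T) ?W"
      by (rule openin_continuous_map_preimage) auto
    have "{x} \<times> topspace T \<subseteq> ?W" using x e by auto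
    then obtain U where U: "openin X U" "x \<in> U" "U \<times> topspace T \<subseteq> ?W"
      by (rule compact_tube[OF compact W x])
    have "haar_mean (F y) \<in> ball (haar_mean (F x)) e" if y: "y \<in> U" for y
    proof -
      have yX: "y \<in> topspace X" using U(1) y openin_subset by blast
      have "\<bar>F y h - F x h\<bar> \<le> e/2" if "h \<in> carrier G" for h
      proof -
        have "(y, h) \<in> ?W" using U(3) y that topspace_eq by blast
        then show ?thesis by auto
      qed
      from haar_mean_diff_le[OF Fx[OF yX] Fx[OF x] this]
      show ?thesis using e by (simp add: dist_real_def abs_minus_commute)
    qed
    then show ?thesis using U by blast
  qed
  then have "\<forall>x\<in>topspace X. \<forall>e>0. \<exists>U. openin X U \<and> x \<in> U \<and> (\<forall>y\<in>U. haar_mean (F y) \<in> ball (haar_mean (F x)) e)"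
    by blast
  then show ?thesis by (subst Met_TC.continuous_map_to_metric[of X, unfolded mtopology_is_euclidean mball_eq_ball])
qed

end

subsection \<open>Complex-valued functions\<close>

lemma continuous_map_complex_mult [continuous_intros]:
  fixes f g :: "'a \<Rightarrow> complex"
  assumes "continuous_map X euclidean f" "continuous_map X euclidean g"
  shows "continuous_map X euclidean (\<lambda>x. f x * g x)"
proof -
  have "continuous_map (prod_topology euclidean euclidean) euclidean (\<lambda>(x::complex, y). x * y)"
    by (simp add: case_prod_unfold) (intro continuous_intros)
  from continuous_map_compose[OF continuous_map_pairedI[OF assms] this]
  show ?thesis by (simp add: o_def)
qed

lemma continuous_map_complex_prod:
  fixes f :: "'i \<Rightarrow> 'a \<Rightarrow> complex"
  assumes "\<And>i. i \<in> I \<Longrightarrow> continuous_map X euclidean (f i)"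
  shows "continuous_map X euclidean (\<lambda>x. \<Prod>i\<in>I. f i x)"
  using assms by (induction I rule: infinite_finite_induct) (auto intro!: continuous_map_complex_mult)

lemma continuous_map_complex_inverse:
  fixes f :: "'a \<Rightarrow> complex"
  assumes "continuous_map X euclidean f" "\<And>x. x \<in> topspace X \<Longrightarrow> f x \<noteq> 0"
  shows "continuous_map X euclidean (\<lambda>x. inverse (f x))"
proof -
  have "continuous_map X (top_of_set (- {0})) f"
    using assms by (auto simp: continuous_map_in_subtopology)
  moreover have "continuous_map (top_of_set (- {0})) euclidean (inverse :: complex \<Rightarrow> complex)"
    by (auto intro!: continuous_intros)
  ultimately show ?thesis using continuous_map_compose[of X _ f _ inverse] by (simp add: o_def)
qed

lemma continuous_map_Re:
  assumes "continuous_map X euclidean f" shows "continuous_map X euclideanreal (\<lambda>x. Re (f x))"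
proof -
  have "continuous_map euclidean euclideanreal Re" by (auto intro!: continuous_intros)
  from continuous_map_compose[OF assms this] show ?thesis by (simp add: o_def)
qed

lemma continuous_map_Im:
  assumes "continuous_map X euclidean f" shows "continuous_map X euclideanreal (\<lambda>x. Im (f x))"
proof -
  have "continuous_map euclidean euclideanreal Im" by (auto intro!: continuous_intros)
  from continuous_map_compose[OF assms this] show ?thesis by (simp add: o_def)
qed

lemma continuous_map_of_real:
  assumes "continuous_map X euclideanreal f"
  shows "continuous_map X euclidean (\<lambda>x. complex_of_real (f x))"
proof -
  have "continuous_map euclideanreal euclidean complex_of_real" by (auto intro!: continuous_intros)
  from continuous_map_compose[OF assms this] show ?thesis by (simp add: o_def)
qed

lemma continuous_map_Complex:
  assumes "continuous_map X euclideanreal f" "continuous_map X euclideanreal g"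
  shows "continuous_map X euclidean (\<lambda>x. Complex (f x) (g x))"
  unfolding Complex_eq
  by (intro continuous_intros continuous_map_of_real assms) auto

context compact_group begin

definition cmean :: "('g \<Rightarrow> complex) \<Rightarrow> complex" where
  "cmean f = Complex (haar_mean (\<lambda>x. Re (f x))) (haar_mean (\<lambda>x. Im (f x)))"

lemma cmean_cong: "(\<And>x. x \<in> carrier G \<Longrightarrow> f x = g x) \<Longrightarrow> cmean f = cmean g"
  unfolding cmean_def using haar_mean_cong[of "\<lambda>x. Re (f x)" "\<lambda>x. Re (g x)"]
    haar_mean_cong[of "\<lambda>x. Im (f x)" "\<lambda>x. Im (g x)"] by simp

lemma cmean_const: "cmean (\<lambda>x. c) = c"
  by (simp add: cmean_def haar_mean_const)

lemma cmean_add: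
  assumes "continuous_map T euclidean f" "continuous_map T euclidean g"
  shows "cmean (\<lambda>x. f x + g x) = cmean f + cmean g"
  using haar_mean_add[OF assms[THEN continuous_map_Re]] haar_mean_add[OF assms[THEN continuous_map_Im]]
  by (simp add: cmean_def complex_eq_iff)

lemma cmean_scale:
  assumes f: "continuous_map T euclidean f"
  shows "cmean (\<lambda>x. c * f x) = c * cmean f"
proof -
  note R = continuous_map_Re[OF f] and I = continuous_map_Im[OF f]
  have "haar_mean (\<lambda>x. Re c * Re (f x) - Im c * Im (f x)) = Re c * haar_mean (\<lambda>x. Re (f x)) - Im c * haar_mean (\<lambda>x. Im (f x))"
    using haar_mean_add[OF continuous_map_real_mult_left[OF R, of "Re c"] continuous_map_real_mult_left[OF I, of "- Im c"]]
      haar_mean_scale[OF R, of "Re c"] haar_mean_scale[OF I, of "- Im c"] by simp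
  moreover have "haar_mean (\<lambda>x. Re c * Im (f x) + Im c * Re (f x)) = Re c * haar_mean (\<lambda>x. Im (f x)) + Im c * haar_mean (\<lambda>x. Re (f x))"
    using haar_mean_add[OF continuous_map_real_mult_left[OF I, of "Re c"] continuous_map_real_mult_left[OF R, of "Im c"]]
      haar_mean_scale[OF I, of "Re c"] haar_mean_scale[OF R, of "Im c"] by simp
  ultimately show ?thesis by (simp add: cmean_def complex_eq_iff)
qed

lemma cmean_scale_right:
  assumes f: "continuous_map T euclidean f"
  shows "cmean (\<lambda>x. f x * c) = cmean f * c"
  using cmean_scale[OF f, of c] by (simp add: mult.commute)

lemma cmean_sum:
  assumes "\<And>i. i \<in> I \<Longrightarrow> continuous_map T euclidean (f i)"
  shows "cmean (\<lambda>x. \<Sum>i\<in>I. f i x) = (\<Sum>i\<in>I. cmean (f i))"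
  using assms
proof (induction I rule: infinite_finite_induct)
  case (insert i I)
  have "continuous_map T euclidean (\<lambda>x. \<Sum>i\<in>I. f i x)" by (rule continuous_map_sum) (use insert in auto)
  then show ?case using insert cmean_add[of "f i" "\<lambda>x. \<Sum>i\<in>I. f i x"] by simp
qed (auto simp: cmean_const)

lemma cmean_left_invariant:
  assumes f: "continuous_map T euclidean f" and a: "a \<in> carrier G"
  shows "cmean (\<lambda>x. f (a \<otimes> x)) = cmean f"
  using haar_mean_left_invariant[OF continuous_map_Re[OF f] a]
    haar_mean_left_invariant[OF continuous_map_Im[OF f] a]
  by (simp add: cmean_def)

lemma cmean_continuous:
  assumes F: "continuous_map (prod_topology X T) euclidean (\<lambda>(x, h). F x h)"
  shows "continuous_map X euclidean (\<lambda>x. cmean (F x))"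
  unfolding cmean_def
  using continuous_map_Re[OF F] continuous_map_Im[OF F]
  by (intro continuous_map_Complex haar_mean_continuous) (simp_all add: case_prod_unfold)

end

section \<open>Closed subgroups of compact groups\<close>

lemma compact_group_subgroup:
  fixes G (structure)
  assumes "compact_group G T" "subgroup K G" "closedin T K"
  shows "compact_group (G\<lparr>carrier := K\<rparr>) (subtopology T K)"
proof -
  interpret compact_group G T by fact
  have K: "K \<subseteq> carrier G" using assms(2) by (rule subgroup.subset)
  interpret K: group "G\<lparr>carrier := K\<rparr>" using subgroup_imp_group[OF assms(2)] .
  show ?thesis
  proof
    show "topspace (subtopology T K) = carrier (G\<lparr>carrier := K\<rparr>)"
      using K by (auto simp: topspace_eq)
    show "compact_space (subtopology T K)"
      using closedin_compact_space[OF compact assms(3)] compact_space_subtopology by blast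
    have "continuous_map (prod_topology (subtopology T K) (subtopology T K)) T (\<lambda>p. fst p \<otimes> snd p)"
      by (intro continuous_map_mult continuous_map_into_fulltopology[OF continuous_map_fst]
          continuous_map_into_fulltopology[OF continuous_map_snd])
    then show "continuous_map (prod_topology (subtopology T K) (subtopology T K)) (subtopology T K)
        (\<lambda>(g, h). g \<otimes>\<^bsub>G\<lparr>carrier := K\<rparr>\<^esub> h)"
      unfolding continuous_map_in_subtopology case_prod_unfold
      using subgroup.m_closed[OF assms(2)] by (auto simp: image_subset_iff)
    have "continuous_map (subtopology T K) (subtopology T K) (\<lambda>g. inv g)"
      unfolding continuous_map_in_subtopology
      using continuous_map_from_subtopology[OF inv_cont] subgroup.m_inv_closed[OF assms(2)]
      by (auto simp: image_subset_iff)
    then show "continuous_map (subtopology T K) (subtopology T K) (\<lambda>g. inv\<^bsub>G\<lparr>carrier := K\<rparr>\<^esub> g)"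
      by (rule continuous_map_eq) (use m_inv_consistent[OF assms(2)] in auto)
  qed
qed

section \<open>Continuous families of matrices\<close>

text \<open>The type of matrices contains all sizes, so a continuous family is described by a fixed
  size together with continuous entries.\<close>

definition cmat :: "'a topology \<Rightarrow> nat \<Rightarrow> ('a \<Rightarrow> complex mat) \<Rightarrow> bool" where
  "cmat X n F \<longleftrightarrow> (\<forall>x\<in>topspace X. F x \<in> carrier_mat n n) \<and>
     (\<forall>i<n. \<forall>j<n. continuous_map X euclidean (\<lambda>x. F x $$ (i, j)))"

lemma cmatI:
  assumes "\<And>x. x \<in> topspace X \<Longrightarrow> F x \<in> carrier_mat n n"
    "\<And>i j. i < n \<Longrightarrow> j < n \<Longrightarrow> continuous_map X euclidean (\<lambda>x. F x $$ (i, j))"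
  shows "cmat X n F"
  using assms by (auto simp: cmat_def)

lemma cmat_carrier: "cmat X n F \<Longrightarrow> x \<in> topspace X \<Longrightarrow> F x \<in> carrier_mat n n"
  and cmat_entry: "cmat X n F \<Longrightarrow> i < n \<Longrightarrow> j < n \<Longrightarrow> continuous_map X euclidean (\<lambda>x. F x $$ (i, j))"
  by (auto simp: cmat_def)

lemma cmat_cong:
  assumes "cmat X n F" "\<And>x. x \<in> topspace X \<Longrightarrow> F x = G x" shows "cmat X n G"
  using assms unfolding cmat_def by (metis (no_types, lifting) continuous_map_eq)

lemma cmat_const: "A \<in> carrier_mat n n \<Longrightarrow> cmat X n (\<lambda>x. A)"
  by (auto simp: cmat_def)

lemma cmat_compose:
  assumes "continuous_map X Y f" "cmat Y n F" shows "cmat X n (\<lambda>x. F (f x))"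
proof (rule cmatI)
  show "F (f x) \<in> carrier_mat n n" if "x \<in> topspace X" for x
    using assms that by (auto simp: cmat_def continuous_map_def)
  show "continuous_map X euclidean (\<lambda>x. F (f x) $$ (i, j))" if "i < n" "j < n" for i j
    using continuous_map_compose[OF assms(1) cmat_entry[OF assms(2) that]] by (simp add: o_def)
qed

lemma cmat_subtopology: "cmat X n F \<Longrightarrow> cmat (subtopology X S) n F"
  by (auto simp: cmat_def intro: continuous_map_from_subtopology)

lemma mult_entry:
  assumes "A \<in> carrier_mat n m" "B \<in> carrier_mat m k" "i < n" "j < k"
  shows "(A * B) $$ (i, j) = (\<Sum>l<m. A $$ (i, l) * B $$ (l, j))"
  using assms by (auto simp: scalar_prod_def atLeast0LessThan)

lemma mult_vec_entry:
  assumes "A \<in> carrier_mat n m" "v \<in> carrier_vec m" "i < n"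
  shows "(A *\<^sub>v v) $ i = (\<Sum>l<m. A $$ (i, l) * v $ l)"
  using assms by (auto simp: scalar_prod_def atLeast0LessThan)

lemma cmat_mult:
  assumes "cmat X n F" "cmat X n G" shows "cmat X n (\<lambda>x. F x * G x)"
proof (rule cmatI)
  show "F x * G x \<in> carrier_mat n n" if "x \<in> topspace X" for x
    using cmat_carrier[OF assms(1) that] cmat_carrier[OF assms(2) that] by simp
  show "continuous_map X euclidean (\<lambda>x. (F x * G x) $$ (i, j))" if "i < n" "j < n" for i j
  proof (rule continuous_map_eq)
    show "continuous_map X euclidean (\<lambda>x. \<Sum>l<n. F x $$ (i, l) * G x $$ (l, j))"
      using that by (auto intro!: continuous_map_sum continuous_map_complex_mult cmat_entry[OF assms(1)] cmat_entry[OF assms(2)])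
    show "(\<Sum>l<n. F x $$ (i, l) * G x $$ (l, j)) = (F x * G x) $$ (i, j)" if "x \<in> topspace X" for x
      using cmat_carrier[OF assms(1) that] cmat_carrier[OF assms(2) that] \<open>i < n\<close> \<open>j < n\<close>
      by (simp only: mult_entry)
  qed
qed

lemma cmat_add:
  assumes "cmat X n F" "cmat X n G" shows "cmat X n (\<lambda>x. F x + G x)"
proof (rule cmatI)
  show "F x + G x \<in> carrier_mat n n" if "x \<in> topspace X" for x
    using cmat_carrier[OF assms(1) that] cmat_carrier[OF assms(2) that] by simp
  show "continuous_map X euclidean (\<lambda>x. (F x + G x) $$ (i, j))" if "i < n" "j < n" for i j
  proof (rule continuous_map_eq)
    show "continuous_map X euclidean (\<lambda>x. F x $$ (i, j) + G x $$ (i, j))"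
      using that by (intro continuous_map_add cmat_entry[OF assms(1)] cmat_entry[OF assms(2)])
    show "F x $$ (i, j) + G x $$ (i, j) = (F x + G x) $$ (i, j)" if "x \<in> topspace X" for x
      using cmat_carrier[OF assms(1) that] cmat_carrier[OF assms(2) that] \<open>i < n\<close> \<open>j < n\<close> by auto
  qed
qed

lemma cmat_smult:
  assumes "continuous_map X euclidean c" "cmat X n F" shows "cmat X n (\<lambda>x. c x \<cdot>\<^sub>m F x)"
proof (rule cmatI)
  show "c x \<cdot>\<^sub>m F x \<in> carrier_mat n n" if "x \<in> topspace X" for x
    using cmat_carrier[OF assms(2) that] by simp
  show "continuous_map X euclidean (\<lambda>x. (c x \<cdot>\<^sub>m F x) $$ (i, j))" if "i < n" "j < n" for i j
  proof (rule continuous_map_eq)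
    show "continuous_map X euclidean (\<lambda>x. c x * F x $$ (i, j))"
      using that by (intro continuous_map_complex_mult assms(1) cmat_entry[OF assms(2)])
    show "c x * F x $$ (i, j) = (c x \<cdot>\<^sub>m F x) $$ (i, j)" if "x \<in> topspace X" for x
      using cmat_carrier[OF assms(2) that] \<open>i < n\<close> \<open>j < n\<close> by auto
  qed
qed

lemma continuous_map_det:
  assumes "cmat X n F" shows "continuous_map X euclidean (\<lambda>x. det (F x))"
proof (rule continuous_map_eq)
  show "continuous_map X euclidean
      (\<lambda>x. \<Sum>p \<in> {p. p permutes {0..<n}}. signof p * (\<Prod>i = 0..<n. F x $$ (i, p i)))"
    by (intro continuous_map_sum continuous_map_complex_mult continuous_map_complex_prod cmat_entry[OF assms])
      (auto simp: finite_permutations dest: permutes_in_image)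
  show "(\<Sum>p \<in> {p. p permutes {0..<n}}. signof p * (\<Prod>i = 0..<n. F x $$ (i, p i))) = det (F x)"
    if "x \<in> topspace X" for x
    using det_def'[OF cmat_carrier[OF assms that]] by simp
qed

text \<open>Cramer's formula. It is total and built from determinants, so continuity of inversion
  reduces to continuity of determinants.\<close>

definition minv :: "complex mat \<Rightarrow> complex mat" where
  "minv A = inverse (det A) \<cdot>\<^sub>m adj_mat A"

lemma minv:
  assumes A: "A \<in> carrier_mat n n" and d: "det A \<noteq> 0"
  shows "minv A \<in> carrier_mat n n" "A * minv A = 1\<^sub>m n" "minv A * A = 1\<^sub>m n"
proof -
  note a = adj_mat[OF A]
  show "minv A \<in> carrier_mat n n" using a by (simp add: minv_def)
  have "A * minv A = inverse (det A) \<cdot>\<^sub>m (A * adj_mat A)"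
    unfolding minv_def using A a by (simp add: mult_smult_distrib)
  then show "A * minv A = 1\<^sub>m n" using a d by (auto intro!: eq_matI)
  have "minv A * A = inverse (det A) \<cdot>\<^sub>m (adj_mat A * A)"
    unfolding minv_def using A a by (simp add: mult_smult_assoc_mat)
  then show "minv A * A = 1\<^sub>m n" using a d by (auto intro!: eq_matI)
qed

lemma cmat_minv:
  assumes F: "cmat X n F" and d: "\<And>x. x \<in> topspace X \<Longrightarrow> det (F x) \<noteq> 0"
  shows "cmat X n (\<lambda>x. minv (F x))"
  unfolding minv_def
proof (rule cmat_smult)
  show "continuous_map X euclidean (\<lambda>x. inverse (det (F x)))"
    by (rule continuous_map_complex_inverse[OF continuous_map_det[OF F] d])
  show "cmat X n (\<lambda>x. adj_mat (F x))"
  proof (rule cmatI)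
    show "adj_mat (F x) \<in> carrier_mat n n" if "x \<in> topspace X" for x
      using adj_mat(1)[OF cmat_carrier[OF F that]] .
    show "continuous_map X euclidean (\<lambda>x. adj_mat (F x) $$ (i, j))" if ij: "i < n" "j < n" for i j
    proof (rule continuous_map_eq)
      have "cmat X (n - 1) (\<lambda>x. mat_delete (F x) j i)"
      proof (rule cmatI)
        show "mat_delete (F x) j i \<in> carrier_mat (n - 1) (n - 1)" if "x \<in> topspace X" for x
          using cmat_carrier[OF F that] by (auto simp: mat_delete_def)
        show "continuous_map X euclidean (\<lambda>x. mat_delete (F x) j i $$ (i', j'))"
          if ij': "i' < n - 1" "j' < n - 1" for i' j'
        proof (rule continuous_map_eq)
          show "continuous_map X euclidean
              (\<lambda>x. F x $$ (if i' < j then i' else Suc i', if j' < i then j' else Suc j'))"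
            by (rule cmat_entry[OF F]) (use ij ij' in auto)
          fix x assume "x \<in> topspace X"
          then have "dim_row (F x) = n" "dim_col (F x) = n" using cmat_carrier[OF F] by auto
          then show "F x $$ (if i' < j then i' else Suc i', if j' < i then j' else Suc j') = mat_delete (F x) j i $$ (i', j')"
            using ij' by (simp add: mat_delete_def)
        qed
      qed
      then show "continuous_map X euclidean (\<lambda>x. (-1) ^ (j + i) * det (mat_delete (F x) j i))"
        by (intro continuous_map_complex_mult continuous_map_det) auto
      fix x assume "x \<in> topspace X"
      then have "dim_row (F x) = n" "dim_col (F x) = n" using cmat_carrier[OF F] by auto
      then show "(-1) ^ (j + i) * det (mat_delete (F x) j i) = adj_mat (F x) $$ (i, j)"
        using ij by (simp add: adj_mat_def cofactor_def)
    qed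
  qed
qed

section \<open>Continuous families of vectors\<close>

lemma continuous_map_cvec:
  "continuous_map X (cvec_topology n) f \<longleftrightarrow>
     (\<forall>x\<in>topspace X. f x \<in> carrier_vec n) \<and> (\<forall>i<n. continuous_map X euclidean (\<lambda>x. f x $ i))"
  (is "?L \<longleftrightarrow> ?R")
proof
  assume L: ?L
  have "f ` topspace X \<subseteq> topspace (cvec_topology n)" using L continuous_map_image_subset_topspace by blast
  then have "\<forall>x\<in>topspace X. f x \<in> carrier_vec n"
    by (auto simp: cvec_topology_def topspace_pullback_topology)
  moreover have "continuous_map X euclidean (\<lambda>x. f x $ i)" if i: "i < n" for i
  proof -
    have "continuous_map (product_topology (\<lambda>_. euclidean :: complex topology) {..<n}) euclidean (\<lambda>v. v i)"
      using i by (intro continuous_map_product_projection) simp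
    from continuous_map_pullback[OF this, of "carrier_vec n" "\<lambda>v. \<lambda>i\<in>{..<n}. v $ i"]
    have "continuous_map (cvec_topology n) euclidean (\<lambda>v. v $ i)"
      using i by (simp add: cvec_topology_def o_def)
    from continuous_map_compose[OF L this] show ?thesis by (simp add: o_def)
  qed
  ultimately show ?R by blast
next
  assume R: ?R
  show ?L unfolding cvec_topology_def
  proof (rule continuous_map_pullback')
    show "continuous_map X (product_topology (\<lambda>_. euclidean) {..<n}) ((\<lambda>v. \<lambda>i\<in>{..<n}. v $ i) \<circ> f)"
      using R by (auto simp: continuous_map_componentwise o_def)
    show "topspace X \<subseteq> f -` carrier_vec n" using R by blast
  qed
qed

lemma topspace_cvec: "topspace (cvec_topology n) = carrier_vec n"
  by (auto simp: cvec_topology_def topspace_pullback_topology)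

lemma continuous_map_mult_vec:
  assumes F: "cmat X n F" and v: "continuous_map X (cvec_topology n) v"
  shows "continuous_map X (cvec_topology n) (\<lambda>x. F x *\<^sub>v v x)"
  unfolding continuous_map_cvec
proof (intro conjI ballI allI impI)
  note v' = v[unfolded continuous_map_cvec]
  show "F x *\<^sub>v v x \<in> carrier_vec n" if "x \<in> topspace X" for x
    using cmat_carrier[OF F that] v' that by auto
  show "continuous_map X euclidean (\<lambda>x. (F x *\<^sub>v v x) $ i)" if i: "i < n" for i
  proof (rule continuous_map_eq)
    show "continuous_map X euclidean (\<lambda>x. \<Sum>l<n. F x $$ (i, l) * v x $ l)"
      using i v' by (auto intro!: continuous_map_sum continuous_map_complex_mult cmat_entry[OF F])
    show "(\<Sum>l<n. F x $$ (i, l) * v x $ l) = (F x *\<^sub>v v x) $ i" if "x \<in> topspace X" for x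
      using mult_vec_entry[OF cmat_carrier[OF F that], of "v x" i] v' that i by simp
  qed
qed

section \<open>Square complex matrices\<close>

lemma sq_mult: "A \<in> carrier_mat n n \<Longrightarrow> B \<in> carrier_mat n n \<Longrightarrow> A * B \<in> carrier_mat n n"
  for A B :: "'a::semiring_0 mat"
  by simp

lemma sq_assoc: "A \<in> carrier_mat n n \<Longrightarrow> B \<in> carrier_mat n n \<Longrightarrow> C \<in> carrier_mat n n \<Longrightarrow> A * B * C = A * (B * C)"
  for A B C :: "'a::semiring_0 mat"
  by (rule assoc_mult_mat)

lemma sq_distribs:
  fixes A B C :: "'a::comm_ring_1 mat"
  assumes "A \<in> carrier_mat n n" "B \<in> carrier_mat n n"
  shows "C \<in> carrier_mat n n \<Longrightarrow> A * (B + C) = A * B + A * C"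
    "C \<in> carrier_mat n n \<Longrightarrow> (A + B) * C = A * C + B * C"
    "A * (c \<cdot>\<^sub>m B) = c \<cdot>\<^sub>m (A * B)" "c \<cdot>\<^sub>m A * B = c \<cdot>\<^sub>m (A * B)"
  using assms by (simp_all add: mult_add_distrib_mat[of _ n n _ n] add_mult_distrib_mat[of _ n n _ _ n]
      mult_smult_distrib[of _ n n _ n] mult_smult_assoc_mat[of _ n n _ n])

lemma sq_cancel:
  fixes Q :: "'a::comm_ring_1 mat"
  assumes "Q * P = 1\<^sub>m n" "Q \<in> carrier_mat n n" "P \<in> carrier_mat n n" "X \<in> carrier_mat n n"
  shows "Q * (P * X) = X"
  using assms by (simp add: sq_assoc[of Q n P X, symmetric])

lemma sum_fun_apply: "(\<Sum>j\<in>S. h j) x = (\<Sum>j\<in>S. h j x)"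
  for h :: "'a \<Rightarrow> 'b \<Rightarrow> 'c::comm_monoid_add"
  by (induction S rule: infinite_finite_induct) auto

section \<open>Traces, triangular form and generalized inverses\<close>

definition tr :: "complex mat \<Rightarrow> complex" where
  "tr A = (\<Sum>i<dim_row A. A $$ (i, i))"

lemma character_eq_tr: "character \<sigma> h = tr (\<sigma> h)"
  by (simp add: character_def tr_def)

lemma tr_mult_comm:
  assumes "A \<in> carrier_mat n n" "B \<in> carrier_mat n n" shows "tr (A * B) = tr (B * A)"
proof -
  have "tr (A * B) = (\<Sum>i<n. \<Sum>l<n. A $$ (i, l) * B $$ (l, i))"
    using assms unfolding tr_def by (auto intro!: sum.cong simp del: index_mult_mat(1) simp: mult_entry[OF assms])
  also have "\<dots> = (\<Sum>l<n. \<Sum>i<n. B $$ (l, i) * A $$ (i, l))"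
    by (subst sum.swap) (simp add: mult.commute)
  also have "\<dots> = tr (B * A)"
    using assms unfolding tr_def by (auto intro!: sum.cong simp del: index_mult_mat(1) simp: mult_entry[OF assms(2,1)])
  finally show ?thesis .
qed

lemma tr_add: "A \<in> carrier_mat n n \<Longrightarrow> B \<in> carrier_mat n n \<Longrightarrow> tr (A + B) = tr A + tr B"
  by (auto simp: tr_def sum.distrib)

lemma tr_minus: "A \<in> carrier_mat n n \<Longrightarrow> B \<in> carrier_mat n n \<Longrightarrow> tr (A - B) = tr A - tr B"
  by (auto simp: tr_def sum_subtractf)

lemma tr_similar:
  assumes "P \<in> carrier_mat n n" "B \<in> carrier_mat n n" "Q \<in> carrier_mat n n" "Q * P = 1\<^sub>m n"
  shows "tr (P * B * Q) = tr B"
proof -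
  have "tr (P * B * Q) = tr (P * (B * Q))" using assms by (simp add: sq_assoc)
  also have "\<dots> = tr (B * Q * P)" using assms by (simp add: tr_mult_comm[of P n])
  also have "\<dots> = tr (B * (Q * P))" using assms by (simp only: sq_assoc)
  also have "\<dots> = tr B" using assms by simp
  finally show ?thesis .
qed

lemma schur_form:
  assumes A: "A \<in> carrier_mat n n"
  obtains B P Q :: "complex mat" where "B \<in> carrier_mat n n" "P \<in> carrier_mat n n" "Q \<in> carrier_mat n n"
    "P * Q = 1\<^sub>m n" "Q * P = 1\<^sub>m n" "A = P * B * Q" "\<And>i j. j < i \<Longrightarrow> i < n \<Longrightarrow> B $$ (i, j) = 0"
proof -
  obtain es where "char_poly A = (\<Prod>a\<leftarrow>es. [:- a, 1:])" using char_poly_factorized[OF A] by blast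
  from schur_decomposition_exists[OF A this] obtain B P Q where
    B: "B \<in> carrier_mat n n" "upper_triangular B" and w: "similar_mat_wit A B P Q"
    by (auto simp: similar_mat_def)
  show ?thesis
    by (rule that[of B P Q]) (use similar_mat_witD2[OF A w] B in \<open>auto simp: upper_triangular_def\<close>)
qed

text \<open>The trace of an idempotent is its rank. In triangular form the diagonal is idempotent
  entrywise, hence consists of zeros and ones; a strictly triangular idempotent is nilpotent and so
  vanishes.\<close>

lemma idempotent_trace:
  assumes A: "A \<in> carrier_mat n n" and idem: "A * A = A"
  obtains k :: nat where "tr A = of_nat k" "k \<le> n" "k = 0 \<Longrightarrow> A = 0\<^sub>m n n"
proof -
  from schur_form[OF A] obtain B P Q where BPQ: "B \<in> carrier_mat n n" "P \<in> carrier_mat n n" "Q \<in> carrier_mat n n"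
    and PQ: "P * Q = 1\<^sub>m n" "Q * P = 1\<^sub>m n" and AB: "A = P * B * Q"
    and ut: "\<And>i j. j < i \<Longrightarrow> i < n \<Longrightarrow> B $$ (i, j) = 0" by blast
  have "B = (Q * P) * B * (Q * P)" using BPQ PQ by simp
  also have "\<dots> = Q * A * P" unfolding AB using BPQ by (simp add: sq_assoc[of _ n] sq_mult[of _ n])
  finally have B: "B = Q * A * P" .
  have "B * B = Q * A * (P * Q) * A * P" unfolding B using BPQ A by (simp add: sq_assoc[of _ n] sq_mult[of _ n])
  also have "\<dots> = Q * (A * A) * P" unfolding PQ using BPQ A by (simp add: sq_assoc[of _ n] sq_mult[of _ n])
  finally have BB: "B * B = B" unfolding idem B .
  have entry: "B $$ (i, j) = (\<Sum>l<n. B $$ (i, l) * B $$ (l, j))" if "i < n" "j < n" for i j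
    using mult_entry[OF BPQ(1) BPQ(1) that] BB by simp
  have diag: "B $$ (i, i) \<in> {0, 1}" if i: "i < n" for i
  proof -
    have "B $$ (i, i) = (\<Sum>l<n. B $$ (i, l) * B $$ (l, i))" by (rule entry[OF i i])
    also have "\<dots> = (\<Sum>l<n. if l = i then B $$ (i, i) * B $$ (i, i) else 0)"
    proof (rule sum.cong)
      fix l assume "l \<in> {..<n}"
      then show "B $$ (i, l) * B $$ (l, i) = (if l = i then B $$ (i, i) * B $$ (i, i) else 0)"
        using ut[of l i] ut[of i l] i by (cases l i rule: linorder_cases) auto
    qed simp
    also have "\<dots> = B $$ (i, i) * B $$ (i, i)" using i by simp
    finally have "B $$ (i, i) * (B $$ (i, i) - 1) = 0" by (simp add: algebra_simps)
    then show ?thesis by auto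
  qed
  define k where "k = card {i. i < n \<and> B $$ (i, i) = 1}"
  have "tr A = tr B" unfolding AB using tr_similar[OF BPQ(2,1,3) PQ(2)] .
  also have "\<dots> = (\<Sum>i<n. if B $$ (i, i) = 1 then 1 else 0)"
    unfolding tr_def using BPQ diag by (intro sum.cong) auto
  also have "\<dots> = of_nat k" by (simp add: k_def sum.If_cases Int_def)
  finally have 1: "tr A = of_nat k" .
  have 2: "k \<le> n" unfolding k_def using card_mono[of "{..<n}" "{i. i < n \<and> B $$ (i, i) = 1}"] by auto
  have 3: "A = 0\<^sub>m n n" if "k = 0"
  proof -
    have d0: "B $$ (i, i) = 0" if "i < n" for i
      using \<open>k = 0\<close> diag[OF that] that by (auto simp: k_def)
    \<comment> \<open>The equation \<open>B = B * B\<close> clears one further superdiagonal at a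
      time: in each product one of the factors lies in the region already known to be zero.\<close>
    have "\<forall>i<n. \<forall>j<n. j \<le> i + d \<longrightarrow> B $$ (i, j) = 0" for d
    proof (induction d)
      case 0
      show ?case using ut d0 by (auto simp: le_less)
    next
      case (Suc d)
      show ?case
      proof (intro allI impI)
        fix i j assume ij: "i < n" "j < n" "j \<le> i + Suc d"
        show "B $$ (i, j) = 0" unfolding entry[OF ij(1,2)]
        proof (rule sum.neutral, safe)
          fix l assume "l < n"
          then show "B $$ (i, l) * B $$ (l, j) = 0"
            using Suc.IH ij by (cases "l \<le> i + d") auto
        qed
      qed
    qed
    from this[of n] have "B = 0\<^sub>m n n" using BPQ by (intro eq_matI) auto
    then show ?thesis unfolding AB using BPQ by simp
  qed
  show ?thesis using that[OF 1 2 3] .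
qed

text \<open>A linear map has a linear right inverse on its range, extended to the whole space; its
  matrix is \<open>R\<close>. Averaging \<open>R\<close> later preserves the equation
  \<open>A * R * A = A\<close> when \<open>A\<close> is an intertwiner.\<close>

lemma generalized_inverse:
  fixes A :: "complex mat"
  assumes A: "A \<in> carrier_mat n n"
  obtains R where "R \<in> carrier_mat n n" "A * R * A = A"
proof -
  interpret vector_space_pair "\<lambda>(c::complex) (f::nat \<Rightarrow> complex) i. c * f i" "\<lambda>(c::complex) (f::nat \<Rightarrow> complex) i. c * f i"
    by standard (auto simp: fun_eq_iff algebra_simps)
  \<comment> \<open>The space of all functions on the naturals stands for the space of vectors of
    length \<open>n\<close>: \<open>f\<close> reads only the first \<open>n\<close> coordinates and
    vanishes beyond them, so the rest of the space has no influence.\<close>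
  define f where "f = (\<lambda>(v::nat \<Rightarrow> complex) i. if i < n then \<Sum>j<n. A $$ (i, j) * v j else 0)"
  have f: "Vector_Spaces.linear (\<lambda>c f i. c * f i) (\<lambda>c f i. c * f i) f"
    unfolding f_def
    by standard (auto simp: fun_eq_iff algebra_simps sum.distrib sum_distrib_left)
  from linear_exists_right_inverse_on[OF f vs1.subspace_UNIV]
  obtain g where g: "Vector_Spaces.linear (\<lambda>c f i. c * f i) (\<lambda>c f i. c * f i) g"
    and fg: "\<And>v. f (g (f v)) = f v" by auto
  define e where "e j = (\<lambda>i. if i = j then 1 else 0 :: complex)" for j :: nat
  define R where "R = Matrix.mat n n (\<lambda>(i, j). g (e j) i)"
  have R: "R \<in> carrier_mat n n" by (simp add: R_def)
  have gsum: "g (\<lambda>i. if i < n then w i else 0) k = (\<Sum>j<n. w j * g (e j) k)" for w k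
  proof -
    interpret g: Vector_Spaces.linear "\<lambda>(c::complex) (f::nat \<Rightarrow> complex) i. c * f i" "\<lambda>(c::complex) (f::nat \<Rightarrow> complex) i. c * f i" g
      by (rule g)
    have "(\<lambda>i. if i < n then w i else 0) = (\<Sum>j<n. (\<lambda>i. w j * e j i))"
      by (auto simp: fun_eq_iff e_def sum_fun_apply if_distrib cong: if_cong)
    then show ?thesis by (simp add: g.sum g.scale sum_fun_apply)
  qed
  have "A * R * A = A"
  proof (rule eq_matI)
    fix i j assume "i < dim_row A" "j < dim_col A"
    then have ij: "i < n" "j < n" using A by auto
    have fe: "f (e j) = (\<lambda>i. if i < n then A $$ (i, j) else 0)"
      using ij unfolding f_def e_def by (auto simp: fun_eq_iff if_distrib cong: if_cong)
    have "A $$ (i, j) = f (e j) i" using ij by (simp add: fe)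
    also have "\<dots> = f (g (f (e j))) i" by (simp add: fg)
    also have "\<dots> = (\<Sum>k<n. A $$ (i, k) * (\<Sum>l<n. A $$ (l, j) * g (e l) k))"
      unfolding fe using ij by (simp add: f_def gsum)
    also have "\<dots> = (\<Sum>k<n. A $$ (i, k) * (R * A) $$ (k, j))"
    proof (intro sum.cong refl arg_cong2[where f="(*)"])
      fix k assume "k \<in> {..<n}"
      then show "(\<Sum>l<n. A $$ (l, j) * g (e l) k) = (R * A) $$ (k, j)"
        using mult_entry[OF R A _ ij(2), of k] by (simp add: R_def mult.commute)
    qed
    also have "\<dots> = (A * (R * A)) $$ (i, j)"
      using mult_entry[OF A _ ij, of "R * A"] A R by simp
    finally show "(A * R * A) $$ (i, j) = A $$ (i, j)" using sq_assoc[OF A R A] by simp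
  qed (use A R in auto)
  with R show ?thesis using that by blast
qed

subsection \<open>Square roots as polynomials\<close>

text \<open>Going from \<open>m\<close> to \<open>(X - a) m\<close>, replace \<open>f\<close> by \<open>f + c m\<close>, where \<open>c\<close> solves a quadratic
  equation; if \<open>m(a) = 0\<close>, then \<open>f(a)\<^sup>2 = a \<noteq> 0\<close>, so the equation is solvable in this case as well.\<close>

lemma poly_sqrt_mod:
  fixes es :: "complex list"
  assumes "0 \<notin> set es"
  shows "\<exists>f. (\<Prod>a\<leftarrow>es. [:- a, 1:]) dvd f\<^sup>2 - [:0, 1:]"
  using assms
proof (induction es)
  case (Cons a es)
  define m where "m = (\<Prod>a\<leftarrow>es. [:- a, 1:])"
  obtain f u where fu: "f\<^sup>2 - [:0, 1:] = m * u" using Cons unfolding m_def by (auto elim!: dvdE)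
  have a: "a \<noteq> 0" using Cons.prems by auto
  have "\<exists>c. poly u a + 2 * c * poly f a + c\<^sup>2 * poly m a = 0"
  proof (cases "poly m a = 0")
    case True
    have "poly (f\<^sup>2 - [:0, 1:]) a = poly (m * u) a" by (simp only: fu)
    then have "(poly f a)\<^sup>2 = a" using True by simp
    then have "poly f a \<noteq> 0" using a by auto
    then show ?thesis using True by (intro exI[of _ "- poly u a / (2 * poly f a)"]) (simp add: field_simps)
  next
    case False
    \<comment> \<open>A quarter of the discriminant of the quadratic equation for
      \<open>c\<close>.\<close>
    define D where "D = (poly f a)\<^sup>2 - poly m a * poly u a"
    define c where "c = (csqrt D - poly f a) / poly m a"
    have "poly m a * (poly u a + 2 * c * poly f a + c\<^sup>2 * poly m a)
        = (poly m a * c + poly f a)\<^sup>2 - D"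
      by (simp add: D_def power2_eq_square algebra_simps)
    also have "poly m a * c + poly f a = csqrt D" using False by (simp add: c_def)
    finally show ?thesis using False by auto
  qed
  then obtain c where c: "poly u a + 2 * c * poly f a + c\<^sup>2 * poly m a = 0" by blast
  define g where "g = f + Polynomial.smult c m"
  have "g\<^sup>2 - [:0, 1:] = (f\<^sup>2 - [:0, 1:]) + m * (Polynomial.smult (2 * c) f + Polynomial.smult (c\<^sup>2) m)"
    by (simp add: g_def poly_eq_poly_eq_iff[symmetric] fun_eq_iff power2_eq_square algebra_simps)
  also have "\<dots> = m * (u + Polynomial.smult (2 * c) f + Polynomial.smult (c\<^sup>2) m)"
    unfolding fu by (simp add: algebra_simps)
  finally have g: "g\<^sup>2 - [:0, 1:] = m * (u + Polynomial.smult (2 * c) f + Polynomial.smult (c\<^sup>2) m)" .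
  have "poly (u + Polynomial.smult (2 * c) f + Polynomial.smult (c\<^sup>2) m) a = 0" using c by simp
  then have "[:- a, 1:] dvd u + Polynomial.smult (2 * c) f + Polynomial.smult (c\<^sup>2) m"
    by (simp only: poly_eq_0_iff_dvd)
  then have "m * [:- a, 1:] dvd g\<^sup>2 - [:0, 1:]" unfolding g by (rule mult_dvd_mono[OF dvd_refl])
  moreover have "(\<Prod>a\<leftarrow>a # es. [:- a, 1:]) = m * [:- a, 1:]"
    by (simp only: list.map prod_list.Cons m_def mult.commute)
  ultimately show ?case by metis
qed auto

text \<open>Evaluation of a polynomial at a matrix by Horner's scheme. The size is an argument
  because zero and identity matrices depend on it.\<close>

definition pev :: "nat \<Rightarrow> complex mat \<Rightarrow> complex poly \<Rightarrow> complex mat" where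
  "pev n A p = foldr (\<lambda>a X. a \<cdot>\<^sub>m 1\<^sub>m n + A * X) (coeffs p) (0\<^sub>m n n)"

context
  fixes n :: nat and A :: "complex mat"
  assumes A: "A \<in> carrier_mat n n"
begin

lemma pev_0: "pev n A 0 = 0\<^sub>m n n"
  by (simp add: pev_def)

lemma pev_pCons: "pev n A (pCons a p) = a \<cdot>\<^sub>m 1\<^sub>m n + A * pev n A p"
  using A by (auto simp: pev_def cCons_def)

lemma pev_carrier [simp]: "pev n A p \<in> carrier_mat n n"
  by (induction p) (use A in \<open>auto simp: pev_0 pev_pCons\<close>)

lemma pev_dim [simp]: "dim_row (pev n A p) = n" "dim_col (pev n A p) = n"
  using pev_carrier[of p] by (blast dest: carrier_matD)+

lemma pev_add: "pev n A (p + q) = pev n A p + pev n A q"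
proof (induction p arbitrary: q)
  case 0 then show ?case by (simp add: pev_0)
next
  case (pCons a p)
  show ?case
  proof (cases q)
    case (pCons b r)
    have "pev n A (pCons a p + q) = (a + b) \<cdot>\<^sub>m 1\<^sub>m n + (A * pev n A p + A * pev n A r)"
      using A by (simp add: pCons pev_pCons pCons.IH sq_distribs[of _ n])
    also have "\<dots> = pev n A (pCons a p) + pev n A q"
      using A by (auto intro!: eq_matI simp: pCons pev_pCons algebra_simps simp del: index_mult_mat(1))
    finally show ?thesis .
  qed
qed

lemma pev_smult: "pev n A (Polynomial.smult c p) = c \<cdot>\<^sub>m pev n A p"
proof (induction p)
  case 0 then show ?case by (auto simp: pev_0)
next
  case (pCons a p)
  have "A * (c \<cdot>\<^sub>m pev n A p) = c \<cdot>\<^sub>m (A * pev n A p)" by (rule mult_smult_distrib[OF A pev_carrier])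
  then show ?case using A
    by (auto intro!: eq_matI simp: pCons.IH pev_pCons algebra_simps simp del: index_mult_mat(1))
qed

lemma pev_mult: "pev n A (p * q) = pev n A p * pev n A q"
proof (induction p)
  case 0 then show ?case using left_mult_zero_mat[OF pev_carrier] by (simp add: pev_0)
next
  case (pCons a p)
  have "pev n A (pCons a p * q) = a \<cdot>\<^sub>m pev n A q + (0 \<cdot>\<^sub>m 1\<^sub>m n + A * (pev n A p * pev n A q))"
    by (simp add: pev_add pev_smult pev_pCons pCons.IH)
  also have "0 \<cdot>\<^sub>m 1\<^sub>m n + A * (pev n A p * pev n A q) = A * (pev n A p * pev n A q)"
    using A by (auto intro!: eq_matI simp del: index_mult_mat(1))
  also have "a \<cdot>\<^sub>m pev n A q + A * (pev n A p * pev n A q) = pev n A (pCons a p) * pev n A q"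
    using A by (simp add: pev_pCons sq_distribs[of _ n] sq_assoc[of _ n] sq_distribs[of _ n])
  finally show ?case .
qed

lemma pev_X: "pev n A [:0, 1:] = A"
  using A by (auto intro!: eq_matI simp: pev_pCons pev_0 sq_distribs[of _ n] simp del: index_mult_mat(1))

lemma pev_diff: "pev n A (p - q) = pev n A p - pev n A q"
proof -
  have "p - q = p + Polynomial.smult (-1) q" by simp
  then show ?thesis by (simp only: pev_add pev_smult) (auto intro!: eq_matI)
qed

lemma pev_commute:
  assumes "X \<in> carrier_mat n n" "X * A = A * X"
  shows "X * pev n A p = pev n A p * X"
proof (induction p)
  case 0 then show ?case using assms by (simp add: pev_0)
next
  case (pCons a p)
  have "X * pev n A (pCons a p) = a \<cdot>\<^sub>m X + (X * A) * pev n A p"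
    using A assms(1) by (simp add: pev_pCons sq_distribs[of _ n] sq_assoc[of _ n])
  also have "(X * A) * pev n A p = A * (X * pev n A p)"
    using A assms by (simp add: sq_assoc[of _ n])
  also have "\<dots> = A * pev n A p * X"
    using A assms by (simp add: sq_assoc[of _ n] pCons.IH)
  also have "a \<cdot>\<^sub>m X + A * pev n A p * X = pev n A (pCons a p) * X"
    using A assms by (simp add: pev_pCons sq_distribs[of _ n] sq_distribs[of _ n])
  finally show ?case .
qed

end

text \<open>The Cayley-Hamilton theorem for triangular matrices, one factor at a time. The first
  \<open>k + 1\<close> columns of the new factor are supported in the first \<open>k\<close> rows,
  and these meet columns of the old product that already vanish.\<close>

lemma pev_triangular_zero:
  assumes B: "B \<in> carrier_mat n n" and ut: "\<And>i j. j < i \<Longrightarrow> i < n \<Longrightarrow> B $$ (i, j) = 0"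
  shows "k \<le> n \<Longrightarrow> r < n \<Longrightarrow> j < k \<Longrightarrow> pev n B (\<Prod>i<k. [:- (B $$ (i, i)), 1:]) $$ (r, j) = 0"
proof (induction k arbitrary: r j)
  case (Suc k)
  define M where "M = pev n B (\<Prod>i<k. [:- (B $$ (i, i)), 1:])"
  define L where "L = pev n B [:- (B $$ (k, k)), 1:]"
  have LM: "M \<in> carrier_mat n n" "L \<in> carrier_mat n n" using B by (auto simp: M_def L_def)
  have L: "L $$ (l, j) = B $$ (l, j) - (if l = j then B $$ (k, k) else 0)" if "l < n" for l
  proof -
    have "L = - (B $$ (k, k)) \<cdot>\<^sub>m 1\<^sub>m n + B"
      using B by (auto intro!: eq_matI simp: L_def pev_pCons[OF B] pev_0[OF B] sq_distribs[of _ n] simp del: index_mult_mat(1))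
    then show ?thesis using that Suc.prems B by auto
  qed
  have "pev n B (\<Prod>i<Suc k. [:- (B $$ (i, i)), 1:]) = M * L"
    by (simp only: prod.lessThan_Suc M_def L_def pev_mult[OF B])
  then have "pev n B (\<Prod>i<Suc k. [:- (B $$ (i, i)), 1:]) $$ (r, j) = (\<Sum>l<n. M $$ (r, l) * L $$ (l, j))"
    using mult_entry[OF LM Suc.prems(2), of j] Suc.prems by (simp only:)
  also have "\<dots> = 0"
  proof (rule sum.neutral, safe)
    fix l assume l: "l < n"
    consider "l < k" | "l = k" "j = k" | "j < l" using Suc.prems by linarith
    then show "M $$ (r, l) * L $$ (l, j) = 0"
    proof cases
      case 1 then show ?thesis using Suc.IH[of r l] Suc.prems by (simp add: M_def)
    next
      case 2 then show ?thesis using L[OF l] by simp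
    next
      case 3 then show ?thesis using L[OF l] ut[OF 3 l] by simp
    qed
  qed
  finally show ?case .
qed simp

lemma pev_similar:
  assumes "B \<in> carrier_mat n n" "P \<in> carrier_mat n n" "Q \<in> carrier_mat n n"
    "P * Q = 1\<^sub>m n" "Q * P = 1\<^sub>m n"
  shows "pev n (P * B * Q) p = P * pev n B p * Q"
proof (induction p)
  case 0 then show ?case using assms by (simp add: pev_0[of _ n])
next
  case (pCons a p)
  have c: "pev n B p \<in> carrier_mat n n" "P * B * Q \<in> carrier_mat n n" using assms by auto
  have 1: "P * B * Q * (P * pev n B p * Q) = P * (B * pev n B p) * Q"
    using assms c by (simp add: sq_assoc[of _ n] sq_mult[of _ n] sq_cancel[of Q P n])
  have "P * (a \<cdot>\<^sub>m 1\<^sub>m n + B * pev n B p) * Q = a \<cdot>\<^sub>m (P * Q) + P * (B * pev n B p) * Q"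
    using assms c by (simp add: sq_distribs[of _ n] sq_distribs[of _ n]
        sq_distribs[of _ n] sq_distribs[of _ n])
  then show ?case
    by (simp add: pev_pCons[OF c(2)] pev_pCons[OF assms(1)] pCons.IH 1 assms(4))
qed

text \<open>A square root of \<open>X\<close> modulo the characteristic polynomial is evaluated at
  \<open>A\<close>. That \<open>C\<close> is a polynomial in \<open>A\<close> matters as much as its
  square: it makes \<open>C\<close> commute with everything that commutes with
  \<open>A\<close>.\<close>

lemma matrix_sqrt:
  fixes A :: "complex mat"
  assumes A: "A \<in> carrier_mat n n" and d: "det A \<noteq> 0"
  obtains C where "C \<in> carrier_mat n n" "C * C = A"
    "\<And>X. X \<in> carrier_mat n n \<Longrightarrow> X * A = A * X \<Longrightarrow> X * C = C * X"
proof -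
  from schur_form[OF A] obtain B P Q where BPQ: "B \<in> carrier_mat n n" "P \<in> carrier_mat n n" "Q \<in> carrier_mat n n"
    and PQ: "P * Q = 1\<^sub>m n" "Q * P = 1\<^sub>m n" and AB: "A = P * B * Q"
    and ut: "\<And>i j. j < i \<Longrightarrow> i < n \<Longrightarrow> B $$ (i, j) = 0" by blast
  define es where "es = diag_mat B"
  have "det B = prod_list es"
    unfolding es_def using BPQ(1) ut by (intro det_upper_triangular) (auto simp: upper_triangular_def)
  moreover have "det B \<noteq> 0"
    using d BPQ unfolding AB by (auto simp: det_mult[of _ n])
  ultimately have "0 \<notin> set es" by (simp add: prod_list_zero_iff)
  from poly_sqrt_mod[OF this] obtain f u where fu: "f\<^sup>2 - [:0, 1:] = (\<Prod>a\<leftarrow>es. [:- a, 1:]) * u"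
    by (auto elim!: dvdE)
  have es: "(\<Prod>a\<leftarrow>es. [:- a, 1:]) = (\<Prod>i<n. [:- (B $$ (i, i)), 1:])"
    using BPQ(1) by (simp add: es_def diag_mat_def o_def atLeast0LessThan flip: prod.distinct_set_conv_list)
  have "pev n B (\<Prod>a\<leftarrow>es. [:- a, 1:]) = 0\<^sub>m n n"
    unfolding es using pev_triangular_zero[OF BPQ(1) ut, of n] BPQ(1) by (auto intro!: eq_matI)
  then have z: "pev n A (\<Prod>a\<leftarrow>es. [:- a, 1:]) = 0\<^sub>m n n"
    unfolding AB pev_similar[OF BPQ PQ] using BPQ by simp
  define C where "C = pev n A f"
  have C: "C \<in> carrier_mat n n" using A by (simp add: C_def)
  have "C * C - A = pev n A (f\<^sup>2 - [:0, 1:])"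
    using A by (simp add: C_def pev_diff pev_X pev_mult power2_eq_square)
  also have "\<dots> = 0\<^sub>m n n" unfolding fu using A z by (simp add: pev_mult)
  finally have z: "C * C - A = 0\<^sub>m n n" .
  have "C * C = (C * C - A) + A" using A C by (auto intro!: eq_matI simp del: index_mult_mat(1))
  then have "C * C = A" unfolding z using A by simp
  then show ?thesis using that[OF C] pev_commute[OF A] by (auto simp: C_def)
qed

section \<open>Representations of compact groups\<close>

lemma sq_one: "A \<in> carrier_mat n n \<Longrightarrow> A * 1\<^sub>m n = A" "A \<in> carrier_mat n n \<Longrightarrow> 1\<^sub>m n * A = A"
  for A :: "'a::semiring_1 mat"
  by simp_all

lemma sq_absorb:
  fixes q :: "'a::semiring_1 mat"
  assumes "q * q = q" "q \<in> carrier_mat n n" "X \<in> carrier_mat n n"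
  shows "q * (q * X) = q * X"
  using assms sq_assoc[of q n q X] by simp

text \<open>Module homomorphisms from \<open>\<sigma>\<close> to \<open>\<tau>\<close>, possibly
  singular.\<close>

definition intw :: "('g, 'r) monoid_scheme \<Rightarrow> nat \<Rightarrow> ('g \<Rightarrow> complex mat) \<Rightarrow> ('g \<Rightarrow> complex mat) \<Rightarrow> complex mat \<Rightarrow> bool" where
  "intw G n \<sigma> \<tau> X \<longleftrightarrow> X \<in> carrier_mat n n \<and> (\<forall>h\<in>carrier G. \<tau> h * X = X * \<sigma> h)"

lemma complex_repD:
  assumes "complex_rep G T n \<sigma>"
  shows "h \<in> carrier G \<Longrightarrow> \<sigma> h \<in> carrier_mat n n"
    "\<sigma> \<one>\<^bsub>G\<^esub> = 1\<^sub>m n"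
    "h \<in> carrier G \<Longrightarrow> k \<in> carrier G \<Longrightarrow> \<sigma> (h \<otimes>\<^bsub>G\<^esub> k) = \<sigma> h * \<sigma> k"
  using assms by (auto simp: complex_rep_def)

lemma complex_rep_inv:
  fixes G (structure)
  assumes "group G" "complex_rep G T n \<sigma>" "h \<in> carrier G"
  shows "\<sigma> h * \<sigma> (inv h) = 1\<^sub>m n" "\<sigma> (inv h) * \<sigma> h = 1\<^sub>m n"
proof -
  interpret group G by fact
  show "\<sigma> h * \<sigma> (inv h) = 1\<^sub>m n" "\<sigma> (inv h) * \<sigma> h = 1\<^sub>m n"
    using complex_repD(3)[OF assms(2), of h "inv h"] complex_repD(3)[OF assms(2), of "inv h" h]
      complex_repD(2)[OF assms(2)] assms(3) by auto
qed

lemma intw_mult: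
  assumes "complex_rep G T n \<sigma>" "complex_rep G T n \<tau>" "complex_rep G T n \<upsilon>"
    and X: "intw G n \<sigma> \<tau> X" and Y: "intw G n \<tau> \<upsilon> Y"
  shows "intw G n \<sigma> \<upsilon> (Y * X)"
  unfolding intw_def
proof (intro conjI ballI)
  have c: "X \<in> carrier_mat n n" "Y \<in> carrier_mat n n" using X Y by (auto simp: intw_def)
  then show "Y * X \<in> carrier_mat n n" by simp
  fix h assume h: "h \<in> carrier G"
  note r = complex_repD(1)[OF assms(1) h] complex_repD(1)[OF assms(2) h] complex_repD(1)[OF assms(3) h]
  have "\<upsilon> h * (Y * X) = (\<upsilon> h * Y) * X" using c r by (simp add: sq_assoc[of _ n] sq_mult)
  also have "\<dots> = Y * (\<tau> h * X)" using Y h c r by (simp add: intw_def sq_assoc[of _ n] sq_mult)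
  also have "\<dots> = Y * X * \<sigma> h" using X h c r by (simp add: intw_def sq_assoc[of _ n] sq_mult)
  finally show "\<upsilon> h * (Y * X) = Y * X * \<sigma> h" .
qed

lemma intw_add:
  assumes "complex_rep G T n \<sigma>" "complex_rep G T n \<tau>" "intw G n \<sigma> \<tau> X" "intw G n \<sigma> \<tau> Y"
  shows "intw G n \<sigma> \<tau> (X + Y)"
  using assms complex_repD(1)[OF assms(1)] complex_repD(1)[OF assms(2)]
  by (auto simp: intw_def sq_distribs[of _ n])

lemma intw_one_minus:
  assumes "complex_rep G T n \<sigma>" "intw G n \<sigma> \<sigma> X"
  shows "intw G n \<sigma> \<sigma> (1\<^sub>m n - X)"
  using assms complex_repD(1)[OF assms(1)]
  by (auto simp: intw_def mult_minus_distrib_mat[of _ n n _ n] minus_mult_distrib_mat[of _ n n _ _ n] sq_one)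

definition munit :: "nat \<Rightarrow> nat \<Rightarrow> nat \<Rightarrow> complex mat" where
  "munit n b c = Matrix.mat n n (\<lambda>(i, j). if i = b \<and> j = c then 1 else 0)"

lemma munit_carrier [simp]: "munit n b c \<in> carrier_mat n n"
  by (simp add: munit_def)

lemma sandwich_entry:
  fixes A B X :: "complex mat"
  assumes "A \<in> carrier_mat n n" "B \<in> carrier_mat n n" "X \<in> carrier_mat n n" "i < n" "j < n"
  shows "(A * X * B) $$ (i, j) = (\<Sum>a<n. \<Sum>b<n. A $$ (i, a) * B $$ (b, j) * X $$ (a, b))"
proof -
  have "(A * X * B) $$ (i, j) = (\<Sum>b<n. (A * X) $$ (i, b) * B $$ (b, j))"
    using assms by (intro mult_entry) auto
  also have "\<dots> = (\<Sum>b<n. \<Sum>a<n. A $$ (i, a) * B $$ (b, j) * X $$ (a, b))"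
  proof (rule sum.cong)
    fix b assume "b \<in> {..<n}"
    then show "(A * X) $$ (i, b) * B $$ (b, j) = (\<Sum>a<n. A $$ (i, a) * B $$ (b, j) * X $$ (a, b))"
      using mult_entry[OF assms(1,3,4), of b] by (simp add: sum_distrib_left mult.assoc mult.commute mult.left_commute)
  qed simp
  finally show ?thesis by (subst sum.swap)
qed

lemma sandwich_munit:
  assumes "A \<in> carrier_mat n n" "B \<in> carrier_mat n n" "i < n" "j < n" "b < n" "c < n"
  shows "(A * munit n b c * B) $$ (i, j) = A $$ (i, b) * B $$ (c, j)"
proof -
  have "(A * munit n b c * B) $$ (i, j) = (\<Sum>a<n. \<Sum>d<n. if d = c then if a = b then A $$ (i, b) * B $$ (c, j) else 0 else 0)"
    unfolding sandwich_entry[OF assms(1,2) munit_carrier assms(3,4)]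
    by (intro sum.cong refl) (auto simp: munit_def)
  then show ?thesis using assms by simp
qed

context compact_group begin

lemma complex_rep_cmat: "complex_rep G T n \<sigma> \<Longrightarrow> cmat T n \<sigma>"
  by (auto simp: complex_rep_def cmat_def topspace_eq)

lemma complex_rep_cmat_inv: "complex_rep G T n \<sigma> \<Longrightarrow> cmat T n (\<lambda>h. \<sigma> (inv h))"
  using cmat_compose[OF inv_cont complex_rep_cmat] .

lemma cmean_double_sum:
  assumes "\<And>a b. a < m \<Longrightarrow> b < n \<Longrightarrow> continuous_map T euclidean (f a b)"
  shows "cmean (\<lambda>h. \<Sum>a<(m::nat). \<Sum>b<(n::nat). f a b h) = (\<Sum>a<m. \<Sum>b<n. cmean (f a b))"
proof -
  have "cmean (\<lambda>h. \<Sum>a<m. \<Sum>b<n. f a b h) = (\<Sum>a<m. cmean (\<lambda>h. \<Sum>b<n. f a b h))"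
    by (rule cmean_sum, rule continuous_map_sum) (use assms in auto)
  also have "\<dots> = (\<Sum>a<m. \<Sum>b<n. cmean (f a b))"
    by (intro sum.cong refl cmean_sum) (use assms in auto)
  finally show ?thesis .
qed

section \<open>Averaging matrix-valued functions to intertwiners\<close>

definition mmean :: "nat \<Rightarrow> ('g \<Rightarrow> complex mat) \<Rightarrow> complex mat" where
  "mmean n F = Matrix.mat n n (\<lambda>(i, j). cmean (\<lambda>h. F h $$ (i, j)))"

lemma mmean_carrier [simp]: "mmean n F \<in> carrier_mat n n"
  by (simp add: mmean_def)

lemma mmean_cong: "(\<And>h. h \<in> carrier G \<Longrightarrow> F h = F' h) \<Longrightarrow> mmean n F = mmean n F'"
  unfolding mmean_def by (intro eq_matI) (auto intro: cmean_cong)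

lemma mmean_const: "A \<in> carrier_mat n n \<Longrightarrow> mmean n (\<lambda>h. A) = A"
  unfolding mmean_def by (intro eq_matI) (auto simp: cmean_const)

lemma mmean_left_invariant:
  assumes "cmat T n F" "a \<in> carrier G" shows "mmean n (\<lambda>h. F (a \<otimes> h)) = mmean n F"
  unfolding mmean_def using cmean_left_invariant[OF cmat_entry[OF assms(1)] assms(2)]
  by (intro eq_matI) auto

lemma mmean_sandwich:
  assumes F: "cmat T n F" and A: "A \<in> carrier_mat n n" and B: "B \<in> carrier_mat n n"
  shows "mmean n (\<lambda>h. A * F h * B) = A * mmean n F * B"
proof (rule eq_matI)
  fix i j assume "i < dim_row (A * mmean n F * B)" "j < dim_col (A * mmean n F * B)"
  then have ij: "i < n" "j < n" using A B by auto
  have e: "continuous_map T euclidean (\<lambda>h. F h $$ (a, b))" if "a < n" "b < n" for a b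
    by (rule cmat_entry[OF F that])
  have "mmean n (\<lambda>h. A * F h * B) $$ (i, j) = cmean (\<lambda>h. (A * F h * B) $$ (i, j))"
    using ij by (simp add: mmean_def)
  also have "\<dots> = cmean (\<lambda>h. \<Sum>a<n. \<Sum>b<n. A $$ (i, a) * B $$ (b, j) * F h $$ (a, b))"
    by (rule cmean_cong) (use cmat_carrier[OF F] topspace_eq ij in \<open>auto simp: sandwich_entry[OF A B] simp del: index_mult_mat(1)\<close>)
  also have "\<dots> = (\<Sum>a<n. \<Sum>b<n. A $$ (i, a) * B $$ (b, j) * cmean (\<lambda>h. F h $$ (a, b)))"
  proof -
    have "cmean (\<lambda>h. \<Sum>a<n. \<Sum>b<n. A $$ (i, a) * B $$ (b, j) * F h $$ (a, b))
      = (\<Sum>a<n. \<Sum>b<n. cmean (\<lambda>h. A $$ (i, a) * B $$ (b, j) * F h $$ (a, b)))"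
      by (rule cmean_double_sum) (intro continuous_map_complex_mult e, auto)
    also have "\<dots> = (\<Sum>a<n. \<Sum>b<n. A $$ (i, a) * B $$ (b, j) * cmean (\<lambda>h. F h $$ (a, b)))"
      by (intro sum.cong refl cmean_scale e) auto
    finally show ?thesis .
  qed
  also have "\<dots> = (A * mmean n F * B) $$ (i, j)"
    unfolding sandwich_entry[OF A B mmean_carrier ij] by (simp add: mmean_def)
  finally show "mmean n (\<lambda>h. A * F h * B) $$ (i, j) = (A * mmean n F * B) $$ (i, j)" .
qed (use A B in \<open>auto simp: mmean_def\<close>)

lemma mmean_left:
  assumes F: "cmat T n F" and A: "A \<in> carrier_mat n n"
  shows "mmean n (\<lambda>h. A * F h) = A * mmean n F"
proof -
  have "mmean n (\<lambda>h. A * F h) = mmean n (\<lambda>h. A * F h * 1\<^sub>m n)"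
    by (rule mmean_cong) (use cmat_carrier[OF F] topspace_eq A in \<open>auto simp: sq_one sq_mult\<close>)
  also have "\<dots> = A * mmean n F * 1\<^sub>m n" by (rule mmean_sandwich[OF F A]) simp
  finally show ?thesis using A by (simp add: sq_one sq_mult)
qed

lemma mmean_right:
  assumes F: "cmat T n F" and A: "A \<in> carrier_mat n n"
  shows "mmean n (\<lambda>h. F h * A) = mmean n F * A"
proof -
  have "mmean n (\<lambda>h. F h * A) = mmean n (\<lambda>h. 1\<^sub>m n * F h * A)"
    by (rule mmean_cong) (use cmat_carrier[OF F] topspace_eq A in \<open>auto simp: sq_one sq_mult\<close>)
  also have "\<dots> = 1\<^sub>m n * mmean n F * A" by (rule mmean_sandwich[OF F _ A]) simp
  finally show ?thesis using A by (simp add: sq_one sq_mult)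
qed

text \<open>The average over the action of the group on matrices by \<open>\<tau>\<close> on the
  left and \<open>\<sigma>\<close> of the inverse on the right; it projects onto the
  intertwiners.\<close>

definition iavg :: "nat \<Rightarrow> ('g \<Rightarrow> complex mat) \<Rightarrow> ('g \<Rightarrow> complex mat) \<Rightarrow> complex mat \<Rightarrow> complex mat" where
  "iavg n \<sigma> \<tau> X = mmean n (\<lambda>h. \<tau> h * X * \<sigma> (inv h))"

context
  fixes n \<sigma> \<tau>
  assumes \<sigma>: "complex_rep G T n \<sigma>" and \<tau>: "complex_rep G T n \<tau>"
begin

lemma iavg_cmat: "X \<in> carrier_mat n n \<Longrightarrow> cmat T n (\<lambda>h. \<tau> h * X * \<sigma> (inv h))"
  by (intro cmat_mult cmat_const complex_rep_cmat complex_rep_cmat_inv \<sigma> \<tau>)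

lemma iavg_intw:
  assumes X: "X \<in> carrier_mat n n" shows "intw G n \<sigma> \<tau> (iavg n \<sigma> \<tau> X)"
  unfolding intw_def
proof (intro conjI ballI)
  show "iavg n \<sigma> \<tau> X \<in> carrier_mat n n" by (simp add: iavg_def)
  fix a assume a: "a \<in> carrier G"
  note r = complex_repD(1)[OF \<sigma>] complex_repD(1)[OF \<tau>]
  let ?F = "\<lambda>h. \<tau> h * X * \<sigma> (inv h)"
  have "\<tau> a * iavg n \<sigma> \<tau> X = mmean n (\<lambda>h. \<tau> a * ?F h)"
    unfolding iavg_def by (rule mmean_left[OF iavg_cmat[OF X] r(2)[OF a], symmetric])
  also have "\<dots> = mmean n (\<lambda>h. ?F (a \<otimes> h) * \<sigma> a)"
  proof (rule mmean_cong)
    fix h assume h: "h \<in> carrier G"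
    have "\<sigma> (inv (a \<otimes> h)) * \<sigma> a = \<sigma> (inv (a \<otimes> h) \<otimes> a)" using a h by (simp add: complex_repD(3)[OF \<sigma>])
    also have "inv (a \<otimes> h) \<otimes> a = inv h" using a h by (simp add: inv_mult_group m_assoc)
    finally have "?F (a \<otimes> h) * \<sigma> a = \<tau> a * (\<tau> h * (X * \<sigma> (inv h)))"
      using a h X r by (simp add: complex_repD(3)[OF \<tau>] sq_assoc[of _ n] sq_mult)
    moreover have "?F h = \<tau> h * (X * \<sigma> (inv h))" using h X r by (simp add: sq_assoc[of _ n] sq_mult)
    ultimately show "\<tau> a * ?F h = ?F (a \<otimes> h) * \<sigma> a" by simp
  qed
  also have "\<dots> = mmean n (\<lambda>h. ?F (a \<otimes> h)) * \<sigma> a"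
  proof (rule mmean_right[OF _ r(1)[OF a]])
    have "continuous_map T T (\<lambda>h. a \<otimes> h)"
      using continuous_map_mult[OF continuous_map_const_carrier[OF a] continuous_map_id[unfolded id_def]] .
    from cmat_compose[OF this iavg_cmat[OF X]] show "cmat T n (\<lambda>h. ?F (a \<otimes> h))" .
  qed
  also have "mmean n (\<lambda>h. ?F (a \<otimes> h)) = iavg n \<sigma> \<tau> X"
    unfolding iavg_def by (rule mmean_left_invariant[OF iavg_cmat[OF X] a])
  finally show "\<tau> a * iavg n \<sigma> \<tau> X = iavg n \<sigma> \<tau> X * \<sigma> a" .
qed

lemma iavg_fixed:
  assumes "intw G n \<sigma> \<tau> X" shows "iavg n \<sigma> \<tau> X = X"
proof -
  have X: "X \<in> carrier_mat n n" using assms by (simp add: intw_def)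
  have "iavg n \<sigma> \<tau> X = mmean n (\<lambda>h. X)" unfolding iavg_def
  proof (rule mmean_cong)
    fix h assume h: "h \<in> carrier G"
    then have "\<tau> h * X * \<sigma> (inv h) = X * \<sigma> h * \<sigma> (inv h)" using assms by (simp add: intw_def)
    also have "\<dots> = X * (\<sigma> h * \<sigma> (inv h))" using h X complex_repD(1)[OF \<sigma>] by (simp add: sq_assoc[of _ n] sq_mult)
    finally show "\<tau> h * X * \<sigma> (inv h) = X" using complex_rep_inv[OF group_axioms \<sigma> h] X by simp
  qed
  then show ?thesis by (simp add: mmean_const[OF X])
qed

lemma iavg_left:
  assumes q: "intw G n \<tau> \<tau> q" and X: "X \<in> carrier_mat n n"
  shows "q * iavg n \<sigma> \<tau> X = iavg n \<sigma> \<tau> (q * X)"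
proof -
  have qc: "q \<in> carrier_mat n n" using q by (simp add: intw_def)
  have "q * iavg n \<sigma> \<tau> X = mmean n (\<lambda>h. q * (\<tau> h * X * \<sigma> (inv h)))"
    unfolding iavg_def by (rule mmean_left[OF iavg_cmat[OF X] qc, symmetric])
  also have "\<dots> = iavg n \<sigma> \<tau> (q * X)" unfolding iavg_def
  proof (rule mmean_cong)
    fix h assume h: "h \<in> carrier G"
    note r = complex_repD(1)[OF \<sigma>, of "inv h"] complex_repD(1)[OF \<tau> h]
    have "q * (\<tau> h * X * \<sigma> (inv h)) = (q * \<tau> h) * X * \<sigma> (inv h)"
      using r h X qc by (simp add: sq_assoc[of _ n] sq_mult)
    also have "q * \<tau> h = \<tau> h * q" using q h by (simp add: intw_def)
    finally show "q * (\<tau> h * X * \<sigma> (inv h)) = \<tau> h * (q * X) * \<sigma> (inv h)"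
      using r h X qc by (simp add: sq_assoc[of _ n] sq_mult)
  qed
  finally show ?thesis .
qed

lemma iavg_right:
  assumes p: "intw G n \<sigma> \<sigma> p" and X: "X \<in> carrier_mat n n"
  shows "iavg n \<sigma> \<tau> X * p = iavg n \<sigma> \<tau> (X * p)"
proof -
  have pc: "p \<in> carrier_mat n n" using p by (simp add: intw_def)
  have "iavg n \<sigma> \<tau> X * p = mmean n (\<lambda>h. \<tau> h * X * \<sigma> (inv h) * p)"
    unfolding iavg_def by (rule mmean_right[OF iavg_cmat[OF X] pc, symmetric])
  also have "\<dots> = iavg n \<sigma> \<tau> (X * p)" unfolding iavg_def
  proof (rule mmean_cong)
    fix h assume h: "h \<in> carrier G"
    note r = complex_repD(1)[OF \<sigma>, of "inv h"] complex_repD(1)[OF \<tau> h]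
    have "\<tau> h * X * \<sigma> (inv h) * p = \<tau> h * X * (\<sigma> (inv h) * p)"
      using r h X pc by (simp add: sq_assoc[of _ n] sq_mult)
    also have "\<sigma> (inv h) * p = p * \<sigma> (inv h)" using p h by (simp add: intw_def)
    finally show "\<tau> h * X * \<sigma> (inv h) * p = \<tau> h * (X * p) * \<sigma> (inv h)"
      using r h X pc by (simp add: sq_assoc[of _ n] sq_mult)
  qed
  finally show ?thesis .
qed

end

text \<open>If all intertwiners \<open>q X p\<close> vanish, then so do the means of all products of an entry of
  \<open>\<tau> h q\<close> with one of \<open>p \<sigma>(h\<^sup>-\<^sup>1)\<close>, in particular the mean of \<open>tr (\<sigma> h p) tr (p \<sigma>(h\<^sup>-\<^sup>1))\<close>. But this is
  the trace of the idempotent \<open>X \<mapsto> iavg (p X p)\<close>, which fixes \<open>p\<close>.\<close>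

lemma exists_intertwiner:
  assumes \<sigma>: "complex_rep G T n \<sigma>" and \<tau>: "complex_rep G T n \<tau>"
    and p: "intw G n \<sigma> \<sigma> p" "p * p = p" and q: "intw G n \<tau> \<tau> q" "q * q = q"
    and tr: "\<And>h. h \<in> carrier G \<Longrightarrow> tr (\<sigma> h * p) = tr (\<tau> h * q)" and p0: "p \<noteq> 0\<^sub>m n n"
  obtains X where "intw G n \<sigma> \<tau> X" "q * X = X" "X * p = X" "X \<noteq> 0\<^sub>m n n"
proof (rule ccontr)
  assume nex: "\<not> thesis"
  have nex': "\<not> (intw G n \<sigma> \<tau> X \<and> q * X = X \<and> X * p = X \<and> X \<noteq> 0\<^sub>m n n)" for X
    using that nex by blast
  have pc: "p \<in> carrier_mat n n" and qc: "q \<in> carrier_mat n n" using p q by (auto simp: intw_def)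
  note r = complex_repD(1)[OF \<sigma>] complex_repD(1)[OF \<tau>]
  have zero: "iavg n \<sigma> \<tau> (q * X * p) = 0\<^sub>m n n" if X: "X \<in> carrier_mat n n" for X
  proof (rule ccontr)
    assume "iavg n \<sigma> \<tau> (q * X * p) \<noteq> 0\<^sub>m n n"
    moreover have "q * iavg n \<sigma> \<tau> (q * X * p) = iavg n \<sigma> \<tau> (q * X * p)"
      using X pc qc by (simp add: iavg_left[OF \<sigma> \<tau> q(1)] sq_assoc[of _ n] sq_mult sq_absorb[OF q(2)])
    moreover have "iavg n \<sigma> \<tau> (q * X * p) * p = iavg n \<sigma> \<tau> (q * X * p)"
      using X pc qc p(2) by (simp add: iavg_right[OF \<sigma> \<tau> p(1)] sq_assoc[of _ n] sq_mult)
    ultimately show False using nex' iavg_intw[OF \<sigma> \<tau>, of "q * X * p"] X pc qc by (auto simp: sq_mult)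
  qed
  define s t s' where "s h = \<sigma> h * p" and "t h = \<tau> h * q" and "s' h = p * \<sigma> (inv h)" for h
  have c: "s h \<in> carrier_mat n n" "t h \<in> carrier_mat n n" "s' h \<in> carrier_mat n n" if "h \<in> carrier G" for h
    using that r pc qc by (auto simp: s_def t_def s'_def sq_mult)
  have cm: "cmat T n s" "cmat T n t" "cmat T n s'" unfolding s_def t_def s'_def
    by (intro cmat_mult cmat_const complex_rep_cmat complex_rep_cmat_inv \<sigma> \<tau> pc qc)+
  note e = cmat_entry[OF cm(1)] cmat_entry[OF cm(2)] cmat_entry[OF cm(3)]
  \<comment> \<open>Schur orthogonality: a matrix unit in the middle isolates the product of one
    entry of \<open>t h\<close> with one entry of \<open>s' h\<close>.\<close>
  have t0: "cmean (\<lambda>h. t h $$ (a, b) * s' h $$ (c, d)) = 0" if "a < n" "b < n" "c < n" "d < n" for a b c d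
  proof -
    have "cmean (\<lambda>h. t h $$ (a, b) * s' h $$ (c, d)) = cmean (\<lambda>h. (\<tau> h * (q * munit n b c * p) * \<sigma> (inv h)) $$ (a, d))"
    proof (rule cmean_cong)
      fix h assume h: "h \<in> carrier G"
      have "\<tau> h * (q * munit n b c * p) * \<sigma> (inv h) = t h * munit n b c * s' h"
        using h r[of h] r[of "inv h"] pc qc by (simp add: t_def s'_def sq_assoc[of _ n] sq_mult)
      then show "t h $$ (a, b) * s' h $$ (c, d) = (\<tau> h * (q * munit n b c * p) * \<sigma> (inv h)) $$ (a, d)"
        using sandwich_munit[OF c(2,3)[OF h] that(1,4,2,3)] by simp
    qed
    also have "\<dots> = iavg n \<sigma> \<tau> (q * munit n b c * p) $$ (a, d)" using that by (simp add: iavg_def mmean_def)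
    also have "\<dots> = 0" using zero[of "munit n b c"] that by simp
    finally show ?thesis .
  qed
  \<comment> \<open>Here the equality of the characters enters: it replaces the trace of
    \<open>s h\<close> by that of \<open>t h\<close>, to which \<open>t0\<close> applies.\<close>
  have trz: "cmean (\<lambda>h. tr (s h) * tr (s' h)) = 0"
  proof -
    have "cmean (\<lambda>h. tr (s h) * tr (s' h)) = cmean (\<lambda>h. \<Sum>a<n. \<Sum>b<n. t h $$ (a, a) * s' h $$ (b, b))"
    proof (rule cmean_cong)
      fix h assume h: "h \<in> carrier G"
      have "tr (s h) = tr (t h)" using tr[OF h] by (simp add: s_def t_def)
      then show "tr (s h) * tr (s' h) = (\<Sum>a<n. \<Sum>b<n. t h $$ (a, a) * s' h $$ (b, b))"
        using c[OF h] by (simp add: tr_def sum_product)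
    qed
    also have "\<dots> = (\<Sum>a<n. \<Sum>b<n. cmean (\<lambda>h. t h $$ (a, a) * s' h $$ (b, b)))"
      by (rule cmean_double_sum) (intro continuous_map_complex_mult e; simp)
    also have "\<dots> = 0" using t0 by simp
    finally show ?thesis .
  qed
  define L where "L X = iavg n \<sigma> \<sigma> (p * X * p)" for X
  have Lc: "L X \<in> carrier_mat n n" for X by (simp add: L_def iavg_def)
  have Lent: "L X $$ (i, j) = (\<Sum>a<n. \<Sum>b<n. cmean (\<lambda>h. s h $$ (i, a) * s' h $$ (b, j)) * X $$ (a, b))"
    if X: "X \<in> carrier_mat n n" and ij: "i < n" "j < n" for X i j
  proof -
    have "L X $$ (i, j) = cmean (\<lambda>h. (\<sigma> h * (p * X * p) * \<sigma> (inv h)) $$ (i, j))"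
      using ij by (simp add: L_def iavg_def mmean_def)
    also have "\<dots> = cmean (\<lambda>h. \<Sum>a<n. \<Sum>b<n. s h $$ (i, a) * s' h $$ (b, j) * X $$ (a, b))"
    proof (rule cmean_cong)
      fix h assume h: "h \<in> carrier G"
      have "\<sigma> h * (p * X * p) * \<sigma> (inv h) = s h * X * s' h"
        using h r[of h] r[of "inv h"] pc X by (simp add: s_def s'_def sq_assoc[of _ n] sq_mult)
      then show "(\<sigma> h * (p * X * p) * \<sigma> (inv h)) $$ (i, j) = (\<Sum>a<n. \<Sum>b<n. s h $$ (i, a) * s' h $$ (b, j) * X $$ (a, b))"
        using sandwich_entry[OF c(1,3)[OF h] X ij] by simp
    qed
    also have "\<dots> = (\<Sum>a<n. \<Sum>b<n. cmean (\<lambda>h. s h $$ (i, a) * s' h $$ (b, j)) * X $$ (a, b))"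
    proof -
      have k: "continuous_map T euclidean (\<lambda>h. s h $$ (i, a) * s' h $$ (b, j))" if "a < n" "b < n" for a b
        by (intro continuous_map_complex_mult e) (use that ij in auto)
      have "cmean (\<lambda>h. \<Sum>a<n. \<Sum>b<n. s h $$ (i, a) * s' h $$ (b, j) * X $$ (a, b))
        = (\<Sum>a<n. \<Sum>b<n. cmean (\<lambda>h. s h $$ (i, a) * s' h $$ (b, j) * X $$ (a, b)))"
        by (rule cmean_double_sum) (auto intro!: continuous_map_complex_mult k)
      also have "\<dots> = (\<Sum>a<n. \<Sum>b<n. cmean (\<lambda>h. s h $$ (i, a) * s' h $$ (b, j)) * X $$ (a, b))"
        by (intro sum.cong refl cmean_scale_right k) auto
      finally show ?thesis .
    qed
    finally show ?thesis .
  qed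
  have Lidem: "L (L X) = L X" if X: "X \<in> carrier_mat n n" for X
  proof -
    have 1: "p * L X = L X" unfolding L_def
      using X pc by (simp add: iavg_left[OF \<sigma> \<sigma> p(1)] sq_assoc[of _ n] sq_mult sq_absorb[OF p(2)])
    have 2: "L X * p = L X" unfolding L_def
      using X pc p(2) by (simp add: iavg_right[OF \<sigma> \<sigma> p(1)] sq_assoc[of _ n] sq_mult)
    have "L (L X) = iavg n \<sigma> \<sigma> (L X)" unfolding L_def[of "L X"] using 1 2 by simp
    also have "\<dots> = L X" unfolding L_def by (intro iavg_fixed iavg_intw \<sigma>) (use X pc in auto)
    finally show ?thesis .
  qed
  \<comment> \<open>The matrix of \<open>L\<close> on the space of \<open>n\<close> by
    \<open>n\<close> matrices, with the entry \<open>(i, j)\<close> stored at index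
    \<open>i * n + j\<close>. Its trace is the mean of \<open>tr (s h) * tr (s' h)\<close>.\<close>
  define M where "M = Matrix.mat (n * n) (n * n) (\<lambda>(x, y). cmean (\<lambda>h. s h $$ (x div n, y div n) * s' h $$ (y mod n, x mod n)))"
  have Mc: "M \<in> carrier_mat (n * n) (n * n)" by (simp add: M_def)
  have dm: "x div n < n" "x mod n < n" "0 < n" if "x < n * n" for x
    using that by (simp_all add: less_mult_imp_div_less) (cases n; simp)+
  have dj: "i * n + j < n * n" if "i < n" "j < n" for i j
  proof -
    have "i * n + j < Suc i * n" using that by simp
    also have "\<dots> \<le> n * n" using that by (intro mult_right_mono) auto
    finally show ?thesis .
  qed
  have Mu: "M $$ (x, y) = L (munit n (y div n) (y mod n)) $$ (x div n, x mod n)" if "x < n * n" "y < n * n" for x y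
  proof -
    have "L (munit n (y div n) (y mod n)) $$ (x div n, x mod n) =
      (\<Sum>a<n. \<Sum>b<n. if b = y mod n then if a = y div n then M $$ (x, y) else 0 else 0)"
      unfolding Lent[OF munit_carrier dm(1,2)[OF that(1)]] using that
      by (intro sum.cong refl) (auto simp: munit_def M_def)
    then show ?thesis using dm[OF that(2)] by simp
  qed
  have "M * M = M"
  proof (rule eq_matI)
    fix x y assume "x < dim_row M" "y < dim_col M"
    then have xy: "x < n * n" "y < n * n" by (auto simp: M_def)
    let ?Y = "L (munit n (y div n) (y mod n))"
    have "(M * M) $$ (x, y) = (\<Sum>z<n * n. M $$ (x, z) * M $$ (z, y))"
      by (rule mult_entry[OF Mc Mc xy])
    also have "\<dots> = (\<Sum>z<n * n. M $$ (x, z) * ?Y $$ (z div n, z mod n))"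
      using Mu xy by (intro sum.cong) auto
    also have "\<dots> = (\<Sum>i<n. \<Sum>j<n. M $$ (x, j + i * n) * ?Y $$ (i, j))"
      unfolding sum_mult_product by (intro sum.cong refl) auto
    also have "\<dots> = (\<Sum>i<n. \<Sum>j<n. cmean (\<lambda>h. s h $$ (x div n, i) * s' h $$ (j, x mod n)) * ?Y $$ (i, j))"
      using xy dj by (intro sum.cong refl) (auto simp: M_def add.commute)
    also have "\<dots> = L ?Y $$ (x div n, x mod n)" using Lent[OF Lc dm(1,2)[OF xy(1)]] by simp
    also have "\<dots> = M $$ (x, y)" using Lidem[OF munit_carrier] Mu[OF xy] by simp
    finally show "(M * M) $$ (x, y) = M $$ (x, y)" .
  qed (use Mc in auto)
  then obtain k where k: "tr M = of_nat k" "k \<le> n * n" "k = 0 \<Longrightarrow> M = 0\<^sub>m (n * n) (n * n)"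
    using idempotent_trace[OF Mc] by blast
  have "tr M = (\<Sum>x<n * n. M $$ (x, x))" using Mc by (simp add: tr_def)
  also have "\<dots> = (\<Sum>i<n. \<Sum>j<n. M $$ (j + i * n, j + i * n))" by (rule sum_mult_product)
  also have "\<dots> = (\<Sum>i<n. \<Sum>j<n. cmean (\<lambda>h. s h $$ (i, i) * s' h $$ (j, j)))"
    using dj by (intro sum.cong refl) (auto simp: M_def add.commute)
  also have "\<dots> = cmean (\<lambda>h. \<Sum>i<n. \<Sum>j<n. s h $$ (i, i) * s' h $$ (j, j))"
    by (rule cmean_double_sum[symmetric]) (intro continuous_map_complex_mult e; simp)
  also have "\<dots> = cmean (\<lambda>h. tr (s h) * tr (s' h))"
  proof (rule cmean_cong)
    fix h assume h: "h \<in> carrier G"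
    show "(\<Sum>i<n. \<Sum>j<n. s h $$ (i, i) * s' h $$ (j, j)) = tr (s h) * tr (s' h)"
      using c[OF h] by (simp add: tr_def sum_product)
  qed
  finally have "tr M = 0" using trz by simp
  then have M0: "M = 0\<^sub>m (n * n) (n * n)" using k by simp
  have "L p = 0\<^sub>m n n"
  proof (rule eq_matI)
    fix i j assume "i < dim_row (0\<^sub>m n n :: complex mat)" "j < dim_col (0\<^sub>m n n :: complex mat)"
    then have ij: "i < n" "j < n" by auto
    have "cmean (\<lambda>h. s h $$ (i, a) * s' h $$ (b, j)) = 0" if "a < n" "b < n" for a b
    proof -
      have "cmean (\<lambda>h. s h $$ (i, a) * s' h $$ (b, j)) = M $$ (i * n + j, a * n + b)"
        using dj[OF ij] dj[OF that] ij that by (simp add: M_def)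
      then show ?thesis using dj[OF ij] dj[OF that] by (simp add: M0)
    qed
    then show "L p $$ (i, j) = 0\<^sub>m n n $$ (i, j)" using Lent[OF pc ij] ij by simp
  qed (use Lc in auto)
  moreover have "L p = p" unfolding L_def using p by (simp add: iavg_fixed[OF \<sigma> \<sigma>])
  ultimately show False using p0 by simp
qed

end

section \<open>Representations with equal characters are equivalent\<close>

lemma (in group) inv_cancel:
  "x \<in> carrier G \<Longrightarrow> z \<in> carrier G \<Longrightarrow> x \<otimes> (inv x \<otimes> z) = z"
  "x \<in> carrier G \<Longrightarrow> z \<in> carrier G \<Longrightarrow> inv x \<otimes> (x \<otimes> z) = z"
  by (simp_all add: m_assoc[symmetric])

lemma mat_diff_zero:
  fixes A B :: "complex mat"
  assumes "A \<in> carrier_mat n n" "B \<in> carrier_mat n n" "A - B = 0\<^sub>m n n" shows "A = B"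
proof (rule eq_matI)
  fix i j assume "i < dim_row B" "j < dim_col B"
  then have "A $$ (i, j) - B $$ (i, j) = (A - B) $$ (i, j)" "i < n" "j < n" using assms(1,2) by auto
  then show "A $$ (i, j) = B $$ (i, j)" unfolding assms(3) by simp
qed (use assms in auto)

lemma sq_minus:
  fixes A B C :: "'a::comm_ring_1 mat"
  assumes "A \<in> carrier_mat n n" "B \<in> carrier_mat n n" "C \<in> carrier_mat n n"
  shows "A * (B - C) = A * B - A * C" "(A - B) * C = A * C - B * C"
  using assms by (simp_all add: mult_minus_distrib_mat[of _ n n _ n] minus_mult_distrib_mat[of _ n n _ _ n])

lemma sq_zero: "A \<in> carrier_mat n n \<Longrightarrow> A * 0\<^sub>m n n = 0\<^sub>m n n" "A \<in> carrier_mat n n \<Longrightarrow> 0\<^sub>m n n * A = 0\<^sub>m n n"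
  for A :: "'a::semiring_1 mat"
  by simp_all

lemma sq_absorb3:
  fixes X :: "'a::semiring_1 mat"
  assumes "X * (Y * X) = X" "X \<in> carrier_mat n n" "Y \<in> carrier_mat n n" "Z \<in> carrier_mat n n"
  shows "X * (Y * (X * Z)) = X * Z"
proof -
  have "X * (Y * (X * Z)) = (X * (Y * X)) * Z" using assms(2-4) by (simp add: sq_assoc[of _ n] sq_mult)
  then show ?thesis by (simp add: assms(1))
qed

context compact_group begin

text \<open>\<open>P\<close> and \<open>R\<close> are inverse isomorphisms between the summands cut
  out by \<open>R * P\<close> and \<open>P * R\<close>. Subtracting their equal characters, the
  complementary summands have equal characters too, so there is a nonzero intertwiner
  \<open>X\<close> between them; it is added to \<open>P\<close>, and a partial inverse of it to
  \<open>R\<close>.\<close>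

lemma intertwiner_rank_step:
  assumes \<sigma>: "complex_rep G T n \<sigma>" and \<tau>: "complex_rep G T n \<tau>"
    and ch: "\<And>h. h \<in> carrier G \<Longrightarrow> tr (\<sigma> h) = tr (\<tau> h)"
    and P: "intw G n \<sigma> \<tau> P" and R: "intw G n \<tau> \<sigma> R" and PRP: "P * R * P = P" and RPR: "R * P * R = R"
    and trk: "tr (R * P) = of_nat k" and ne: "R * P \<noteq> 1\<^sub>m n"
  obtains P' R' k' where "intw G n \<sigma> \<tau> P'" "intw G n \<tau> \<sigma> R'" "P' * R' * P' = P'" "R' * P' * R' = R'"
    "tr (R' * P') = of_nat k'" "k < k'"
proof -
  have c: "P \<in> carrier_mat n n" "R \<in> carrier_mat n n" using P R by (auto simp: intw_def)
  note r = complex_repD(1)[OF \<sigma>] complex_repD(1)[OF \<tau>]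
  note sm = sq_assoc[of _ n] sq_mult sq_one sq_zero
  define p q where "p = 1\<^sub>m n - R * P" and "q = 1\<^sub>m n - P * R"
  have pq: "intw G n \<sigma> \<sigma> p" "intw G n \<tau> \<tau> q" unfolding p_def q_def
    using intw_one_minus[OF \<sigma> intw_mult[OF \<sigma> \<tau> \<sigma> P R]] intw_one_minus[OF \<tau> intw_mult[OF \<tau> \<sigma> \<tau> R P]] by auto
  have pqc: "p \<in> carrier_mat n n" "q \<in> carrier_mat n n" using pq by (auto simp: intw_def)
  have PRP': "P * (R * P) = P" and RPR': "R * (P * R) = R" using PRP RPR c by (auto simp: sm)
  have z: "P * p = 0\<^sub>m n n" "p * R = 0\<^sub>m n n" "q * P = 0\<^sub>m n n" "R * q = 0\<^sub>m n n"
    using sq_minus(1)[of P n "1\<^sub>m n" "R * P"] sq_minus(2)[of "1\<^sub>m n" n "R * P" R]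
      sq_minus(2)[of "1\<^sub>m n" n "P * R" P] sq_minus(1)[of R n "1\<^sub>m n" "P * R"] c
    by (simp_all add: p_def q_def sq_assoc[of _ n] sq_one PRP' RPR' minus_r_inv_mat[of _ n n])
  have "p * p = p - R * P * p" using sq_minus(2)[of "1\<^sub>m n" n "R * P" p] c pqc by (simp add: p_def[symmetric] sq_one)
  also have "R * P * p = R * (P * p)" using c pqc by (simp add: sm)
  finally have pp: "p * p = p" using c pqc z by auto
  have "q * q = q - P * R * q" using sq_minus(2)[of "1\<^sub>m n" n "P * R" q] c pqc by (simp add: q_def[symmetric] sq_one)
  also have "P * R * q = P * (R * q)" using c pqc by (simp add: sm)
  finally have qq: "q * q = q" using c pqc z by auto
  have trpq: "tr (\<sigma> h * p) = tr (\<tau> h * q)" if h: "h \<in> carrier G" for h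
  proof -
    note rh = r(1)[OF h] r(2)[OF h]
    have cc: "R * P \<in> carrier_mat n n" "P * R \<in> carrier_mat n n" "\<sigma> h * (R * P) \<in> carrier_mat n n"
      "\<tau> h * (P * R) \<in> carrier_mat n n" using c rh by auto
    have "\<sigma> h * p = \<sigma> h - \<sigma> h * (R * P)"
      using sq_minus(1)[OF rh(1) one_carrier_mat cc(1)] rh(1) by (simp add: p_def sq_one)
    then have "tr (\<sigma> h * p) = tr (\<sigma> h) - tr (\<sigma> h * R * P)"
      using tr_minus[OF rh(1) cc(3)] sq_assoc[OF rh(1) c(2,1)] by simp
    also have "tr (\<sigma> h * R * P) = tr (P * (\<sigma> h * R))" by (rule tr_mult_comm) (use c rh in auto)
    also have "P * (\<sigma> h * R) = P * \<sigma> h * R" by (rule sq_assoc[OF c(1) rh(1) c(2), symmetric])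
    also have "\<dots> = \<tau> h * P * R" using P h by (simp add: intw_def)
    also have "\<dots> = \<tau> h * (P * R)" by (rule sq_assoc[OF rh(2) c])
    also have "tr (\<sigma> h) - tr (\<tau> h * (P * R)) = tr (\<tau> h * q)"
    proof -
      have "\<tau> h * q = \<tau> h - \<tau> h * (P * R)"
        using sq_minus(1)[OF rh(2) one_carrier_mat cc(2)] rh(2) by (simp add: q_def sq_one)
      then show ?thesis using tr_minus[OF rh(2) cc(4)] ch[OF h] by simp
    qed
    finally show ?thesis .
  qed
  have "p \<noteq> 0\<^sub>m n n"
  proof
    assume "p = 0\<^sub>m n n"
    then have "1\<^sub>m n = R * P" using c by (intro mat_diff_zero[OF one_carrier_mat sq_mult]) (simp_all add: p_def)
    then show False using ne by simp
  qed
  from exists_intertwiner[OF \<sigma> \<tau> pq(1) pp pq(2) qq trpq this]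
  obtain X where X: "intw G n \<sigma> \<tau> X" "q * X = X" "X * p = X" "X \<noteq> 0\<^sub>m n n" by metis
  have Xc: "X \<in> carrier_mat n n" using X by (auto simp: intw_def)
  obtain Y0 where Y0: "Y0 \<in> carrier_mat n n" "X * Y0 * X = X" using generalized_inverse[OF Xc] by blast
  \<comment> \<open>Averaging turns the generalized inverse into an intertwiner. Since
    \<open>X\<close> is one itself, it passes through the average and \<open>X * Y1 * X = X\<close>
    persists.\<close>
  define Y1 where "Y1 = iavg n \<tau> \<sigma> Y0"
  have Y1: "intw G n \<tau> \<sigma> Y1" unfolding Y1_def by (rule iavg_intw[OF \<tau> \<sigma> Y0(1)])
  have Y1c: "Y1 \<in> carrier_mat n n" using Y1 by (auto simp: intw_def)
  have XY1: "X * Y1 * X = X"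
  proof -
    have cm: "cmat T n (\<lambda>h. \<sigma> h * Y0 * \<tau> (inv h))" by (rule iavg_cmat[OF \<tau> \<sigma> Y0(1)])
    have "X * Y1 * X = mmean n (\<lambda>h. X * (\<sigma> h * Y0 * \<tau> (inv h)) * X)"
      unfolding Y1_def iavg_def by (rule mmean_sandwich[OF cm Xc Xc, symmetric])
    also have "\<dots> = mmean n (\<lambda>h. \<tau> h * X * \<sigma> (inv h))"
    proof (rule mmean_cong)
      fix h assume h: "h \<in> carrier G"
      note rh = r(1)[OF h] r(2)[OF h] r(1)[of "inv h"] r(2)[of "inv h"]
      have "X * (\<sigma> h * Y0 * \<tau> (inv h)) * X = (X * \<sigma> h) * Y0 * (\<tau> (inv h) * X)"
        using h rh Xc Y0 by (simp add: sm)
      also have "X * \<sigma> h = \<tau> h * X" using X h by (simp add: intw_def)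
      also have "\<tau> (inv h) * X = X * \<sigma> (inv h)" using X h by (simp add: intw_def)
      also have "\<tau> h * X * Y0 * (X * \<sigma> (inv h)) = \<tau> h * (X * Y0 * X) * \<sigma> (inv h)"
        using h rh Xc Y0(1) by (simp add: sm)
      finally show "X * (\<sigma> h * Y0 * \<tau> (inv h)) * X = \<tau> h * X * \<sigma> (inv h)" unfolding Y0(2) .
    qed
    also have "\<dots> = X" using iavg_fixed[OF \<sigma> \<tau> X(1)] by (simp add: iavg_def)
    finally show ?thesis .
  qed
  \<comment> \<open>Cutting down to the complementary summands makes all mixed products with
    \<open>P\<close> and \<open>R\<close> vanish.\<close>
  define Y2 where "Y2 = p * Y1 * q"
  have Y2: "intw G n \<tau> \<sigma> Y2" unfolding Y2_def
    using intw_mult[OF \<tau> \<tau> \<sigma> pq(2) intw_mult[OF \<tau> \<sigma> \<sigma> Y1 pq(1)]] .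
  have Y2c: "Y2 \<in> carrier_mat n n" using Y2 by (auto simp: intw_def)
  have "X * Y2 * X = (X * p) * Y1 * (q * X)" unfolding Y2_def using Xc pqc Y1c by (simp add: sm)
  then have XY2: "X * (Y2 * X) = X" using X XY1 Xc Y2c by (simp add: sm)
  \<comment> \<open>The usual passage from a one-sided generalized inverse to a reflexive one: now
    \<open>Y * X * Y = Y\<close> holds as well.\<close>
  define Y where "Y = Y2 * X * Y2"
  have Y: "intw G n \<tau> \<sigma> Y" unfolding Y_def
    using intw_mult[OF \<tau> \<sigma> \<sigma> Y2 intw_mult[OF \<sigma> \<tau> \<sigma> X(1) Y2]] .
  have Yc: "Y \<in> carrier_mat n n" using Y by (auto simp: intw_def)
  have "X * Y * X = (X * (Y2 * X)) * (Y2 * X)" unfolding Y_def using Xc Y2c by (simp add: sm)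
  then have XYX: "X * (Y * X) = X" unfolding XY2 using XY2 Xc Yc by (simp add: sm)
  have YXY: "Y * (X * Y) = Y"
    unfolding Y_def using Xc Y2c by (simp add: sm sq_absorb3[OF XY2])
  have pY: "p * Y = Y"
  proof -
    have "p * Y = (p * p) * Y1 * q * X * Y2" unfolding Y_def Y2_def using Xc pqc Y1c by (simp add: sm)
    then show ?thesis unfolding pp Y_def using Xc pqc Y1c by (simp add: sm Y2_def)
  qed
  have Yq: "Y * q = Y"
  proof -
    have "Y * q = Y2 * X * p * Y1 * (q * q)" unfolding Y_def Y2_def using Xc pqc Y1c by (simp add: sm)
    then show ?thesis unfolding qq Y_def using Xc pqc Y1c by (simp add: sm Y2_def)
  qed
  have zero: "P * Y = 0\<^sub>m n n" "Y * P = 0\<^sub>m n n" "R * X = 0\<^sub>m n n" "X * R = 0\<^sub>m n n"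
  proof -
    have "P * Y = P * (p * Y)" by (simp only: pY)
    also have "\<dots> = P * p * Y" by (rule sq_assoc[OF c(1) pqc(1) Yc, symmetric])
    finally show "P * Y = 0\<^sub>m n n" unfolding z using Yc by (simp add: sq_zero)
    have "Y * P = Y * q * P" by (simp only: Yq)
    also have "\<dots> = Y * (q * P)" by (rule sq_assoc[OF Yc pqc(2) c(1)])
    finally show "Y * P = 0\<^sub>m n n" unfolding z using Yc by (simp add: sq_zero)
    have "R * X = R * (q * X)" by (simp only: X(2))
    also have "\<dots> = R * q * X" by (rule sq_assoc[OF c(2) pqc(2) Xc, symmetric])
    finally show "R * X = 0\<^sub>m n n" unfolding z using Xc by (simp add: sq_zero)
    have "X * R = X * p * R" by (simp only: X(3))
    also have "\<dots> = X * (p * R)" by (rule sq_assoc[OF Xc pqc(1) c(2)])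
    finally show "X * R = 0\<^sub>m n n" unfolding z using Xc by (simp add: sq_zero)
  qed
  have RP': "(R + Y) * (P + X) = R * P + Y * X"
    using c Xc Yc zero by (simp add: sq_distribs[of _ n])
  have PR': "(P + X) * (R + Y) = P * R + X * Y"
    using c Xc Yc zero by (simp add: sq_distribs[of _ n])
  have 1: "(P + X) * (R + Y) * (P + X) = P + X"
  proof -
    have e: "P * R * X = 0\<^sub>m n n" "X * Y * P = 0\<^sub>m n n" "P * R * P = P" "X * Y * X = X"
      using c Xc Yc zero PRP' XYX by (simp_all add: sm)
    show ?thesis unfolding PR' using c Xc Yc
      by (simp add: sq_distribs[of _ n] sq_mult e del: assoc_mult_mat)
  qed
  have 2: "(R + Y) * (P + X) * (R + Y) = R + Y"
  proof -
    have e: "R * P * Y = 0\<^sub>m n n" "Y * X * R = 0\<^sub>m n n" "R * P * R = R" "Y * X * Y = Y"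
      using c Xc Yc zero RPR' YXY by (simp_all add: sm)
    show ?thesis unfolding RP' using c Xc Yc
      by (simp add: sq_distribs[of _ n] sq_mult e del: assoc_mult_mat)
  qed
  have "Y * X * (Y * X) = Y * X" using XYX Xc Yc by (simp add: sm)
  moreover have "Y * X \<in> carrier_mat n n" using Xc Yc by simp
  ultimately obtain l where l: "tr (Y * X) = of_nat l" "l = 0 \<Longrightarrow> Y * X = 0\<^sub>m n n"
    using idempotent_trace by blast
  have "l \<noteq> 0"
  proof
    assume "l = 0"
    then have "X = 0\<^sub>m n n" using l(2) XYX Xc by simp
    then show False using X by simp
  qed
  have "tr ((R + Y) * (P + X)) = of_nat (k + l)"
    unfolding RP' using c Xc Yc by (simp add: tr_add[of _ n] trk l)
  then show ?thesis
    using that[of "P + X" "R + Y" "k + l"] intw_add[OF \<sigma> \<tau> P X(1)] intw_add[OF \<tau> \<sigma> R Y] 1 2 \<open>l \<noteq> 0\<close> by simp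
qed

text \<open>Take a partial isomorphism of largest rank, measured by the trace of
  \<open>R * P\<close>. Ranks are bounded by \<open>n\<close>, the zero matrices supply a start, and
  by the rank step a largest one is an isomorphism.\<close>

lemma equal_characters_intertwiner:
  assumes \<sigma>: "complex_rep G T n \<sigma>" and \<tau>: "complex_rep G T n \<tau>"
    and ch: "\<And>h. h \<in> carrier G \<Longrightarrow> tr (\<sigma> h) = tr (\<tau> h)"
  obtains P where "intw G n \<sigma> \<tau> P" "det P \<noteq> 0"
proof -
  define S where "S = {k. \<exists>P R. intw G n \<sigma> \<tau> P \<and> intw G n \<tau> \<sigma> R \<and> P * R * P = P \<and> R * P * R = R \<and> tr (R * P) = of_nat k}"
  have "k \<le> n" if "k \<in> S" for k
  proof -
    from that obtain P R where P: "intw G n \<sigma> \<tau> P" "intw G n \<tau> \<sigma> R" "P * R * P = P" "tr (R * P) = of_nat k"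
      unfolding S_def by blast
    then have c: "P \<in> carrier_mat n n" "R \<in> carrier_mat n n" by (auto simp: intw_def)
    then have "R * P * (R * P) = R * P" using P(3) by (simp add: sq_assoc[of _ n] sq_mult)
    moreover have "R * P \<in> carrier_mat n n" using c by simp
    ultimately obtain l where "tr (R * P) = of_nat l" "l \<le> n" using idempotent_trace by blast
    then show ?thesis using P(4) by simp
  qed
  then have fin: "finite S" by (meson finite_nat_set_iff_bounded_le)
  have "intw G n \<sigma> \<tau> (0\<^sub>m n n)" "intw G n \<tau> \<sigma> (0\<^sub>m n n)"
    using complex_repD(1)[OF \<sigma>] complex_repD(1)[OF \<tau>] by (auto simp: intw_def sq_zero)
  then have "0 \<in> S" unfolding S_def by (intro CollectI exI[of _ "0\<^sub>m n n"]) (auto simp: tr_def)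
  then have "Max S \<in> S" using fin by (intro Max_in) auto
  then obtain P R where PR: "intw G n \<sigma> \<tau> P" "intw G n \<tau> \<sigma> R" "P * R * P = P" "R * P * R = R" "tr (R * P) = of_nat (Max S)"
    unfolding S_def by blast
  have "R * P = 1\<^sub>m n"
  proof (rule ccontr)
    assume "R * P \<noteq> 1\<^sub>m n"
    from intertwiner_rank_step[OF \<sigma> \<tau> ch PR this]
    obtain P' R' k' where "intw G n \<sigma> \<tau> P'" "intw G n \<tau> \<sigma> R'" "P' * R' * P' = P'" "R' * P' * R' = R'"
      "tr (R' * P') = of_nat k'" "Max S < k'" by metis
    moreover from this have "k' \<in> S" unfolding S_def by blast
    ultimately show False using Max_ge[OF fin, of k'] by simp
  qed
  then have "det R * det P = 1" using PR by (simp add: intw_def det_mult[of _ n, symmetric])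
  then have "det P \<noteq> 0" by auto
  then show ?thesis using that[OF PR(1)] by blast
qed

end

section \<open>Extension of a representation from a subgroup of index two\<close>

lemma continuous_map_clopen_cases:
  assumes S: "openin X S" "closedin X S"
    and f: "continuous_map (subtopology X S) Y f" and g: "continuous_map (subtopology X (topspace X - S)) Y g"
  shows "continuous_map X Y (\<lambda>x. if x \<in> S then f x else g x)"
  unfolding continuous_map_def
proof (intro conjI allI impI)
  have SX: "S \<subseteq> topspace X" using S(1) openin_subset by blast
  show "(\<lambda>x. if x \<in> S then f x else g x) \<in> topspace X \<rightarrow> topspace Y"
    using f g SX by (auto simp: continuous_map_def Pi_iff)
  fix U assume U: "openin Y U"
  have o: "openin X (topspace X - S)" using S(2) by blast
  have "openin X {x \<in> topspace (subtopology X S). f x \<in> U}"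
    using openin_continuous_map_preimage[OF f U] openin_trans_full[OF _ S(1)] by blast
  moreover have "openin X {x \<in> topspace (subtopology X (topspace X - S)). g x \<in> U}"
    using openin_continuous_map_preimage[OF g U] openin_trans_full[OF _ o] by blast
  moreover have "{x \<in> topspace X. (if x \<in> S then f x else g x) \<in> U} =
    {x \<in> topspace (subtopology X S). f x \<in> U} \<union> {x \<in> topspace (subtopology X (topspace X - S)). g x \<in> U}"
    using SX by auto
  ultimately show "openin X {x \<in> topspace X. (if x \<in> S then f x else g x) \<in> U}" by auto
qed

text \<open>The intertwiner \<open>P\<close> may be changed by any \<open>C\<close> commuting with \<open>\<sigma>\<close> and \<open>P\<close>. For
  \<open>Q = P\<^sup>2 \<sigma>(\<alpha>\<^sup>-\<^sup>2)\<close>, which commutes with \<open>\<sigma>\<close> and \<open>P\<close>, choose \<open>C\<close> with \<open>C\<^sup>2 = Q\<^sup>-\<^sup>1\<close> as a polynomial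
  in \<open>Q\<^sup>-\<^sup>1\<close>; then \<open>(P C)\<^sup>2 = \<sigma>(\<alpha>\<^sup>2)\<close>.\<close>

lemma extend_index_two:
  fixes G (structure)
  assumes "compact_group G T" and K: "subgroup K G" and H: "subgroup H G" "closedin T H" "H \<subseteq> K"
    and \<sigma>: "complex_rep (G\<lparr>carrier := H\<rparr>) (subtopology T H) n \<sigma>"
    and a: "a \<in> K" "a \<notin> H" "\<And>k. k \<in> K \<Longrightarrow> k \<notin> H \<Longrightarrow> inv a \<otimes> k \<in> H"
    and norm: "\<And>h. h \<in> H \<Longrightarrow> inv a \<otimes> h \<otimes> a \<in> H"
    and P: "P \<in> carrier_mat n n" "det P \<noteq> 0" "\<And>h. h \<in> H \<Longrightarrow> \<sigma> h * P = P * \<sigma> (inv a \<otimes> h \<otimes> a)"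
  obtains \<tau> where "complex_rep (G\<lparr>carrier := K\<rparr>) (subtopology T K) n \<tau>" "\<And>h. h \<in> H \<Longrightarrow> \<tau> h = \<sigma> h"
proof -
  interpret compact_group G T by fact
  note sm = sq_assoc[of _ n] sq_mult sq_one
  note s1 = complex_repD(1)[OF \<sigma>, simplified] and s2 = complex_repD(2)[OF \<sigma>, simplified]
    and s3 = complex_repD(3)[OF \<sigma>, simplified]
  note [simp] = subgroup.mem_carrier[OF H(1)] subgroup.mem_carrier[OF K]
  have ac: "a \<in> carrier G" using a by simp
  have aa: "a \<otimes> a \<in> H"
  proof (rule ccontr)
    assume "a \<otimes> a \<notin> H"
    then have "inv a \<otimes> (a \<otimes> a) \<in> H" using a(3) subgroup.m_closed[OF K a(1) a(1)] by blast
    then show False using ac a(2) by (simp add: m_assoc[symmetric])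
  qed
  \<comment> \<open>With \<open>b\<close> the inverse of the square of \<open>a\<close>, the matrix
    \<open>Q\<close> below measures how far the square of \<open>P\<close> is from \<sigma> of that
    square.\<close>
  define b where "b = inv (a \<otimes> a)"
  have b: "b \<in> H" unfolding b_def by (rule subgroup.m_inv_closed[OF H(1) aa])
  have ab: "inv a \<otimes> b \<otimes> a = b" using ac by (simp add: b_def inv_mult_group m_assoc)
  have sb: "\<sigma> b * \<sigma> (a \<otimes> a) = 1\<^sub>m n" "\<sigma> (a \<otimes> a) * \<sigma> b = 1\<^sub>m n"
    using s3[OF b aa] s3[OF aa b] s2 ac by (simp_all add: b_def)
  have Pb: "\<sigma> b * P = P * \<sigma> b" using P(3)[OF b] ab by simp
  define Q where "Q = P * P * \<sigma> b"
  have Qc: "Q \<in> carrier_mat n n" using P(1) s1[OF b] by (simp add: Q_def)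
  have PQ: "P * Q = Q * P"
  proof -
    have "Q * P = P * P * (\<sigma> b * P)" using P(1) s1[OF b] by (simp add: Q_def sm)
    then show ?thesis unfolding Pb using P(1) s1[OF b] by (simp add: Q_def sm)
  qed
  \<comment> \<open>Passing \<sigma> of \<open>h\<close> through \<open>P\<close> twice conjugates
    \<open>h\<close> by the square of \<open>a\<close>; the factor \<open>\<sigma> b\<close> undoes
    this conjugation.\<close>
  have sQ: "\<sigma> h * Q = Q * \<sigma> h" if h: "h \<in> H" for h
  proof -
    define h1 h2 where "h1 = inv a \<otimes> h \<otimes> a" and "h2 = inv a \<otimes> h1 \<otimes> a"
    have hh: "h1 \<in> H" "h2 \<in> H" using norm h by (auto simp: h1_def h2_def)
    note ss = s1[OF h] s1[OF hh(1)] s1[OF hh(2)] s1[OF b]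
    have "\<sigma> h * Q = (\<sigma> h * P) * P * \<sigma> b" using P(1) ss by (simp add: Q_def sm)
    also have "\<dots> = P * (\<sigma> h1 * P) * \<sigma> b" using P(1) ss P(3)[OF h] by (simp add: sm h1_def)
    also have "\<dots> = P * P * (\<sigma> h2 * \<sigma> b)" using P(1) ss P(3)[OF hh(1)] by (simp add: sm h2_def)
    also have "\<sigma> h2 * \<sigma> b = \<sigma> (h2 \<otimes> b)" using s3[OF hh(2) b] by simp
    also have "h2 \<otimes> b = b \<otimes> h" using ac h by (simp add: h1_def h2_def b_def inv_mult_group m_assoc inv_cancel)
    also have "\<sigma> (b \<otimes> h) = \<sigma> b * \<sigma> h" using s3[OF b h] by simp
    finally show ?thesis using P(1) ss by (simp add: Q_def sm)
  qed
  have "det (\<sigma> b) * det (\<sigma> (a \<otimes> a)) = 1" using sb(1) s1[OF b] s1[OF aa] by (simp add: det_mult[of _ n, symmetric])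
  then have "det (\<sigma> b) \<noteq> 0" by auto
  then have dQ: "det Q \<noteq> 0" using P s1[OF b] by (simp add: Q_def det_mult[of _ n] sq_mult)
  note mi = minv[OF Qc dQ]
  have comm: "X * minv Q = minv Q * X" if X: "X \<in> carrier_mat n n" "X * Q = Q * X" for X
  proof -
    have "X * minv Q = minv Q * (Q * (X * minv Q))"
      using sq_cancel[OF mi(3,1) Qc, of "X * minv Q"] mi(1) X(1) by simp
    also have "Q * (X * minv Q) = Q * X * minv Q" by (rule sq_assoc[OF Qc X(1) mi(1), symmetric])
    also have "\<dots> = X * (Q * minv Q)" unfolding X(2)[symmetric] by (rule sq_assoc[OF X(1) Qc mi(1)])
    also have "\<dots> = X" unfolding mi(2) using X(1) by simp
    finally show ?thesis .
  qed
  have "det (minv Q) \<noteq> 0"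
  proof -
    have "det Q * det (minv Q) = 1" using mi Qc by (simp add: det_mult[of _ n, symmetric])
    then show ?thesis by auto
  qed
  from matrix_sqrt[OF mi(1) this] obtain C where C: "C \<in> carrier_mat n n" "C * C = minv Q"
    and Ccomm: "\<And>X. X \<in> carrier_mat n n \<Longrightarrow> X * minv Q = minv Q * X \<Longrightarrow> X * C = C * X" by blast
  have PC: "P * C = C * P" using Ccomm[OF P(1) comm[OF P(1) PQ]] .
  have sC: "\<sigma> h * C = C * \<sigma> h" if "h \<in> H" for h using Ccomm[OF s1 comm[OF s1 sQ]] that by blast
  define R where "R = P * C"
  have Rc: "R \<in> carrier_mat n n" using P C by (simp add: R_def)
  have RR: "R * R = \<sigma> (a \<otimes> a)"
  proof -
    have "R * R = P * (C * P) * C" unfolding R_def using P(1) C(1) by (simp add: sm)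
    also have "\<dots> = P * P * (C * C)" unfolding PC[symmetric] using P(1) C(1) by (simp add: sm)
    also have "P * P = Q * \<sigma> (a \<otimes> a)"
    proof -
      have "Q * \<sigma> (a \<otimes> a) = P * P * (\<sigma> b * \<sigma> (a \<otimes> a))" unfolding Q_def using P(1) s1[OF b] s1[OF aa] by (simp add: sm)
      then show ?thesis unfolding sb using P(1) by (simp add: sm)
    qed
    also have "\<dots> = \<sigma> (a \<otimes> a) * Q" using sQ[OF aa] by simp
    also have "\<sigma> (a \<otimes> a) * Q * (C * C) = \<sigma> (a \<otimes> a) * (Q * minv Q)" unfolding C(2) using s1[OF aa] Qc mi(1) by (simp add: sm)
    finally show ?thesis unfolding mi(2) using s1[OF aa] by (simp add: sm)
  qed
  have sR: "\<sigma> h * R = R * \<sigma> (inv a \<otimes> h \<otimes> a)" if h: "h \<in> H" for h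
  proof -
    note ss = s1[OF h] s1[OF norm[OF h]]
    have "\<sigma> h * R = (\<sigma> h * P) * C" unfolding R_def using P(1) C(1) ss by (simp add: sm)
    also have "\<dots> = P * (\<sigma> (inv a \<otimes> h \<otimes> a) * C)" unfolding P(3)[OF h] using P(1) C(1) ss by (simp add: sm)
    also have "\<dots> = R * \<sigma> (inv a \<otimes> h \<otimes> a)" unfolding sC[OF norm[OF h]] R_def using P(1) C(1) ss by (simp add: sm)
    finally show ?thesis .
  qed
  \<comment> \<open>\<open>K\<close> is the union of \<open>H\<close> and the coset of
    \<open>a\<close>, and \<open>a\<close> itself is represented by the corrected intertwiner
    \<open>R\<close>.\<close>
  define \<tau> where "\<tau> k = (if k \<in> H then \<sigma> k else R * \<sigma> (inv a \<otimes> k))" for k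
  have Hc: "H \<subseteq> carrier G" "K \<subseteq> carrier G" using H(1) K by (auto dest: subgroup.subset)
  have out: "a \<otimes> h \<notin> H" if "h \<in> H" for h
  proof
    assume "a \<otimes> h \<in> H"
    then have "(a \<otimes> h) \<otimes> inv h \<in> H" using subgroup.m_closed[OF H(1)] subgroup.m_inv_closed[OF H(1)] that by blast
    then show False using a(2) ac that by (simp add: m_assoc)
  qed
  have ta: "\<tau> (a \<otimes> h) = R * \<sigma> h" if h: "h \<in> H" for h
    using out[OF h] ac h by (simp add: \<tau>_def m_assoc[symmetric])
  have dec: "(\<exists>h\<in>H. k = h) \<or> (\<exists>h\<in>H. k = a \<otimes> h)" if "k \<in> K" for k
  proof (cases "k \<in> H")
    case False
    have "k = a \<otimes> (inv a \<otimes> k)" using ac that by (simp add: m_assoc[symmetric])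
    then show ?thesis using a(3)[OF that False] by blast
  qed auto
  have th: "\<tau> h = \<sigma> h" if "h \<in> H" for h using that by (simp add: \<tau>_def)
  have Hm: "h \<otimes> k \<in> H" if "h \<in> H" "k \<in> H" for h k using subgroup.m_closed[OF H(1)] that by blast
  have "complex_rep (G\<lparr>carrier := K\<rparr>) (subtopology T K) n \<tau>"
    unfolding complex_rep_def
  proof (intro conjI ballI allI impI)
    show "\<tau> \<one>\<^bsub>G\<lparr>carrier := K\<rparr>\<^esub> = 1\<^sub>m n" using s2 subgroup.one_closed[OF H(1)] by (simp add: \<tau>_def)
    show "\<tau> k \<in> carrier_mat n n" if "k \<in> carrier (G\<lparr>carrier := K\<rparr>)" for k
      using dec[of k] that s1 Rc ta th by auto
    fix h k assume "h \<in> carrier (G\<lparr>carrier := K\<rparr>)" "k \<in> carrier (G\<lparr>carrier := K\<rparr>)"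
    then have hk: "h \<in> K" "k \<in> K" by auto
    have "\<tau> (h \<otimes> k) = \<tau> h * \<tau> k"
      using dec[OF hk(1)] dec[OF hk(2)]
    proof (elim disjE bexE)
      fix h' k' assume e: "h' \<in> H" "k' \<in> H" "h = h'" "k = k'"
      then show ?thesis using Hm s3 th by simp
    next
      fix h' k' assume e: "h' \<in> H" "k' \<in> H" "h = h'" "k = a \<otimes> k'"
      have "h \<otimes> k = a \<otimes> ((inv a \<otimes> h' \<otimes> a) \<otimes> k')" using e ac by (simp add: m_assoc[symmetric])
      then have "\<tau> (h \<otimes> k) = R * \<sigma> (inv a \<otimes> h' \<otimes> a) * \<sigma> k'"
        using ta[OF Hm[OF norm[OF e(1)] e(2)]] s3[OF norm[OF e(1)] e(2)] Rc s1[OF e(2)] s1[OF norm[OF e(1)]] by (simp add: sm)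
      also have "\<dots> = \<tau> h * \<tau> k" unfolding sR[OF e(1), symmetric] e(3,4) ta[OF e(2)] th[OF e(1)]
        using Rc s1[OF e(1)] s1[OF e(2)] by (simp add: sm)
      finally show ?thesis .
    next
      fix h' k' assume e: "h' \<in> H" "k' \<in> H" "h = a \<otimes> h'" "k = k'"
      have "h \<otimes> k = a \<otimes> (h' \<otimes> k')" using e ac by (simp add: m_assoc)
      then show ?thesis using ta[OF Hm[OF e(1,2)]] s3[OF e(1,2)] Rc s1[OF e(2)] s1[OF e(1)] ta[OF e(1)] th[OF e(2)] e by (simp add: sm)
    next
      fix h' k' assume e: "h' \<in> H" "k' \<in> H" "h = a \<otimes> h'" "k = a \<otimes> k'"
      let ?h = "inv a \<otimes> h' \<otimes> a"
      note ss = s1[OF e(1)] s1[OF e(2)] s1[OF norm[OF e(1)]] s1[OF aa]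
      have "h \<otimes> k = (a \<otimes> a) \<otimes> (?h \<otimes> k')" using e ac by (simp add: m_assoc inv_cancel)
      then have "\<tau> (h \<otimes> k) = \<sigma> (a \<otimes> a) * (\<sigma> ?h * \<sigma> k')"
        using th[OF Hm[OF aa Hm[OF norm[OF e(1)] e(2)]]] s3[OF aa Hm[OF norm[OF e(1)] e(2)]] s3[OF norm[OF e(1)] e(2)] by simp
      also have "\<dots> = R * (R * \<sigma> ?h) * \<sigma> k'" unfolding RR[symmetric] using Rc ss by (simp add: sm)
      also have "\<dots> = \<tau> h * \<tau> k" unfolding sR[OF e(1), symmetric] e(3,4) ta[OF e(1)] ta[OF e(2)]
        using Rc ss by (simp add: sm)
      finally show ?thesis .
    qed
    then show "\<tau> (h \<otimes>\<^bsub>G\<lparr>carrier := K\<rparr>\<^esub> k) = \<tau> h * \<tau> k" by simp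
  next
    fix i j assume ij: "i < n" "j < n"
    let ?X = "subtopology T K"
    have tX: "topspace ?X = K" using Hc by (auto simp: topspace_eq)
    have cl: "closedin ?X H" using H(2,3) by (simp add: closedin_subset_topspace)
    have "continuous_map T T (\<lambda>k. inv a \<otimes> k)"
      by (intro continuous_map_mult continuous_map_const_carrier continuous_map_id[unfolded id_def] inv_closed ac)
    then have ca: "continuous_map ?X T (\<lambda>k. inv a \<otimes> k)" by (rule continuous_map_from_subtopology)
    \<comment> \<open>The nontrivial coset is the preimage of \<open>H\<close> under a translation,
      hence closed. So \<open>H\<close> is open in \<open>K\<close>, and continuity of
      \<open>\<tau>\<close> may be checked on the two cosets separately.\<close>
    have "closedin ?X {k \<in> topspace ?X. inv a \<otimes> k \<in> H}"
      by (rule closedin_continuous_map_preimage[OF ca H(2)])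
    moreover have "{k \<in> topspace ?X. inv a \<otimes> k \<in> H} = topspace ?X - H"
    proof -
      have "k \<notin> H" if "k \<in> K" "inv a \<otimes> k \<in> H" for k
        using out[OF that(2)] inv_cancel(1)[of a k] ac that(1) by simp
      then show ?thesis unfolding tX using a(3) by blast
    qed
    ultimately have op: "openin ?X H" unfolding openin_closedin_eq using H(3) tX by auto
    have "continuous_map ?X euclidean (\<lambda>k. if k \<in> H then \<sigma> k $$ (i, j) else (R * \<sigma> (inv a \<otimes> k)) $$ (i, j))"
    proof (rule continuous_map_clopen_cases[OF op cl, where f = "\<lambda>k. \<sigma> k $$ (i, j)" and g = "\<lambda>k. (R * \<sigma> (inv a \<otimes> k)) $$ (i, j)"])
      have e: "subtopology ?X H = subtopology T H" using H(3) by (simp add: subtopology_subtopology Int_absorb1)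
      have cs: "cmat (subtopology T H) n \<sigma>" using \<sigma> Hc(1) by (auto simp: complex_rep_def cmat_def topspace_eq)
      show "continuous_map (subtopology ?X H) euclidean (\<lambda>k. \<sigma> k $$ (i, j))"
        unfolding e by (rule cmat_entry[OF cs ij])
      have "continuous_map (subtopology ?X (topspace ?X - H)) (subtopology T H) (\<lambda>k. inv a \<otimes> k)"
      proof (rule continuous_map_into_subtopology)
        show "continuous_map (subtopology ?X (topspace ?X - H)) T (\<lambda>k. inv a \<otimes> k)"
          by (rule continuous_map_from_subtopology[OF ca])
        show "(\<lambda>k. inv a \<otimes> k) \<in> topspace (subtopology ?X (topspace ?X - H)) \<rightarrow> H"
          using a(3) unfolding topspace_subtopology tX by blast
      qed
      from cmat_mult[OF cmat_const[OF Rc] cmat_compose[OF this cs]]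
      show "continuous_map (subtopology ?X (topspace ?X - H)) euclidean (\<lambda>k. (R * \<sigma> (inv a \<otimes> k)) $$ (i, j))"
        by (rule cmat_entry[OF _ ij])
    qed
    then show "continuous_map ?X euclidean (\<lambda>k. \<tau> k $$ (i, j))"
      by (rule continuous_map_eq) (simp add: \<tau>_def)
  qed
  then show ?thesis using that th by blast
qed

text \<open>A continuous matrix-valued extension of \<open>\<tau>\<close> to \<open>G\<close> is made equivariant by averaging over \<open>K\<close>;
  it is invertible near \<open>K\<close>, and finitely many translates suffice.\<close>

lemma equivariant_frames:
  fixes G (structure)
  assumes "compact_group G T" "Hausdorff_space T" and K: "subgroup K G" "closedin T K"
    and \<tau>: "complex_rep (G\<lparr>carrier := K\<rparr>) (subtopology T K) n \<tau>"
  obtains m A where "\<And>i. i < (m::nat) \<Longrightarrow> cmat T n (A i)"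
    "\<And>i g k. i < m \<Longrightarrow> g \<in> carrier G \<Longrightarrow> k \<in> K \<Longrightarrow> A i (g \<otimes> k) = A i g * \<tau> k"
    "\<And>g. g \<in> carrier G \<Longrightarrow> \<exists>i<m. det (A i g) \<noteq> 0"
proof -
  interpret compact_group G T by fact
  interpret K: compact_group "G\<lparr>carrier := K\<rparr>" "subtopology T K" by (rule compact_group_subgroup) fact+
  note sm = sq_assoc[of _ n] sq_mult sq_one
  have Kc: "K \<subseteq> carrier G" using K(1) by (rule subgroup.subset)
  have kc: "k \<in> carrier G" if "k \<in> K" for k using Kc that by blast
  have Kinv: "inv\<^bsub>G\<lparr>carrier := K\<rparr>\<^esub> k = inv k" if "k \<in> K" for k using m_inv_consistent[OF K(1) that] .
  note t1 = complex_repD(1)[OF \<tau>, simplified] and t3 = complex_repD(3)[OF \<tau>, simplified]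
  have cmt: "cmat (subtopology T K) n \<tau>" by (rule K.complex_rep_cmat[OF \<tau>])
  have normal: "normal_space T" using compact assms(2) compact_Hausdorff_or_regular_imp_normal_space by blast
  have ext: "\<exists>f. continuous_map T euclidean f \<and> (\<forall>k\<in>K. f k = \<tau> k $$ (i, j))" if ij: "i < n" "j < n" for i j
  proof -
    note e = cmat_entry[OF cmt ij]
    obtain u where u: "continuous_map T euclideanreal u" "\<And>k. k \<in> K \<Longrightarrow> u k = Re (\<tau> k $$ (i, j))"
      using normal[unfolded normal_space_iff_Tietze, rule_format, OF conjI[OF K(2) continuous_map_Re[OF e]]] by blast
    obtain v where v: "continuous_map T euclideanreal v" "\<And>k. k \<in> K \<Longrightarrow> v k = Im (\<tau> k $$ (i, j))"
      using normal[unfolded normal_space_iff_Tietze, rule_format, OF conjI[OF K(2) continuous_map_Im[OF e]]] by blast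
    show ?thesis
      by (rule exI[of _ "\<lambda>x. Complex (u x) (v x)"]) (use u v in \<open>auto intro!: continuous_map_Complex\<close>)
  qed
  \<comment> \<open>Entrywise Tietze extensions of \<open>\<tau>\<close> from the closed set
    \<open>K\<close> to \<open>G\<close>, applied to real and imaginary parts.\<close>
  define f where "f i j = (SOME f. continuous_map T euclidean f \<and> (\<forall>k\<in>K. f k = \<tau> k $$ (i, j)))" for i j
  have f: "continuous_map T euclidean (f i j)" "k \<in> K \<Longrightarrow> f i j k = \<tau> k $$ (i, j)"
    if "i < n" "j < n" for i j k
    using someI_ex[OF ext[OF that]] by (auto simp: f_def)
  define E where "E g = Matrix.mat n n (\<lambda>(i, j). f i j g)" for g
  have Ec: "E g \<in> carrier_mat n n" for g by (simp add: E_def)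
  have E: "cmat T n E" by (rule cmatI) (use f in \<open>auto simp: E_def\<close>)
  have EK: "E k = \<tau> k" if "k \<in> K" for k
    using f(2) that t1[OF that] by (intro eq_matI) (auto simp: E_def)
  \<comment> \<open>The mean of this integrand over \<open>k\<close> is the equivariant part of
    \<open>E\<close>: replacing \<open>g\<close> by its product with an element of \<open>K\<close>
    is absorbed by left invariance of the mean on \<open>K\<close>, up to a factor on the
    right.\<close>
  define F where "F g k = E (g \<otimes> k) * \<tau> (inv k)" for g k
  define B where "B g = K.mmean n (F g)" for g
  have invK: "continuous_map (subtopology T K) (subtopology T K) (\<lambda>k. inv k)"
    by (rule continuous_map_eq[OF K.inv_cont]) (use Kinv in auto)
  have "cmat (prod_topology T (subtopology T K)) n (\<lambda>p. E (fst p \<otimes> snd p) * \<tau> (inv (snd p)))"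
  proof (rule cmat_mult)
    have "continuous_map (prod_topology T (subtopology T K)) T (\<lambda>p. fst p \<otimes> snd p)"
      by (intro continuous_map_mult continuous_map_fst continuous_map_into_fulltopology[OF continuous_map_snd])
    from cmat_compose[OF this E] show "cmat (prod_topology T (subtopology T K)) n (\<lambda>p. E (fst p \<otimes> snd p))" .
    have "continuous_map (prod_topology T (subtopology T K)) (subtopology T K) (\<lambda>p. inv (snd p))"
      using continuous_map_compose[OF continuous_map_snd invK] by (simp add: o_def)
    from cmat_compose[OF this cmt] show "cmat (prod_topology T (subtopology T K)) n (\<lambda>p. \<tau> (inv (snd p)))" .
  qed
  then have F: "cmat (prod_topology T (subtopology T K)) n (\<lambda>(g, k). F g k)"
    by (simp add: F_def case_prod_unfold)
  have Fg: "cmat (subtopology T K) n (F g)" if "g \<in> carrier G" for g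
  proof -
    have "continuous_map (subtopology T K) (prod_topology T (subtopology T K)) (\<lambda>k. (g, k))"
      using that by (intro continuous_map_pairedI) (auto simp: topspace_eq)
    from cmat_compose[OF this F] show ?thesis by simp
  qed
  have B: "cmat T n B"
  proof (rule cmatI)
    fix i j assume ij: "i < n" "j < n"
    have "continuous_map T euclidean (\<lambda>g. K.cmean (\<lambda>k. F g k $$ (i, j)))"
      by (rule K.cmean_continuous) (use cmat_entry[OF F ij] in \<open>simp add: case_prod_unfold\<close>)
    then show "continuous_map T euclidean (\<lambda>g. B g $$ (i, j))" using ij by (simp add: B_def K.mmean_def)
  qed (simp add: B_def)
  have Beq: "B (g \<otimes> k) = B g * \<tau> k" if g: "g \<in> carrier G" and k: "k \<in> K" for g k
  proof -
    have "B (g \<otimes> k) = K.mmean n (\<lambda>l. F g (k \<otimes> l) * \<tau> k)" unfolding B_def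
    proof (rule K.mmean_cong)
      fix l assume "l \<in> carrier (G\<lparr>carrier := K\<rparr>)"
      then have l: "l \<in> K" by simp
      have i: "inv l \<in> K" "inv k \<in> K" "inv (k \<otimes> l) \<in> K"
        using subgroup.m_inv_closed[OF K(1)] subgroup.m_closed[OF K(1)] k l by auto
      have "\<tau> (inv (k \<otimes> l)) * \<tau> k = \<tau> (inv (k \<otimes> l) \<otimes> k)" using t3[OF i(3) k] by simp
      also have "inv (k \<otimes> l) \<otimes> k = inv l" using kc[OF k] kc[OF l] by (simp add: inv_mult_group m_assoc)
      finally show "F (g \<otimes> k) l = F g (k \<otimes> l) * \<tau> k"
        unfolding F_def using g kc[OF k] kc[OF l] Ec t1[OF i(3)] t1[OF k] by (simp add: sm m_assoc)
    qed
    also have "\<dots> = K.mmean n (\<lambda>l. F g (k \<otimes> l)) * \<tau> k"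
    proof (rule K.mmean_right[OF _ t1[OF k]])
      have "continuous_map (subtopology T K) (subtopology T K) (\<lambda>l. k \<otimes>\<^bsub>G\<lparr>carrier := K\<rparr>\<^esub> l)"
        by (intro K.continuous_map_mult K.continuous_map_const_carrier continuous_map_id[unfolded id_def]) (use k in simp)
      from cmat_compose[OF this Fg[OF g]] show "cmat (subtopology T K) n (\<lambda>l. F g (k \<otimes> l))" by simp
    qed
    finally have "B (g \<otimes> k) = K.mmean n (\<lambda>l. F g (k \<otimes> l)) * \<tau> k" .
    moreover have "K.mmean n (\<lambda>l. F g (k \<otimes> l)) = B g" unfolding B_def
      using K.mmean_left_invariant[OF Fg[OF g], of k] k by simp
    ultimately show ?thesis by (simp only:)
  qed
  \<comment> \<open>On \<open>K\<close> the function \<open>E\<close> already is the representation,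
    so the integrand at \<one> is constantly the identity.\<close>
  have "B \<one> = K.mmean n (\<lambda>l. 1\<^sub>m n)" unfolding B_def
  proof (rule K.mmean_cong)
    fix l assume "l \<in> carrier (G\<lparr>carrier := K\<rparr>)"
    then have l: "l \<in> K" by simp
    have "F \<one> l = \<tau> l * \<tau> (inv l)" using l kc[OF l] by (simp add: F_def EK)
    then show "F \<one> l = 1\<^sub>m n" using complex_rep_inv(1)[OF K.group_axioms \<tau>, of l] l Kinv[OF l] by simp
  qed
  then have B1: "B \<one> = 1\<^sub>m n" by (simp add: K.mmean_const)
  \<comment> \<open>The inverse inside adapts the set to a cover by right translates: applied to
    \<open>inv g\<close>, such a cover makes \<open>B (b i \<otimes> g)\<close> invertible for some
    \<open>i\<close>, and left translates of \<open>B\<close> remain equivariant on the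
    right.\<close>
  define U where "U = {g \<in> topspace T. det (B (inv g)) \<in> - {0}}"
  have U1: "openin T U" unfolding U_def
    by (rule openin_continuous_map_preimage[OF continuous_map_det[OF cmat_compose[OF inv_cont B]]]) auto
  have U2: "\<one> \<in> U" by (simp add: U_def B1 topspace_eq)
  obtain m b where b: "(m::nat) > 0" "\<And>i. i < m \<Longrightarrow> b i \<in> carrier G"
    "\<And>x. x \<in> carrier G \<Longrightarrow> \<exists>i<m. x \<otimes> inv (b i) \<in> U" using finite_translate_cover[OF U1 U2] by blast
  show ?thesis
  proof (rule that[of m "\<lambda>i g. B (b i \<otimes> g)"])
    fix i assume i: "i < m"
    have "continuous_map T T (\<lambda>g. b i \<otimes> g)"
      by (intro continuous_map_mult continuous_map_const_carrier b(2)[OF i] continuous_map_id[unfolded id_def])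
    from cmat_compose[OF this B] show "cmat T n (\<lambda>g. B (b i \<otimes> g))" .
    show "B (b i \<otimes> (g \<otimes> k)) = B (b i \<otimes> g) * \<tau> k" if "g \<in> carrier G" "k \<in> K" for g k
      using Beq[of "b i \<otimes> g" k] that b(2)[OF i] kc by (simp add: m_assoc)
  next
    fix g assume g: "g \<in> carrier G"
    obtain i where i: "i < m" "inv g \<otimes> inv (b i) \<in> U" using b(3)[of "inv g"] g by auto
    have "inv (inv g \<otimes> inv (b i)) = b i \<otimes> g" using g b(2)[OF i(1)] by (simp add: inv_mult_group)
    then show "\<exists>i<m. det (B (b i \<otimes> g)) \<noteq> 0" using i by (auto simp: U_def)
  qed
qed

section \<open>Gluing an equivariant bundle over the circle\<close>

lemma topspace_circle: "topspace circle = sphere 0 1"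
  by (simp add: circle_def)

lemma Hausdorff_circle: "Hausdorff_space circle"
  by (simp add: circle_def Hausdorff_space_subtopology)

lemma continuous_map_matrix_vector:
  fixes A :: "'a \<Rightarrow> real^2^2"
  assumes "continuous_map X euclidean A" "continuous_map X euclidean x"
  shows "continuous_map X euclidean (\<lambda>p. A p *v x p)"
proof -
  have "continuous_on UNIV (\<lambda>p. fst p *v snd p :: real^2)" for p :: "(real^2^2) \<times> (real^2)"
    unfolding matrix_vector_mult_def by (intro continuous_intros)
  then have "continuous_map (prod_topology euclidean euclidean) euclidean (\<lambda>p. (fst p :: real^2^2) *v snd p)"
    by simp
  from continuous_map_compose[OF continuous_map_pairedI[OF assms] this] show ?thesis by (simp add: o_def)
qed

lemma continuous_map_locally:
  assumes "\<And>x. x \<in> topspace X \<Longrightarrow> \<exists>U. openin X U \<and> x \<in> U \<and> continuous_map (subtopology X U) Y f"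
  shows "continuous_map X Y f"
  unfolding continuous_map_def
proof (intro conjI allI impI)
  show "f \<in> topspace X \<rightarrow> topspace Y"
  proof
    fix x assume x: "x \<in> topspace X"
    from assms[OF x] obtain U where "x \<in> U" "continuous_map (subtopology X U) Y f" by blast
    then show "f x \<in> topspace Y" using x by (auto simp: continuous_map_def Pi_iff)
  qed
  fix V assume V: "openin Y V"
  show "openin X {x \<in> topspace X. f x \<in> V}"
  proof (subst openin_subopen, intro ballI)
    fix x assume "x \<in> {x \<in> topspace X. f x \<in> V}"
    then have x: "x \<in> topspace X" "f x \<in> V" by auto
    from assms[OF x(1)] obtain U where U: "openin X U" "x \<in> U" "continuous_map (subtopology X U) Y f" by blast
    have "openin X {x \<in> topspace (subtopology X U). f x \<in> V}"
      using openin_continuous_map_preimage[OF U(3) V] openin_trans_full[OF _ U(1)] by blast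
    then show "\<exists>W. openin X W \<and> x \<in> W \<and> W \<subseteq> {x \<in> topspace X. f x \<in> V}"
      using x U(2) by (intro exI[of _ "{x \<in> topspace (subtopology X U). f x \<in> V}"]) auto
  qed
qed

lemma linear_mapI:
  assumes "vectorspace R V" "vectorspace R W"
    "\<And>v. v \<in> carrier V \<Longrightarrow> f v \<in> carrier W"
    "\<And>v w. v \<in> carrier V \<Longrightarrow> w \<in> carrier V \<Longrightarrow> f (v \<oplus>\<^bsub>V\<^esub> w) = f v \<oplus>\<^bsub>W\<^esub> f w"
    "\<And>c v. c \<in> carrier R \<Longrightarrow> v \<in> carrier V \<Longrightarrow> f (c \<odot>\<^bsub>V\<^esub> v) = c \<odot>\<^bsub>W\<^esub> f v"
  shows "linear_map R V W f"
  using assms unfolding linear_map_def mod_hom_def mod_hom_axioms_def module_hom_def vectorspace_def by auto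

text \<open>The pairs \<open>(g, t)\<close> parametrise the circle by \<open>\<rho> g *v y t\<close>. The fiber over this point is the set
  of all \<open>(F 0 g t *\<^sub>v v, F 1 g t *\<^sub>v v, \<dots>)\<close>; assumption \<open>glue\<close> says that this depends on the point only,
  compatibly with left translation by \<open>G\<close>.\<close>

locale bundle_data = compact_group G T for G :: "('g, 'r) monoid_scheme" (structure) and T :: "'g topology" +
  fixes \<rho> :: "'g \<Rightarrow> real^2^2" and y :: "real \<Rightarrow> real^2" and m n :: nat
    and F :: "nat \<Rightarrow> 'g \<Rightarrow> real \<Rightarrow> complex mat" and \<sigma> :: "'g \<Rightarrow> complex mat"
    and j :: "(real^2) \<times> (nat \<Rightarrow> complex vec) \<Rightarrow> 'e"
  assumes Hausdorff: "Hausdorff_space T"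
    and rep: "orthogonal_rep G T \<rho>"
    and y_cont: "continuous_map (top_of_set {0..1}) circle y"
    and F_cont: "\<And>i. i < m \<Longrightarrow> cmat (prod_topology T (top_of_set {0..1})) n (\<lambda>(g, t). F i g t)"
    and F_nz: "\<And>g t. g \<in> carrier G \<Longrightarrow> t \<in> {0..1} \<Longrightarrow> \<exists>i<m. det (F i g t) \<noteq> 0"
    and glue: "\<And>k t t'. k \<in> carrier G \<Longrightarrow> t \<in> {0..1} \<Longrightarrow> t' \<in> {0..1} \<Longrightarrow> \<rho> k *v y t' = y t \<Longrightarrow>
      \<exists>C\<in>carrier_mat n n. det C \<noteq> 0 \<and> (\<forall>i<m. \<forall>g\<in>carrier G. F i (g \<otimes> k) t' = F i g t * C)"
    and F_kernel: "\<And>i g h t. i < m \<Longrightarrow> g \<in> carrier G \<Longrightarrow> h \<in> kernel G O2 \<rho> \<Longrightarrow> t \<in> {0..1} \<Longrightarrow>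
      F i (g \<otimes> h) t = F i g t * \<sigma> h"
    and cover: "\<And>x. x \<in> sphere 0 1 \<Longrightarrow> \<exists>g\<in>carrier G. \<exists>t\<in>{0..1}. \<rho> g *v y t = x"
    and \<sigma>_carrier: "\<And>h. h \<in> kernel G O2 \<rho> \<Longrightarrow> \<sigma> h \<in> carrier_mat n n"
    and conj: "\<And>g. g \<in> carrier G \<Longrightarrow> \<exists>P\<in>carrier_mat n n. det P \<noteq> 0 \<and>
      (\<forall>h\<in>kernel G O2 \<rho>. inv g \<otimes> h \<otimes> g \<in> kernel G O2 \<rho> \<and> \<sigma> (inv g \<otimes> h \<otimes> g) * P = P * \<sigma> h)"
    and j_inj: "inj j"
begin

lemma \<rho>_mult: "g \<in> carrier G \<Longrightarrow> h \<in> carrier G \<Longrightarrow> \<rho> (g \<otimes> h) = \<rho> g ** \<rho> h"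
  and \<rho>_orth: "g \<in> carrier G \<Longrightarrow> orthogonal_matrix (\<rho> g)"
  and \<rho>_cont: "continuous_map T euclidean \<rho>"
  using rep by (auto simp: orthogonal_rep_def hom_def O2_def)

lemma \<rho>_one: "\<rho> \<one> = Finite_Cartesian_Product.mat 1"
proof -
  have "\<rho> \<one> = \<rho> \<one> ** \<rho> \<one>" using \<rho>_mult[of \<one> \<one>] by simp
  then have "transpose (\<rho> \<one>) ** \<rho> \<one> = (transpose (\<rho> \<one>) ** \<rho> \<one>) ** \<rho> \<one>"
    by (metis matrix_mul_assoc)
  then show ?thesis using \<rho>_orth[of \<one>] by (simp add: orthogonal_matrix)
qed

lemma \<rho>_apply_mult: "g \<in> carrier G \<Longrightarrow> h \<in> carrier G \<Longrightarrow> \<rho> (g \<otimes> h) *v x = \<rho> g *v (\<rho> h *v x)"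
  by (simp add: \<rho>_mult matrix_vector_mul_assoc)

lemma \<rho>_sphere: "g \<in> carrier G \<Longrightarrow> x \<in> sphere 0 1 \<Longrightarrow> \<rho> g *v x \<in> sphere 0 1"
  using \<rho>_orth[of g] by (simp add: orthogonal_transformation_norm[of "\<lambda>x. \<rho> g *v x"] orthogonal_transformation_matrix)

lemma action_cont: "continuous_map (prod_topology T circle) circle (\<lambda>(g, x). \<rho> g *v x)"
proof -
  have "continuous_map (prod_topology T circle) euclidean (\<lambda>p. \<rho> (fst p))"
    using continuous_map_compose[OF continuous_map_fst \<rho>_cont] by (simp add: o_def)
  moreover have "continuous_map (prod_topology T circle) euclidean snd"
    unfolding circle_def by (rule continuous_map_into_fulltopology[OF continuous_map_snd])
  ultimately have "continuous_map (prod_topology T circle) euclidean (\<lambda>p. \<rho> (fst p) *v snd p)"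
    by (rule continuous_map_matrix_vector)
  moreover have "(\<lambda>p. \<rho> (fst p) *v snd p) \<in> topspace (prod_topology T circle) \<rightarrow> sphere 0 1"
    using \<rho>_sphere by (auto simp: topspace_eq topspace_circle simp del: mem_sphere_0)
  ultimately have "continuous_map (prod_topology T circle) (subtopology euclidean (sphere 0 1)) (\<lambda>p. \<rho> (fst p) *v snd p)"
    by (rule continuous_map_into_subtopology)
  then show ?thesis by (simp add: case_prod_unfold circle_def)
qed

abbreviation "I \<equiv> top_of_set {0..1::real}"

text \<open>\<open>rp\<close> chooses parameters of a point. Over \<open>U i\<close> the coordinate \<open>i\<close> is a chart of the bundle, and
  \<open>c i i' k x\<close> is the matrix of the action of \<open>k\<close> from this chart at \<open>x\<close> to the coordinate \<open>i'\<close>.\<close>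

definition "pr g t = \<rho> g *v y t"
definition "pt g t v = (pr g t, \<lambda>i\<in>{..<m}. F i g t *\<^sub>v v)"
definition "S = {pt g t v | g t v. g \<in> carrier G \<and> t \<in> {0..1} \<and> v \<in> carrier_vec n}"
definition "TS = subtopology (prod_topology circle (product_topology (\<lambda>_. cvec_topology n) {..<m})) S"
definition "rp x = (SOME p. fst p \<in> carrier G \<and> snd p \<in> {0..1} \<and> pr (fst p) (snd p) = x)"
definition "c i i' k x = F i' (k \<otimes> fst (rp x)) (snd (rp x)) * minv (F i (fst (rp x)) (snd (rp x)))"
definition "U i = {x \<in> sphere 0 1. det (F i (fst (rp x)) (snd (rp x))) \<noteq> 0}"

section \<open>Independence of the parameters chosen for a point\<close>

lemma y_sphere: "t \<in> {0..1} \<Longrightarrow> y t \<in> sphere 0 1"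
  using y_cont by (auto simp: continuous_map_def topspace_circle simp del: mem_sphere_0)

lemma pr_sphere: "g \<in> carrier G \<Longrightarrow> t \<in> {0..1} \<Longrightarrow> pr g t \<in> sphere 0 1"
  unfolding pr_def by (intro \<rho>_sphere y_sphere)

lemma pr_mult: "g \<in> carrier G \<Longrightarrow> k \<in> carrier G \<Longrightarrow> pr (k \<otimes> g) t = \<rho> k *v pr g t"
  by (simp add: pr_def \<rho>_apply_mult)

lemma F_carrier: "i < m \<Longrightarrow> g \<in> carrier G \<Longrightarrow> t \<in> {0..1} \<Longrightarrow> F i g t \<in> carrier_mat n n"
  using cmat_carrier[OF F_cont, of i "(g, t)"] by (simp add: topspace_eq)

lemma rp:
  assumes "x \<in> sphere 0 1"
  shows "fst (rp x) \<in> carrier G" "snd (rp x) \<in> {0..1}" "pr (fst (rp x)) (snd (rp x)) = x"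
proof -
  have "\<exists>p. fst p \<in> carrier G \<and> snd p \<in> {0..1} \<and> pr (fst p) (snd p) = x"
    using cover[OF assms] unfolding pr_def by (metis fst_conv snd_conv)
  from someI_ex[OF this]
  show "fst (rp x) \<in> carrier G" "snd (rp x) \<in> {0..1}" "pr (fst (rp x)) (snd (rp x)) = x"
    unfolding rp_def by auto
qed

text \<open>The element \<open>inv g \<otimes> g'\<close> moves \<open>y t'\<close> to
  \<open>y t\<close>, so \<open>glue\<close> applies to it. One \<open>C\<close> serves all
  coordinates and all left translates, and therefore cancels in the matrices
  \<open>c\<close>.\<close>

lemma same_point:
  assumes g: "g \<in> carrier G" "g' \<in> carrier G" and t: "t \<in> {0..1}" "t' \<in> {0..1}" and eq: "pr g t = pr g' t'"
  obtains C where "C \<in> carrier_mat n n" "det C \<noteq> 0"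
    "\<And>k i. k \<in> carrier G \<Longrightarrow> i < m \<Longrightarrow> F i (k \<otimes> g') t' = F i (k \<otimes> g) t * C"
    "\<And>i. i < m \<Longrightarrow> F i g' t' = F i g t * C"
proof -
  have "\<rho> (inv g \<otimes> g') *v y t' = \<rho> (inv g) *v pr g t" unfolding eq using g by (simp add: \<rho>_apply_mult pr_def)
  also have "\<dots> = \<rho> (inv g \<otimes> g) *v y t" using g unfolding pr_def by (intro \<rho>_apply_mult[symmetric]) auto
  also have "\<dots> = y t" using g by (simp add: \<rho>_one)
  finally obtain C where C: "C \<in> carrier_mat n n" "det C \<noteq> 0"
    "\<And>i k. i < m \<Longrightarrow> k \<in> carrier G \<Longrightarrow> F i (k \<otimes> (inv g \<otimes> g')) t' = F i k t * C"
    using glue[of "inv g \<otimes> g'" t t'] g t by auto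
  have 1: "F i (k \<otimes> g') t' = F i (k \<otimes> g) t * C" if "k \<in> carrier G" "i < m" for k i
    using C(3)[of i "k \<otimes> g"] that g by (simp add: m_assoc inv_cancel)
  have 2: "F i g' t' = F i g t * C" if "i < m" for i
    using 1[of \<one> i] that g by simp
  show ?thesis using that[OF C(1,2) 1 2] by blast
qed

lemma U_iff:
  assumes "i < m" "g \<in> carrier G" "t \<in> {0..1}"
  shows "pr g t \<in> U i \<longleftrightarrow> det (F i g t) \<noteq> 0"
proof -
  note s = pr_sphere[OF assms(2,3)]
  note r = rp[OF s]
  obtain C where C: "C \<in> carrier_mat n n" "det C \<noteq> 0"
    "\<And>i. i < m \<Longrightarrow> F i g t = F i (fst (rp (pr g t))) (snd (rp (pr g t))) * C"
    using same_point[OF r(1) assms(2) r(2) assms(3) r(3)] by metis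
  have "det (F i g t) = det (F i (fst (rp (pr g t))) (snd (rp (pr g t)))) * det C"
    unfolding C(3)[OF assms(1)] by (rule det_mult[OF F_carrier[OF assms(1) r(1,2)] C(1)])
  then show ?thesis using C(2) s by (simp add: U_def del: mem_sphere_0)
qed

lemma right_factor:
  assumes "X \<in> carrier_mat n n" "A \<in> carrier_mat n n" "det A \<noteq> 0" "B \<in> carrier_mat n n"
  shows "X * A = B \<longleftrightarrow> X = B * minv A"
proof
  note mi = minv[OF assms(2,3)]
  show "X = B * minv A" if "X * A = B"
    using sq_assoc[OF assms(1,2) mi(1)] assms(1) unfolding that mi(2) by (simp add: sq_one)
  show "X * A = B" if "X = B * minv A"
    using sq_assoc[OF assms(4) mi(1) assms(2)] assms(4) unfolding that mi(3) by (simp add: sq_one)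
qed

text \<open>The definition of \<open>c\<close> uses the arbitrary and possibly discontinuous choice
  \<open>rp\<close>. Since the factor \<open>C\<close> cancels, the formula is valid for all
  parameters of the point, and this version is the one whose continuity can be seen.\<close>

lemma c_eq:
  assumes "i < m" "i' < m" "k \<in> carrier G" "g \<in> carrier G" "t \<in> {0..1}" "pr g t \<in> U i"
  shows "c i i' k (pr g t) = F i' (k \<otimes> g) t * minv (F i g t)"
proof -
  note s = pr_sphere[OF assms(4,5)]
  note r = rp[OF s]
  define g0 t0 where "g0 = fst (rp (pr g t))" and "t0 = snd (rp (pr g t))"
  note r = r[folded g0_def t0_def]
  obtain C where C: "C \<in> carrier_mat n n" "det C \<noteq> 0"
    "\<And>k i. k \<in> carrier G \<Longrightarrow> i < m \<Longrightarrow> F i (k \<otimes> g) t = F i (k \<otimes> g0) t0 * C"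
    "\<And>i. i < m \<Longrightarrow> F i g t = F i g0 t0 * C"
    using same_point[OF r(1) assms(4) r(2) assms(5) r(3)] by metis
  have d0: "det (F i g0 t0) \<noteq> 0" using assms(6) by (simp add: U_def g0_def t0_def)
  have d: "det (F i g t) \<noteq> 0" using U_iff[OF assms(1,4,5)] assms(6) by simp
  note f = F_carrier[OF assms(1) r(1,2)] F_carrier[OF assms(2) m_closed[OF assms(3) r(1)] r(2)]
    F_carrier[OF assms(1,4,5)] F_carrier[OF assms(2) m_closed[OF assms(3,4)] assms(5)]
  note mi = minv[OF f(1) d0]
  define X where "X = c i i' k (pr g t)"
  have X: "X = F i' (k \<otimes> g0) t0 * minv (F i g0 t0)" by (simp add: X_def c_def g0_def t0_def)
  have Xc: "X \<in> carrier_mat n n" unfolding X using mi(1) f by simp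
  have "X * F i g0 t0 = F i' (k \<otimes> g0) t0" using right_factor[OF Xc f(1) d0 f(2)] X by simp
  then have "X * F i g0 t0 * C = F i' (k \<otimes> g) t" using C(3)[OF assms(3,2)] by simp
  then have "X * F i g t = F i' (k \<otimes> g) t" unfolding C(4)[OF assms(1)] using sq_assoc[OF Xc f(1) C(1)] by simp
  then show ?thesis using right_factor[OF Xc f(3) d f(4)] by (simp add: X_def)
qed

lemma c_carrier:
  assumes "i < m" "i' < m" "k \<in> carrier G" "x \<in> U i"
  shows "c i i' k x \<in> carrier_mat n n"
proof -
  have s: "x \<in> sphere 0 1" and d: "det (F i (fst (rp x)) (snd (rp x))) \<noteq> 0" using assms(4) by (auto simp: U_def)
  note r = rp[OF s]
  show ?thesis unfolding c_def
    by (rule sq_mult[OF F_carrier[OF assms(2) m_closed[OF assms(3) r(1)] r(2)] minv(1)[OF F_carrier[OF assms(1) r(1,2)] d]])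
qed

lemma c_apply:
  assumes "i < m" "i' < m" "k \<in> carrier G" "g \<in> carrier G" "t \<in> {0..1}" "pr g t \<in> U i" "v \<in> carrier_vec n"
  shows "c i i' k (pr g t) *\<^sub>v (F i g t *\<^sub>v v) = F i' (k \<otimes> g) t *\<^sub>v v"
proof -
  have d: "det (F i g t) \<noteq> 0" using U_iff[OF assms(1,4,5)] assms(6) by simp
  note f = F_carrier[OF assms(1,4,5)] F_carrier[OF assms(2) m_closed[OF assms(3,4)] assms(5)]
  have Xc: "c i i' k (pr g t) \<in> carrier_mat n n" by (rule c_carrier[OF assms(1-3,6)])
  have "c i i' k (pr g t) * F i g t = F i' (k \<otimes> g) t"
    using right_factor[OF Xc f(1) d f(2)] c_eq[OF assms(1-6)] by simp
  then show ?thesis using assoc_mult_mat_vec[OF Xc f(1) assms(7)] by simp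
qed

lemma U_exists:
  assumes "x \<in> sphere 0 1" obtains i where "i < m" "x \<in> U i"
  using F_nz[OF rp(1,2)[OF assms]] assms by (auto simp: U_def simp del: mem_sphere_0)

lemma pr_cont: "continuous_map (prod_topology T I) circle (\<lambda>p. pr (fst p) (snd p))"
proof -
  have "continuous_map (prod_topology T I) (prod_topology T circle) (\<lambda>p. (fst p, y (snd p)))"
    using continuous_map_compose[OF continuous_map_snd y_cont, of T]
    by (intro continuous_map_pairedI continuous_map_fst) (simp add: o_def)
  from continuous_map_compose[OF this action_cont] show ?thesis by (simp add: o_def pr_def)
qed

lemma compact_PI: "compact_space (prod_topology T I)"
  using compact by (simp add: compact_space_prod_topology compact_space_subtopology)

text \<open>The complement is the image of the closed set of parameters with vanishing determinant,
  under a map from a compact space to a Hausdorff space.\<close>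

lemma U_open: assumes i: "i < m" shows "openin circle (U i)"
proof -
  let ?P = "prod_topology T I"
  have cl: "closed_map ?P circle (\<lambda>p. pr (fst p) (snd p))"
    by (rule continuous_imp_closed_map[OF pr_cont compact_PI Hausdorff_circle])
  have "continuous_map ?P euclidean (\<lambda>p. det (F i (fst p) (snd p)))"
    using continuous_map_det[OF F_cont[OF i]] by (simp add: case_prod_unfold)
  from closedin_continuous_map_preimage[OF this, of "{0}"]
  have "closedin ?P {p \<in> topspace ?P. det (F i (fst p) (snd p)) \<in> {0}}" by simp
  then have "closedin circle ((\<lambda>p. pr (fst p) (snd p)) ` {p \<in> topspace ?P. det (F i (fst p) (snd p)) \<in> {0}})"
    using cl unfolding closed_map_def by blast
  moreover have "(\<lambda>p. pr (fst p) (snd p)) ` {p \<in> topspace ?P. det (F i (fst p) (snd p)) \<in> {0}} = topspace circle - U i"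
  proof (intro equalityI subsetI)
    fix x assume "x \<in> (\<lambda>p. pr (fst p) (snd p)) ` {p \<in> topspace ?P. det (F i (fst p) (snd p)) \<in> {0}}"
    then obtain g t where "g \<in> carrier G" "t \<in> {0..1}" "det (F i g t) = 0" "x = pr g t"
      by (auto simp: topspace_eq)
    then show "x \<in> topspace circle - U i" using U_iff[OF i] pr_sphere by (simp add: topspace_circle del: mem_sphere_0)
  next
    fix x assume "x \<in> topspace circle - U i"
    then have x: "x \<in> sphere 0 1" "x \<notin> U i" by (auto simp: topspace_circle)
    then have "det (F i (fst (rp x)) (snd (rp x))) = 0" unfolding U_def by blast
    then show "x \<in> (\<lambda>p. pr (fst p) (snd p)) ` {p \<in> topspace ?P. det (F i (fst p) (snd p)) \<in> {0}}"
      using rp[OF x(1)] by (intro image_eqI[of _ _ "rp x"]) (auto simp: topspace_eq mem_Times_iff)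
  qed
  ultimately show ?thesis unfolding openin_closedin_eq using U_def by (auto simp: topspace_circle)
qed

text \<open>No continuous choice of parameters is at hand. Instead
  \<open>(k, g, t) \<mapsto> (k, pr g t)\<close> is a quotient map, being a closed continuous
  surjection, and along it \<open>c\<close> pulls back to an explicitly continuous expression.
  Restriction to the open set over \<open>U i\<close> is again a quotient map.\<close>

lemma c_cont:
  assumes i: "i < m" and i': "i' < m"
  shows "cmat (prod_topology T (subtopology circle (U i))) n (\<lambda>(k, x). c i i' k x)"
proof -
  let ?P = "prod_topology T I"
  let ?f = "\<lambda>q. (fst q, pr (fst (snd q)) (snd (snd q)))"
  let ?X = "prod_topology T ?P" and ?Y = "prod_topology T circle"
  let ?V = "topspace T \<times> U i"
  let ?W = "{q \<in> topspace ?X. ?f q \<in> ?V}"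
  have "continuous_map ?X circle (\<lambda>q. pr (fst (snd q)) (snd (snd q)))"
    using continuous_map_compose[OF continuous_map_snd pr_cont, of T] by (simp add: o_def)
  then have fc: "continuous_map ?X ?Y ?f" by (intro continuous_map_pairedI continuous_map_fst)
  have "closed_map ?X ?Y ?f"
    by (rule continuous_imp_closed_map[OF fc])
      (use compact compact_PI Hausdorff Hausdorff_circle in \<open>simp_all add: compact_space_prod_topology Hausdorff_space_prod_topology\<close>)
  moreover have "?f ` topspace ?X = topspace ?Y"
  proof (intro equalityI subsetI)
    fix q assume "q \<in> topspace ?Y"
    then have "fst q \<in> carrier G" "snd q \<in> sphere 0 1" by (auto simp: topspace_eq topspace_circle)
    then show "q \<in> ?f ` topspace ?X" using rp[of "snd q"]
      by (intro image_eqI[of _ _ "(fst q, rp (snd q))"]) (auto simp: topspace_eq mem_Times_iff)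
  qed (use fc in \<open>auto simp: continuous_map_def\<close>)
  ultimately have q: "quotient_map ?X ?Y ?f"
    using continuous_closed_imp_quotient_map[OF fc] by blast
  have V: "openin ?Y ?V" using U_open[OF i] by (simp add: openin_prod_Times_iff)
  have qr: "quotient_map (subtopology ?X ?W) (subtopology ?Y ?V) ?f"
    by (rule quotient_map_restriction[OF q]) (use V in auto)
  have eY: "subtopology ?Y ?V = prod_topology T (subtopology circle (U i))"
    by (simp add: prod_topology_subtopology(2) )
  have Fk: "cmat ?X n (\<lambda>q. F i' (fst q \<otimes> fst (snd q)) (snd (snd q)))"
  proof -
    have "continuous_map ?X ?P (\<lambda>q. (fst q \<otimes> fst (snd q), snd (snd q)))"
      by (intro continuous_map_pairedI continuous_map_mult continuous_map_fst
          continuous_map_compose[OF continuous_map_snd continuous_map_fst, unfolded o_def]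
          continuous_map_compose[OF continuous_map_snd continuous_map_snd, unfolded o_def])
    from cmat_compose[OF this F_cont[OF i']] show ?thesis by simp
  qed
  have Fi: "cmat ?X n (\<lambda>q. F i (fst (snd q)) (snd (snd q)))"
    using cmat_compose[OF continuous_map_snd F_cont[OF i], of T] by (simp add: case_prod_unfold)
  have "cmat (subtopology ?X ?W) n (\<lambda>q. F i' (fst q \<otimes> fst (snd q)) (snd (snd q)) * minv (F i (fst (snd q)) (snd (snd q))))"
  proof (intro cmat_mult cmat_minv cmat_subtopology Fk Fi)
    fix q assume "q \<in> topspace (subtopology ?X ?W)"
    then show "det (F i (fst (snd q)) (snd (snd q))) \<noteq> 0"
      using U_iff[OF i, of "fst (snd q)" "snd (snd q)"] by (auto simp: topspace_eq)
  qed
  then have cf: "cmat (subtopology ?X ?W) n (\<lambda>q. c i i' (fst q) (pr (fst (snd q)) (snd (snd q))))"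
    by (rule cmat_cong) (use i i' in \<open>auto simp: topspace_eq c_eq\<close>)
  show ?thesis
  proof (rule cmatI)
    show "(case p of (k, x) \<Rightarrow> c i i' k x) \<in> carrier_mat n n"
      if "p \<in> topspace (prod_topology T (subtopology circle (U i)))" for p
      using that c_carrier[OF i i'] by (auto simp: topspace_eq)
    fix a b assume ab: "a < n" "b < n"
    have "continuous_map (subtopology ?Y ?V) euclidean (\<lambda>p. c i i' (fst p) (snd p) $$ (a, b))"
      by (rule continuous_compose_quotient_map[OF qr]) (use cmat_entry[OF cf ab] in \<open>simp add: o_def\<close>)
    then show "continuous_map (prod_topology T (subtopology circle (U i))) euclidean (\<lambda>p. (case p of (k, x) \<Rightarrow> c i i' k x) $$ (a, b))"
      by (simp add: eY case_prod_unfold)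
  qed
qed

section \<open>The total space and the action of the group\<close>

lemma pt_S: "g \<in> carrier G \<Longrightarrow> t \<in> {0..1} \<Longrightarrow> v \<in> carrier_vec n \<Longrightarrow> pt g t v \<in> S"
  unfolding S_def by blast

lemma S_E:
  assumes "s \<in> S"
  obtains g t v where "g \<in> carrier G" "t \<in> {0..1}" "v \<in> carrier_vec n" "s = pt g t v"
  using assms unfolding S_def by blast

lemma fst_pt [simp]: "fst (pt g t v) = pr g t"
  by (simp add: pt_def)

lemma snd_pt: "i < m \<Longrightarrow> snd (pt g t v) i = F i g t *\<^sub>v v"
  by (simp add: pt_def)

lemma topspace_TS: "topspace TS = S"
proof -
  have "S \<subseteq> topspace (prod_topology circle (product_topology (\<lambda>_. cvec_topology n) {..<m}))"
  proof
    fix s assume "s \<in> S"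
    then obtain g t v where "g \<in> carrier G" "t \<in> {0..1}" "v \<in> carrier_vec n" "s = pt g t v" by (rule S_E)
    then show "s \<in> topspace (prod_topology circle (product_topology (\<lambda>_. cvec_topology n) {..<m}))"
      using pr_sphere by (auto simp: pt_def topspace_circle topspace_cvec simp del: mem_sphere_0 atLeastAtMost_iff
          intro!: mult_mat_vec_carrier[OF F_carrier])
  qed
  then show ?thesis by (auto simp: TS_def)
qed

lemma pt_change:
  assumes g: "g \<in> carrier G" "g' \<in> carrier G" and t: "t \<in> {0..1}" "t' \<in> {0..1}" and eq: "pr g t = pr g' t'"
    and v: "v \<in> carrier_vec n"
  obtains w where "w \<in> carrier_vec n" "pt g' t' v = pt g t w"
proof -
  obtain C where C: "C \<in> carrier_mat n n" "\<And>i. i < m \<Longrightarrow> F i g' t' = F i g t * C"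
    using same_point[OF g t eq] by metis
  have "F i g' t' *\<^sub>v v = F i g t *\<^sub>v (C *\<^sub>v v)" if "i < m" for i
    unfolding C(2)[OF that] by (rule assoc_mult_mat_vec[OF F_carrier[OF that g(1) t(1)] C(1) v])
  then have "pt g' t' v = pt g t (C *\<^sub>v v)" by (auto simp: pt_def eq intro!: restrict_ext)
  then show ?thesis using that C(1) v by (metis mult_mat_vec_carrier)
qed

text \<open>Over \<open>U i\<close> the coordinate \<open>i\<close> determines a point of the fiber.
  Expressing all coordinates of the translate through it makes the action continuous there.\<close>

definition "local_act i k s = (\<rho> k *v fst s, \<lambda>i'\<in>{..<m}. c i i' k (fst s) *\<^sub>v snd s i)"
definition "bact k s = local_act (SOME i. i < m \<and> fst s \<in> U i) k s"

lemma local_act_pt: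
  assumes "i < m" "k \<in> carrier G" "g \<in> carrier G" "t \<in> {0..1}" "v \<in> carrier_vec n" "pr g t \<in> U i"
  shows "local_act i k (pt g t v) = pt (k \<otimes> g) t v"
  unfolding local_act_def fst_pt snd_pt[OF assms(1)]
  using c_apply[OF assms(1) _ assms(2-4,6,5)] pr_mult[OF assms(3,2)]
  by (auto simp: pt_def intro!: restrict_ext)

lemma bact_pt:
  assumes "k \<in> carrier G" "g \<in> carrier G" "t \<in> {0..1}" "v \<in> carrier_vec n"
  shows "bact k (pt g t v) = pt (k \<otimes> g) t v"
proof -
  have "\<exists>i. i < m \<and> fst (pt g t v) \<in> U i" using U_exists[OF pr_sphere[OF assms(2,3)]] by (metis fst_pt)
  from someI_ex[OF this] show ?thesis
    unfolding bact_def by (intro local_act_pt assms) auto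
qed

lemma fst_TS_cont: "continuous_map TS circle fst"
  unfolding TS_def by (intro continuous_map_from_subtopology continuous_map_fst)

lemma snd_TS_cont: "i < m \<Longrightarrow> continuous_map TS (cvec_topology n) (\<lambda>s. snd s i)"
  using continuous_map_compose[OF continuous_map_snd continuous_map_product_projection, of i "{..<m}" circle "\<lambda>_. cvec_topology n"]
  unfolding TS_def by (intro continuous_map_from_subtopology) (simp add: o_def)

lemma local_act_cont:
  assumes i: "i < m"
  shows "continuous_map (subtopology (prod_topology T TS) {p. fst (snd p) \<in> U i}) TS (\<lambda>p. local_act i (fst p) (snd p))"
proof -
  let ?X = "subtopology (prod_topology T TS) {p. fst (snd p) \<in> U i}"
  have 1: "continuous_map ?X T fst" by (intro continuous_map_from_subtopology continuous_map_fst)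
  have 2: "continuous_map ?X circle (\<lambda>p. fst (snd p))"
    using continuous_map_compose[OF continuous_map_snd fst_TS_cont, of T]
    by (intro continuous_map_from_subtopology) (simp add: o_def)
  have 3: "continuous_map ?X (cvec_topology n) (\<lambda>p. snd (snd p) i)"
    using continuous_map_compose[OF continuous_map_snd snd_TS_cont[OF i], of T]
    by (intro continuous_map_from_subtopology) (simp add: o_def)
  have "continuous_map ?X circle (\<lambda>p. \<rho> (fst p) *v fst (snd p))"
    using continuous_map_compose[OF continuous_map_pairedI[OF 1 2] action_cont] by (simp add: o_def)
  moreover have "continuous_map ?X (product_topology (\<lambda>_. cvec_topology n) {..<m})
      (\<lambda>p. \<lambda>i'\<in>{..<m}. c i i' (fst p) (fst (snd p)) *\<^sub>v snd (snd p) i)"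
  proof (subst continuous_map_componentwise, intro conjI ballI)
    show "(\<lambda>p. \<lambda>i'\<in>{..<m}. c i i' (fst p) (fst (snd p)) *\<^sub>v snd (snd p) i) ` topspace ?X \<subseteq> extensional {..<m}" by auto
    fix i' assume "i' \<in> {..<m}"
    then have i': "i' < m" by simp
    have "continuous_map ?X (prod_topology T (subtopology circle (U i))) (\<lambda>p. (fst p, fst (snd p)))"
      by (intro continuous_map_pairedI 1 continuous_map_into_subtopology 2) auto
    from cmat_compose[OF this c_cont[OF i i']]
    have "cmat ?X n (\<lambda>p. c i i' (fst p) (fst (snd p)))" by simp
    from continuous_map_mult_vec[OF this 3]
    show "continuous_map ?X (cvec_topology n) (\<lambda>p. (\<lambda>i'\<in>{..<m}. c i i' (fst p) (fst (snd p)) *\<^sub>v snd (snd p) i) i')"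
      using i' by simp
  qed
  ultimately have "continuous_map ?X (prod_topology circle (product_topology (\<lambda>_. cvec_topology n) {..<m}))
      (\<lambda>p. local_act i (fst p) (snd p))"
    unfolding local_act_def by (rule continuous_map_pairedI)
  moreover have "(\<lambda>p. local_act i (fst p) (snd p)) \<in> topspace ?X \<rightarrow> S"
  proof
    fix p assume "p \<in> topspace ?X"
    then have p: "fst p \<in> carrier G" "snd p \<in> S" "fst (snd p) \<in> U i" by (auto simp: topspace_TS topspace_eq)
    from p(2) obtain g t v where "g \<in> carrier G" "t \<in> {0..1}" "v \<in> carrier_vec n" "snd p = pt g t v" by (rule S_E)
    then show "local_act i (fst p) (snd p) \<in> S" using p local_act_pt[OF i p(1)] pt_S by simp
  qed
  ultimately show ?thesis unfolding TS_def by (rule continuous_map_into_subtopology)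
qed

lemma bact_cont: "continuous_map (prod_topology T TS) TS (\<lambda>p. bact (fst p) (snd p))"
proof (rule continuous_map_locally)
  fix p assume p: "p \<in> topspace (prod_topology T TS)"
  let ?X = "prod_topology T TS"
  have s: "snd p \<in> S" using p by (auto simp: topspace_TS)
  then have "fst (snd p) \<in> sphere 0 1" using pr_sphere by (auto elim!: S_E simp del: mem_sphere_0 atLeastAtMost_iff)
  then obtain i where i: "i < m" "fst (snd p) \<in> U i" by (rule U_exists)
  let ?W = "{q \<in> topspace ?X. fst (snd q) \<in> U i}"
  have "continuous_map ?X circle (\<lambda>p. fst (snd p))"
    using continuous_map_compose[OF continuous_map_snd fst_TS_cont, of T] by (simp add: o_def)
  then have W: "openin ?X ?W" by (rule openin_continuous_map_preimage[OF _ U_open[OF i(1)]])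
  have e: "subtopology ?X ?W = subtopology ?X {p. fst (snd p) \<in> U i}"
    unfolding subtopology_restrict[symmetric, of _ "{p. fst (snd p) \<in> U i}"]
    by (rule arg_cong[where f = "subtopology ?X"]) auto
  have "continuous_map (subtopology ?X ?W) TS (\<lambda>p. bact (fst p) (snd p))"
    unfolding e
  proof (rule continuous_map_eq[OF local_act_cont[OF i(1)]])
    fix q assume "q \<in> topspace (subtopology ?X {p. fst (snd p) \<in> U i})"
    then have q: "fst q \<in> carrier G" "snd q \<in> S" "fst (snd q) \<in> U i" by (auto simp: topspace_TS topspace_eq)
    from q(2) obtain g t v where gtv: "g \<in> carrier G" "t \<in> {0..1}" "v \<in> carrier_vec n" "snd q = pt g t v" by (rule S_E)
    then show "local_act i (fst q) (snd q) = bact (fst q) (snd q)"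
      using q local_act_pt[OF i(1) q(1) gtv(1-3)] bact_pt[OF q(1) gtv(1-3)] by simp
  qed
  then show "\<exists>W. openin ?X W \<and> p \<in> W \<and> continuous_map (subtopology ?X W) TS (\<lambda>p. bact (fst p) (snd p))"
    using W p i(2) by (intro exI[of _ ?W]) auto
qed

text \<open>The bundle is built as the set \<open>S\<close> of pairs of a base point and a tuple of
  vectors, and only then transported along \<open>j\<close> to the type of points prescribed from
  outside; \<open>d\<close> decodes a point.\<close>

definition "d = inv_into UNIV j"
definition "TE = pullback_topology (j ` S) d TS"
definition "fib x = \<lparr>carrier = {e \<in> j ` S. fst (d e) = x}, mult = undefined, one = undefined,
  zero = j (x, \<lambda>i\<in>{..<m}. 0\<^sub>v n),
  add = \<lambda>e e'. j (x, \<lambda>i\<in>{..<m}. snd (d e) i + snd (d e') i),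
  smult = \<lambda>a e. j (x, \<lambda>i\<in>{..<m}. a \<cdot>\<^sub>v snd (d e) i)\<rparr>"
definition E :: "('g, 'e) equivariant_bundle" where
  "E = \<lparr>total_space = TE, proj = \<lambda>e. fst (d e), fiber = fib, act = \<lambda>k e. j (bact k (d e))\<rparr>"

lemma E_simps [simp]: "total_space E = TE" "proj E e = fst (d e)" "fiber E = fib" "act E k e = j (bact k (d e))"
  by (simp_all add: E_def)

lemma d_j [simp]: "d (j s) = s"
  using j_inj by (simp add: d_def)

lemma topspace_TE: "topspace TE = j ` S"
  by (auto simp: TE_def topspace_pullback_topology topspace_TS)

lemma j_cont: "continuous_map TS TE j"
  unfolding TE_def by (rule continuous_map_pullback') (auto simp: o_def topspace_TS)

lemma d_cont: "continuous_map TE TS d"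
  unfolding TE_def using continuous_map_pullback[of TS TS id "j ` S" d] by (simp add: id_def o_def)

section \<open>The fibers as vector spaces\<close>

lemma pt_add:
  assumes "g \<in> carrier G" "t \<in> {0..1}" "v \<in> carrier_vec n" "w \<in> carrier_vec n"
  shows "j (pt g t v) \<oplus>\<^bsub>fib (pr g t)\<^esub> j (pt g t w) = j (pt g t (v + w))"
proof -
  have "F i g t *\<^sub>v v + F i g t *\<^sub>v w = F i g t *\<^sub>v (v + w)" if "i < m" for i
    by (rule mult_add_distrib_mat_vec[OF F_carrier[OF that assms(1,2)] assms(3,4), symmetric])
  then show ?thesis by (auto simp: fib_def pt_def intro!: arg_cong[where f = j] restrict_ext)
qed

lemma pt_smult:
  assumes "g \<in> carrier G" "t \<in> {0..1}" "v \<in> carrier_vec n"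
  shows "a \<odot>\<^bsub>fib (pr g t)\<^esub> j (pt g t v) = j (pt g t (a \<cdot>\<^sub>v v))"
proof -
  have "a \<cdot>\<^sub>v (F i g t *\<^sub>v v) = F i g t *\<^sub>v (a \<cdot>\<^sub>v v)" if "i < m" for i
    by (rule mult_mat_vec[OF F_carrier[OF that assms(1,2)] assms(3), symmetric])
  then show ?thesis by (auto simp: fib_def pt_def intro!: arg_cong[where f = j] restrict_ext)
qed

lemma pt_zero:
  assumes "g \<in> carrier G" "t \<in> {0..1}"
  shows "\<zero>\<^bsub>fib (pr g t)\<^esub> = j (pt g t (0\<^sub>v n))"
proof -
  have "F i g t *\<^sub>v 0\<^sub>v n = 0\<^sub>v n" if "i < m" for i
    using F_carrier[OF that assms] by (intro eq_vecI) (auto simp: scalar_prod_def)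
  then show ?thesis by (auto simp: fib_def pt_def intro!: arg_cong[where f = j] restrict_ext)
qed

text \<open>One parameter pair describes the whole fiber: a point given by other parameters is
  rewritten by an invertible change of the vector.\<close>

lemma fib_carrier:
  assumes g: "g \<in> carrier G" "t \<in> {0..1}"
  shows "carrier (fib (pr g t)) = (\<lambda>v. j (pt g t v)) ` carrier_vec n"
proof (intro equalityI subsetI)
  fix e assume "e \<in> carrier (fib (pr g t))"
  then obtain s where s: "s \<in> S" "e = j s" "fst s = pr g t" by (auto simp: fib_def)
  then obtain g' t' v where p: "g' \<in> carrier G" "t' \<in> {0..1}" "v \<in> carrier_vec n" "s = pt g' t' v" by (elim S_E)
  then have "pr g t = pr g' t'" using s(3) by simp
  from pt_change[OF g(1) p(1) g(2) p(2) this p(3)]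
  obtain w where "w \<in> carrier_vec n" "pt g' t' v = pt g t w" by blast
  then show "e \<in> (\<lambda>v. j (pt g t v)) ` carrier_vec n" using s(2) p(4) by simp
next
  fix e assume "e \<in> (\<lambda>v. j (pt g t v)) ` carrier_vec n"
  then show "e \<in> carrier (fib (pr g t))" using pt_S[OF g] by (auto simp: fib_def)
qed

lemma pt_inj:
  assumes "g \<in> carrier G" "t \<in> {0..1}" "v \<in> carrier_vec n" "w \<in> carrier_vec n" "pt g t v = pt g t w"
  shows "v = w"
proof -
  obtain i where i: "i < m" "det (F i g t) \<noteq> 0" using F_nz[OF assms(1,2)] by blast
  note f = F_carrier[OF i(1) assms(1,2)]
  note mi = minv[OF f i(2)]
  have "F i g t *\<^sub>v v = F i g t *\<^sub>v w" using snd_pt[OF i(1)] assms(5) by metis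
  then have "minv (F i g t) *\<^sub>v (F i g t *\<^sub>v v) = minv (F i g t) *\<^sub>v (F i g t *\<^sub>v w)" by simp
  then have "(minv (F i g t) * F i g t) *\<^sub>v v = (minv (F i g t) * F i g t) *\<^sub>v w"
    using assoc_mult_mat_vec[OF mi(1) f] assms(3,4) by simp
  then show ?thesis using mi(3) assms(3,4) by simp
qed

lemma fib_vectorspace: assumes "x \<in> sphere 0 1" shows "vectorspace class_ring (fib x)"
proof -
  obtain g t where g: "g \<in> carrier G" "t \<in> {0..1}" and x: "x = pr g t" using rp[OF assms] by metis
  let ?L = "\<lambda>v. j (pt g t v)"
  let ?M = "fib (pr g t)"
  note cm = fib_carrier[OF g]
  note [simp] = pt_add[OF g] pt_smult[OF g] pt_zero[OF g]
  have "module class_ring ?M"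
  proof (rule module_criteria)
    show "cring (class_ring :: complex ring)" by (rule class_cring.is_cring)
    show "\<zero>\<^bsub>?M\<^esub> \<in> carrier ?M" unfolding cm by simp
    show "\<forall>v w. v \<in> carrier ?M \<and> w \<in> carrier ?M \<longrightarrow> v \<oplus>\<^bsub>?M\<^esub> w \<in> carrier ?M" unfolding cm by auto
    show "\<forall>v\<in>carrier ?M. \<exists>neg_v\<in>carrier ?M. v \<oplus>\<^bsub>?M\<^esub> neg_v = \<zero>\<^bsub>?M\<^esub>"
    proof
      fix e assume "e \<in> carrier ?M"
      then obtain v where v: "v \<in> carrier_vec n" "e = ?L v" unfolding cm by blast
      have "v + - v = 0\<^sub>v n" using v(1) by (intro eq_vecI) auto
      then have "e \<oplus>\<^bsub>?M\<^esub> ?L (- v) = \<zero>\<^bsub>?M\<^esub>" using v by simp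
      moreover have "?L (- v) \<in> carrier ?M" unfolding cm using v(1) by simp
      ultimately show "\<exists>neg_v\<in>carrier ?M. e \<oplus>\<^bsub>?M\<^esub> neg_v = \<zero>\<^bsub>?M\<^esub>" by blast
    qed
    show "\<forall>a v. a \<in> carrier class_ring \<and> v \<in> carrier ?M \<longrightarrow> a \<odot>\<^bsub>?M\<^esub> v \<in> carrier ?M" unfolding cm by auto
    show "\<forall>v w. v \<in> carrier ?M \<and> w \<in> carrier ?M \<longrightarrow> v \<oplus>\<^bsub>?M\<^esub> w = w \<oplus>\<^bsub>?M\<^esub> v"
      unfolding cm by (auto simp: comm_add_vec[of _ n])
    show "\<forall>v w x. v \<in> carrier ?M \<and> w \<in> carrier ?M \<and> x \<in> carrier ?M \<longrightarrow>
        v \<oplus>\<^bsub>?M\<^esub> w \<oplus>\<^bsub>?M\<^esub> x = v \<oplus>\<^bsub>?M\<^esub> (w \<oplus>\<^bsub>?M\<^esub> x)"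
      unfolding cm by (auto simp: assoc_add_vec[of _ n])
    show "\<forall>v\<in>carrier ?M. v \<oplus>\<^bsub>?M\<^esub> \<zero>\<^bsub>?M\<^esub> = v" unfolding cm by auto
    show "\<forall>a b v. a \<in> carrier class_ring \<and> b \<in> carrier class_ring \<and> v \<in> carrier ?M \<longrightarrow>
        (a \<otimes>\<^bsub>class_ring\<^esub> b) \<odot>\<^bsub>?M\<^esub> v = a \<odot>\<^bsub>?M\<^esub> (b \<odot>\<^bsub>?M\<^esub> v)"
      unfolding cm by (auto simp: smult_smult_assoc)
    show "\<forall>v\<in>carrier ?M. \<one>\<^bsub>class_ring\<^esub> \<odot>\<^bsub>?M\<^esub> v = v" unfolding cm by auto
    show "\<forall>a b v. a \<in> carrier class_ring \<and> b \<in> carrier class_ring \<and> v \<in> carrier ?M \<longrightarrow>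
        (a \<oplus>\<^bsub>class_ring\<^esub> b) \<odot>\<^bsub>?M\<^esub> v = a \<odot>\<^bsub>?M\<^esub> v \<oplus>\<^bsub>?M\<^esub> b \<odot>\<^bsub>?M\<^esub> v"
      unfolding cm by (auto simp: add_smult_distrib_vec)
    show "\<forall>a v w. a \<in> carrier class_ring \<and> v \<in> carrier ?M \<and> w \<in> carrier ?M \<longrightarrow>
        a \<odot>\<^bsub>?M\<^esub> (v \<oplus>\<^bsub>?M\<^esub> w) = a \<odot>\<^bsub>?M\<^esub> v \<oplus>\<^bsub>?M\<^esub> a \<odot>\<^bsub>?M\<^esub> w"
      unfolding cm by (auto simp: smult_add_distrib_vec[of _ n])
  qed
  then show ?thesis unfolding vectorspace_def x using class_field by auto
qed

lemma pt_linear: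
  assumes g: "g \<in> carrier G" "t \<in> {0..1}" and A: "A \<in> carrier_mat n n"
  shows "linear_map class_ring (module_vec TYPE(complex) n) (fib (pr g t)) (\<lambda>v. j (pt g t (A *\<^sub>v v)))"
proof (rule linear_mapI[OF vec_vs fib_vectorspace[OF pr_sphere[OF g]]])
  fix v :: "complex vec" assume "v \<in> carrier (module_vec TYPE(complex) n)"
  then have v: "v \<in> carrier_vec n" by (simp add: module_vec_def)
  show "j (pt g t (A *\<^sub>v v)) \<in> carrier (fib (pr g t))" unfolding fib_carrier[OF g] by (rule imageI[OF mult_mat_vec_carrier[OF A v]])
  show "j (pt g t (A *\<^sub>v (a \<odot>\<^bsub>module_vec TYPE(complex) n\<^esub> v))) = a \<odot>\<^bsub>fib (pr g t)\<^esub> j (pt g t (A *\<^sub>v v))" for a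
    using pt_smult[OF g mult_mat_vec_carrier[OF A v], of a] mult_mat_vec[OF A v, of a]
    by (simp only: module_vec_def module.simps)
  fix w :: "complex vec" assume "w \<in> carrier (module_vec TYPE(complex) n)"
  then have w: "w \<in> carrier_vec n" by (simp add: module_vec_def)
  show "j (pt g t (A *\<^sub>v (v \<oplus>\<^bsub>module_vec TYPE(complex) n\<^esub> w))) =
      j (pt g t (A *\<^sub>v v)) \<oplus>\<^bsub>fib (pr g t)\<^esub> j (pt g t (A *\<^sub>v w))"
    using pt_add[OF g mult_mat_vec_carrier[OF A v] mult_mat_vec_carrier[OF A w]] mult_add_distrib_mat_vec[OF A v w]
    by (simp only: module_vec_def ring.simps)
qed

text \<open>The inverse of the chart that reads off coordinate \<open>i\<close>: all other
  coordinates are recovered by the transition matrices for the action of \<one>.\<close>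

definition "triv i = (\<lambda>p. j (fst p, \<lambda>i'\<in>{..<m}. c i i' \<one> (fst p) *\<^sub>v snd p))"

lemma triv_pt:
  assumes "i < m" "g \<in> carrier G" "t \<in> {0..1}" "v \<in> carrier_vec n" "pr g t \<in> U i"
  shows "triv i (pr g t, F i g t *\<^sub>v v) = j (pt g t v)"
  using c_apply[OF assms(1) _ one_closed assms(2,3,5,4)] assms(2)
  by (auto simp: triv_def pt_def intro!: arg_cong[where f = j] restrict_ext)

lemma triv_eq:
  assumes "i < m" "g \<in> carrier G" "t \<in> {0..1}" "v \<in> carrier_vec n" "pr g t \<in> U i"
  shows "triv i (pr g t, v) = j (pt g t (minv (F i g t) *\<^sub>v v))"
proof -
  note f = F_carrier[OF assms(1-3)]
  have "det (F i g t) \<noteq> 0" using U_iff[OF assms(1-3)] assms(5) by simp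
  note mi = minv[OF f this]
  have "F i g t *\<^sub>v (minv (F i g t) *\<^sub>v v) = v"
    using assoc_mult_mat_vec[OF f mi(1) assms(4)] mi(2) assms(4) by simp
  then show ?thesis using triv_pt[OF assms(1-3) mult_mat_vec_carrier[OF mi(1) assms(4)] assms(5)] by simp
qed

lemma triv_homeomorphic:
  assumes i: "i < m"
  shows "homeomorphic_map (prod_topology (subtopology circle (U i)) (cvec_topology n))
    (subtopology TE {e. fst (d e) \<in> U i}) (triv i)"
proof -
  let ?X = "prod_topology (subtopology circle (U i)) (cvec_topology n)"
  let ?Y = "subtopology TE {e. fst (d e) \<in> U i}"
  have xU: "x \<in> sphere 0 1" if "x \<in> U i" for x using that by (simp add: U_def)
  have img: "triv i p \<in> j ` S" "fst (d (triv i p)) = fst p" "snd (d (triv i p)) i = snd p"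
    if "p \<in> topspace ?X" for p
  proof -
    have p: "fst p \<in> U i" "snd p \<in> carrier_vec n" using that by (auto simp: topspace_cvec)
    note r = rp[OF xU[OF p(1)]]
    define g t where "g = fst (rp (fst p))" and "t = snd (rp (fst p))"
    note r = r[folded g_def t_def]
    note f = F_carrier[OF i r(1,2)]
    have "det (F i g t) \<noteq> 0" using U_iff[OF i r(1,2)] r(3) p(1) by simp
    note mi = minv[OF f this]
    have e: "triv i p = j (pt g t (minv (F i g t) *\<^sub>v snd p))"
      using triv_eq[OF i r(1,2) p(2)] p(1) r(3) by simp
    have w: "minv (F i g t) *\<^sub>v snd p \<in> carrier_vec n" using mi(1) p(2) by simp
    show "triv i p \<in> j ` S" unfolding e using pt_S[OF r(1,2) w] by simp
    show "fst (d (triv i p)) = fst p" unfolding e by (simp add: r(3))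
    have "F i g t *\<^sub>v (minv (F i g t) *\<^sub>v snd p) = snd p"
      using assoc_mult_mat_vec[OF f mi(1) p(2)] mi(2) p(2) by simp
    then show "snd (d (triv i p)) i = snd p" unfolding e using i by (simp add: snd_pt)
  qed
  have "homeomorphic_maps ?X ?Y (triv i) (\<lambda>e. (fst (d e), snd (d e) i))"
    unfolding homeomorphic_maps_def
  proof (intro conjI ballI)
    have c1: "continuous_map ?X (subtopology circle (U i)) fst" and c2: "continuous_map ?X (cvec_topology n) snd"
      by (rule continuous_map_fst continuous_map_snd)+
    have c3: "continuous_map ?X circle fst" using continuous_map_into_fulltopology[OF c1] .
    have "continuous_map ?X (prod_topology circle (product_topology (\<lambda>_. cvec_topology n) {..<m}))
      (\<lambda>p. (fst p, \<lambda>i'\<in>{..<m}. c i i' \<one> (fst p) *\<^sub>v snd p))"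
    proof (intro continuous_map_pairedI c3, subst continuous_map_componentwise, intro conjI ballI)
      show "(\<lambda>p. \<lambda>i'\<in>{..<m}. c i i' \<one> (fst p) *\<^sub>v snd p) ` topspace ?X \<subseteq> extensional {..<m}" by auto
      fix i' assume "i' \<in> {..<m}"
      then have i': "i' < m" by simp
      have "continuous_map ?X (prod_topology T (subtopology circle (U i))) (\<lambda>p. (\<one>, fst p))"
        by (intro continuous_map_pairedI c1 continuous_map_const_carrier one_closed)
      from cmat_compose[OF this c_cont[OF i i']]
      have "cmat ?X n (\<lambda>p. c i i' \<one> (fst p))" by simp
      from continuous_map_mult_vec[OF this c2]
      show "continuous_map ?X (cvec_topology n) (\<lambda>p. (\<lambda>i'\<in>{..<m}. c i i' \<one> (fst p) *\<^sub>v snd p) i')"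
        using i' by simp
    qed
    moreover have "(\<lambda>p. (fst p, \<lambda>i'\<in>{..<m}. c i i' \<one> (fst p) *\<^sub>v snd p)) \<in> topspace ?X \<rightarrow> S"
    proof
      fix p assume "p \<in> topspace ?X"
      from img(1)[OF this] obtain s where "s \<in> S" "triv i p = j s" by blast
      then show "(fst p, \<lambda>i'\<in>{..<m}. c i i' \<one> (fst p) *\<^sub>v snd p) \<in> S"
        using j_inj unfolding triv_def by (metis injD)
    qed
    ultimately have "continuous_map ?X TS (\<lambda>p. (fst p, \<lambda>i'\<in>{..<m}. c i i' \<one> (fst p) *\<^sub>v snd p))"
      unfolding TS_def by (rule continuous_map_into_subtopology)
    from continuous_map_compose[OF this j_cont]
    have "continuous_map ?X TE (triv i)" by (simp add: triv_def o_def)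
    moreover have "triv i \<in> topspace ?X \<rightarrow> {e. fst (d e) \<in> U i}" using img(2) by auto
    ultimately show "continuous_map ?X ?Y (triv i)" by (rule continuous_map_into_subtopology)
    have "continuous_map ?Y circle (\<lambda>e. fst (d e))" "continuous_map ?Y (cvec_topology n) (\<lambda>e. snd (d e) i)"
      using continuous_map_compose[OF d_cont fst_TS_cont] continuous_map_compose[OF d_cont snd_TS_cont[OF i]]
      by (simp_all add: o_def continuous_map_from_subtopology)
    then show "continuous_map ?Y ?X (\<lambda>e. (fst (d e), snd (d e) i))"
      by (intro continuous_map_pairedI continuous_map_into_subtopology) auto
    show "(fst (d (triv i p)), snd (d (triv i p)) i) = p" if "p \<in> topspace ?X" for p
      using img(2,3)[OF that] by simp
    fix e assume "e \<in> topspace ?Y"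
    then have "e \<in> j ` S" "fst (d e) \<in> U i" by (auto simp: topspace_TE)
    then obtain g t v where "g \<in> carrier G" "t \<in> {0..1}" "v \<in> carrier_vec n" "e = j (pt g t v)" "pr g t \<in> U i"
      by (auto elim!: S_E simp del: atLeastAtMost_iff)
    then show "triv i (fst (d e), snd (d e) i) = e" using triv_pt[OF i] snd_pt[OF i] by simp
  qed
  then show ?thesis by (rule homeomorphic_maps_map[THEN iffD1, THEN conjunct1])
qed

lemma E_vector_bundle: "complex_vector_bundle E"
  unfolding complex_vector_bundle_def E_simps
proof (intro conjI ballI)
  show "continuous_map TE circle (\<lambda>e. fst (d e))"
    using continuous_map_compose[OF d_cont fst_TS_cont] by (simp add: o_def)
  fix x assume "x \<in> topspace circle"
  then have x: "x \<in> sphere 0 1" by (simp only: topspace_circle)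
  show "carrier (fib x) = {e \<in> topspace TE. fst (d e) = x}" by (simp add: fib_def topspace_TE)
  show "vectorspace class_ring (fib x)" by (rule fib_vectorspace[OF x])
  obtain i where i: "i < m" "x \<in> U i" using U_exists[OF x] by blast
  have "linear_map class_ring (module_vec TYPE(complex) n) (fib y) (\<lambda>v. triv i (y, v))" if y: "y \<in> U i" for y
  proof -
    have "y \<in> sphere 0 1" using y by (simp add: U_def)
    then obtain g t where g: "g \<in> carrier G" "t \<in> {0..1}" "pr g t = y" using rp by metis
    have "det (F i g t) \<noteq> 0" using U_iff[OF i(1) g(1,2)] g(3) y by simp
    note mi = minv[OF F_carrier[OF i(1) g(1,2)] this]
    note l = pt_linear[OF g(1,2) mi(1)]
    show ?thesis
    proof (rule linear_mapI[OF vec_vs fib_vectorspace[OF \<open>y \<in> sphere 0 1\<close>]])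
      interpret l: linear_map class_ring "module_vec TYPE(complex) n" "fib (pr g t)" "\<lambda>v. j (pt g t (minv (F i g t) *\<^sub>v v))" by (rule l)
      have t: "triv i (y, v) = j (pt g t (minv (F i g t) *\<^sub>v v))" if "v \<in> carrier_vec n" for v
        using triv_eq[OF i(1) g(1,2) that] g(3) y by simp
      fix v :: "complex vec" assume v: "v \<in> carrier (module_vec TYPE(complex) n)"
      then have v': "v \<in> carrier_vec n" by (simp add: module_vec_def)
      show "triv i (y, v) \<in> carrier (fib y)" unfolding t[OF v'] unfolding g(3)[symmetric] fib_carrier[OF g(1,2)] by (rule imageI[OF mult_mat_vec_carrier[OF mi(1) v']])
      show "triv i (y, a \<odot>\<^bsub>module_vec TYPE(complex) n\<^esub> v) = a \<odot>\<^bsub>fib y\<^esub> triv i (y, v)" for a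
        using module_hom_smult[OF l.f_hom, of a v] v v' t[OF v'] t[of "a \<cdot>\<^sub>v v"] g(3) by (simp add: module_vec_def)
      fix w :: "complex vec" assume w: "w \<in> carrier (module_vec TYPE(complex) n)"
      then have w': "w \<in> carrier_vec n" by (simp add: module_vec_def)
      show "triv i (y, v \<oplus>\<^bsub>module_vec TYPE(complex) n\<^esub> w) = triv i (y, v) \<oplus>\<^bsub>fib y\<^esub> triv i (y, w)"
        using module_hom_add[OF l.f_hom v w] v' w' t[OF v'] t[OF w'] t[of "v + w"] g(3) by (simp add: module_vec_def)
    qed
  qed
  then show "\<exists>U n \<phi>. openin circle U \<and> x \<in> U \<and>
      homeomorphic_map (prod_topology (subtopology circle U) (cvec_topology n)) (subtopology TE {e. fst (d e) \<in> U}) \<phi> \<and>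
      (\<forall>y\<in>U. linear_map class_ring (module_vec TYPE(complex) n) (fib y) (\<lambda>v. \<phi> (y, v)))"
    using U_open[OF i(1)] i(2) triv_homeomorphic[OF i(1)] by blast
qed

lemma act_pt:
  assumes "k \<in> carrier G" "g \<in> carrier G" "t \<in> {0..1}" "v \<in> carrier_vec n"
  shows "act E k (j (pt g t v)) = j (pt (k \<otimes> g) t v)"
  using bact_pt[OF assms] by simp

lemma E_G_bundle: "G_vector_bundle G T \<rho> E"
  unfolding G_vector_bundle_def
proof (intro conjI ballI)
  show "complex_vector_bundle E" by (rule E_vector_bundle)
  have "continuous_map (prod_topology T TE) (prod_topology T TS) (\<lambda>p. (fst p, d (snd p)))"
    using continuous_map_compose[OF continuous_map_snd d_cont, of T]
    by (intro continuous_map_pairedI continuous_map_fst) (simp add: o_def)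
  from continuous_map_compose[OF continuous_map_compose[OF this bact_cont] j_cont]
  show "continuous_map (prod_topology T (total_space E)) (total_space E) (\<lambda>(g, e). act E g e)"
    by (simp add: o_def case_prod_unfold)
  show "act E \<one> e = e" if e: "e \<in> topspace (total_space E)" for e
  proof -
    obtain s where s: "s \<in> S" "e = j s" using e by (auto simp: topspace_TE)
    from s(1) obtain g t v where "g \<in> carrier G" "t \<in> {0..1}" "v \<in> carrier_vec n" "s = pt g t v" by (rule S_E)
    then show ?thesis using act_pt[OF one_closed] s(2) by simp
  qed
  fix g assume g: "g \<in> carrier G"
  show "proj E (act E g e) = \<rho> g *v proj E e" if e: "e \<in> topspace (total_space E)" for e
  proof -
    obtain s where s: "s \<in> S" "e = j s" using e by (auto simp: topspace_TE)
    from s(1) obtain g' t v where "g' \<in> carrier G" "t \<in> {0..1}" "v \<in> carrier_vec n" "s = pt g' t v" by (rule S_E)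
    then show ?thesis using bact_pt[OF g] s(2) pr_mult[OF _ g] by simp
  qed
  show "act E (g \<otimes> h) e = act E g (act E h e)" if h: "h \<in> carrier G" and e: "e \<in> topspace (total_space E)" for h e
  proof -
    obtain s where s: "s \<in> S" "e = j s" using e by (auto simp: topspace_TE)
    from s(1) obtain g' t v where "g' \<in> carrier G" "t \<in> {0..1}" "v \<in> carrier_vec n" "s = pt g' t v" by (rule S_E)
    then show ?thesis using bact_pt g h s(2) by (simp add: m_assoc)
  qed
  fix x assume "x \<in> topspace circle"
  then have x: "x \<in> sphere 0 1" by (simp only: topspace_circle)
  obtain g0 t where gt: "g0 \<in> carrier G" "t \<in> {0..1}" "pr g0 t = x" using rp[OF x] by metis
  have gx: "\<rho> g *v x = pr (g \<otimes> g0) t" using pr_mult[OF gt(1) g] gt(3) by simp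
  note gg = m_closed[OF g gt(1)]
  note a = act_pt[OF g gt(1,2)]
  have "linear_map class_ring (fib (pr g0 t)) (fib (pr (g \<otimes> g0) t)) (act E g)"
  proof (rule linear_mapI[OF fib_vectorspace[OF pr_sphere[OF gt(1,2)]] fib_vectorspace[OF pr_sphere[OF gg gt(2)]]])
    fix e assume "e \<in> carrier (fib (pr g0 t))"
    then obtain v where v: "v \<in> carrier_vec n" "e = j (pt g0 t v)" unfolding fib_carrier[OF gt(1,2)] by blast
    show "act E g e \<in> carrier (fib (pr (g \<otimes> g0) t))" unfolding v(2) a[OF v(1)] fib_carrier[OF gg gt(2)] using v(1) by simp
    show "act E g (z \<odot>\<^bsub>fib (pr g0 t)\<^esub> e) = z \<odot>\<^bsub>fib (pr (g \<otimes> g0) t)\<^esub> act E g e" for z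
      unfolding v(2) a[OF v(1)] pt_smult[OF gt(1,2) v(1)] pt_smult[OF gg gt(2) v(1)]
      by (rule a) (use v(1) in simp)
    fix e' assume "e' \<in> carrier (fib (pr g0 t))"
    then obtain w where w: "w \<in> carrier_vec n" "e' = j (pt g0 t w)" unfolding fib_carrier[OF gt(1,2)] by blast
    show "act E g (e \<oplus>\<^bsub>fib (pr g0 t)\<^esub> e') = act E g e \<oplus>\<^bsub>fib (pr (g \<otimes> g0) t)\<^esub> act E g e'"
      unfolding v(2) w(2) a[OF v(1)] a[OF w(1)] pt_add[OF gt(1,2) v(1) w(1)] pt_add[OF gg gt(2) v(1) w(1)]
      by (rule a) (use v(1) w(1) in simp)
  qed
  then show "linear_map class_ring (fiber E x) (fiber E (\<rho> g *v x)) (act E g)"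
    by (simp only: gx gt(3) E_simps(3))
qed

text \<open>Over the point with parameters \<open>g\<close> and \<open>t\<close>, an element
  \<open>h\<close> acts in the coordinates of the frame by \<sigma> of
  \<open>inv g \<otimes> h \<otimes> g\<close>. The fiber is thus a conjugate of
  \<open>\<sigma>\<close>, and the intertwiner from \<open>conj\<close> identifies it with
  \<open>\<sigma>\<close>.\<close>

lemma E_fiber_module: "is_fiber_module (kernel G O2 \<rho>) E n \<sigma>"
  unfolding is_fiber_module_def
proof
  fix x assume "x \<in> topspace circle"
  then have x: "x \<in> sphere 0 1" by (simp only: topspace_circle)
  obtain g t where g: "g \<in> carrier G" "t \<in> {0..1}" and xp: "x = pr g t" using rp[OF x] by metis
  obtain P where P: "P \<in> carrier_mat n n" "det P \<noteq> 0"
    and Ph: "\<And>h. h \<in> kernel G O2 \<rho> \<Longrightarrow> inv g \<otimes> h \<otimes> g \<in> kernel G O2 \<rho>"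
      "\<And>h. h \<in> kernel G O2 \<rho> \<Longrightarrow> \<sigma> (inv g \<otimes> h \<otimes> g) * P = P * \<sigma> h" using conj[OF g(1)] by blast
  note mi = minv[OF P]
  let ?f = "\<lambda>v. j (pt g t (P *\<^sub>v v))"
  show "\<exists>f. linear_map class_ring (module_vec TYPE(complex) n) (fiber E x) f \<and>
      bij_betw f (carrier_vec n) (carrier (fiber E x)) \<and>
      (\<forall>h\<in>kernel G O2 \<rho>. \<forall>v\<in>carrier_vec n. f (\<sigma> h *\<^sub>v v) = act E h (f v))"
  proof (intro exI[of _ ?f] conjI ballI)
    show "linear_map class_ring (module_vec TYPE(complex) n) (fiber E x) ?f"
      unfolding xp E_simps(3) by (rule pt_linear[OF g P(1)])
    show "bij_betw ?f (carrier_vec n) (carrier (fiber E x))"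
    proof (rule bij_betwI')
      fix v w :: "complex vec" assume v: "v \<in> carrier_vec n" and w: "w \<in> carrier_vec n"
      show "(?f v = ?f w) = (v = w)"
      proof
        assume "?f v = ?f w"
        then have "pt g t (P *\<^sub>v v) = pt g t (P *\<^sub>v w)" by (rule injD[OF j_inj])
        then have "P *\<^sub>v v = P *\<^sub>v w" by (rule pt_inj[OF g mult_mat_vec_carrier[OF P(1) v] mult_mat_vec_carrier[OF P(1) w]])
        then have "(minv P * P) *\<^sub>v v = (minv P * P) *\<^sub>v w"
          using assoc_mult_mat_vec[OF mi(1) P(1)] v w by simp
        then show "v = w" using mi(3) v w by simp
      qed simp
    next
      fix v :: "complex vec" assume v: "v \<in> carrier_vec n"
      show "?f v \<in> carrier (fiber E x)" unfolding xp E_simps(3) fib_carrier[OF g] by (rule imageI[OF mult_mat_vec_carrier[OF P(1) v]])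
    next
      fix e assume "e \<in> carrier (fiber E x)"
      then obtain v where v: "v \<in> carrier_vec n" "e = j (pt g t v)" unfolding xp E_simps(3) fib_carrier[OF g] by blast
      have "P *\<^sub>v (minv P *\<^sub>v v) = v" using assoc_mult_mat_vec[OF P(1) mi(1) v(1)] mi(2) v(1) by simp
      then have "e = ?f (minv P *\<^sub>v v)" using v(2) by simp
      then show "\<exists>v\<in>carrier_vec n. e = ?f v" using mult_mat_vec_carrier[OF mi(1) v(1)] by blast
    qed
    fix h and v :: "complex vec" assume h: "h \<in> kernel G O2 \<rho>" and v: "v \<in> carrier_vec n"
    have hc: "h \<in> carrier G" using h by (simp add: kernel_def)
    let ?h = "inv g \<otimes> h \<otimes> g"
    have w: "P *\<^sub>v v \<in> carrier_vec n" using P(1) v by simp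
    have "h \<otimes> g = g \<otimes> ?h" using g(1) hc by (simp add: m_assoc inv_cancel)
    then have "F i (h \<otimes> g) t *\<^sub>v (P *\<^sub>v v) = F i g t *\<^sub>v (P *\<^sub>v (\<sigma> h *\<^sub>v v))" if i: "i < m" for i
    proof -
      note f = F_carrier[OF i g] and s = \<sigma>_carrier[OF h] \<sigma>_carrier[OF Ph(1)[OF h]]
      have "F i (h \<otimes> g) t = F i g t * \<sigma> ?h"
        using F_kernel[OF i g(1) Ph(1)[OF h] g(2)] \<open>h \<otimes> g = g \<otimes> ?h\<close> by simp
      then have "F i (h \<otimes> g) t *\<^sub>v (P *\<^sub>v v) = F i g t *\<^sub>v (\<sigma> ?h *\<^sub>v (P *\<^sub>v v))"
        using assoc_mult_mat_vec[OF f s(2) w] by simp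
      also have "\<sigma> ?h *\<^sub>v (P *\<^sub>v v) = (\<sigma> ?h * P) *\<^sub>v v" using assoc_mult_mat_vec[OF s(2) P(1) v] by simp
      also have "\<dots> = P *\<^sub>v (\<sigma> h *\<^sub>v v)" unfolding Ph(2)[OF h] by (rule assoc_mult_mat_vec[OF P(1) s(1) v])
      finally show ?thesis .
    qed
    moreover have "pr (h \<otimes> g) t = pr g t"
    proof -
      have "\<rho> h = Finite_Cartesian_Product.mat 1" using h by (simp add: kernel_def O2_def)
      then show ?thesis using pr_mult[OF g(1) hc] by simp
    qed
    ultimately have "pt (h \<otimes> g) t (P *\<^sub>v v) = pt g t (P *\<^sub>v (\<sigma> h *\<^sub>v v))"
      by (auto simp: pt_def intro!: restrict_ext)
    then show "?f (\<sigma> h *\<^sub>v v) = act E h (?f v)" unfolding act_pt[OF hc g w] by simp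
  qed
qed

end

section \<open>Subgroups of the orthogonal group of the plane\<close>

definition cpt :: "real \<Rightarrow> real^2" where
  "cpt a = (\<chi> i. if i = 1 then cos a else sin a)"

lemma cpt_nth [simp]: "cpt a $ 1 = cos a" "cpt a $ 2 = sin a"
  by (simp_all add: cpt_def)

lemma norm_cpt [simp]: "norm (cpt a) = 1"
  by (simp add: norm_vec_def L2_set_def sum_2)

lemma sphere_cpt: assumes "x \<in> sphere 0 1" obtains a where "x = cpt a"
proof -
  have "(x $ 1)\<^sup>2 + (x $ 2)\<^sup>2 = 1" using assms by (simp add: norm_vec_def L2_set_def sum_2)
  then obtain a where "x $ 1 = cos a" "x $ 2 = sin a" using sincos_total_2pi by metis
  then have "x = cpt a" by (simp add: Finite_Cartesian_Product.vec_eq_iff forall_2)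
  then show ?thesis using that by blast
qed

lemma cpt_eq_iff: "cpt a = cpt b \<longleftrightarrow> (\<exists>z::int. a = b + 2 * pi * of_int z)"
  using sin_cos_eq_iff[of a b] by (auto simp: Finite_Cartesian_Product.vec_eq_iff forall_2)

lemma cpt_cont: "continuous_on S cpt"
  unfolding cpt_def
proof (intro continuous_on_vec_lambda)
  show "continuous_on S (\<lambda>x. if i = 1 then cos x else sin x)" for i :: 2
    by (cases "i = 1") (auto intro!: continuous_intros)
qed

lemma matrix_eq_on_cpt:
  fixes M N :: "real^2^2"
  assumes "\<And>a. M *v cpt a = N *v cpt a" shows "M = N"
proof -
  have "cpt 0 = axis 1 1" "cpt (pi/2) = axis 2 1" by (auto simp: Finite_Cartesian_Product.vec_eq_iff forall_2 axis_def)
  then have "column 1 M = column 1 N" "column 2 M = column 2 N"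
    using assms[of 0] assms[of "pi/2"] by (simp_all add: matrix_vector_mult_basis)
  then show ?thesis by (simp add: Finite_Cartesian_Product.vec_eq_iff column_def forall_2 fun_eq_iff)
qed

lemma orthonormal_aux:
  fixes c d p q :: real
  assumes "c * p + d * q = 0" "c * c + d * d = 1" "p\<^sup>2 + q\<^sup>2 = 1"
  obtains s where "s = 1 \<or> s = -1" "p = - s * d" "q = s * c"
proof -
  \<comment> \<open>The determinant of the matrix with columns \<open>(c, d)\<close> and
    \<open>(p, q)\<close>; orthonormality forces it to be a sign.\<close>
  define s where "s = q * c - p * d"
  have "p = p * (c * c + d * d) - c * (c * p + d * q)" unfolding assms by simp
  also have "\<dots> = - s * d" by (simp add: s_def algebra_simps)
  finally have p: "p = - s * d" .
  have "q = q * (c * c + d * d) - d * (c * p + d * q)" unfolding assms by simp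
  also have "\<dots> = s * c" by (simp add: s_def algebra_simps)
  finally have q: "q = s * c" .
  have "s\<^sup>2 = s\<^sup>2 * (c * c + d * d)" unfolding assms by simp
  also have "\<dots> = (- s * d)\<^sup>2 + (s * c)\<^sup>2" by (simp add: power2_eq_square algebra_simps)
  also have "\<dots> = 1" unfolding p[symmetric] q[symmetric] by (rule assms)
  finally have "s = 1 \<or> s = -1" by (simp add: power2_eq_1_iff)
  then show ?thesis using that p q by blast
qed

text \<open>The first case is the rotation by \<open>a\<close>, the second the reflection in the
  line at angle \<open>a / 2\<close>. The sign from \<open>orthonormal_aux\<close> separates
  them.\<close>

lemma orthogonal_cpt_cases:
  fixes M :: "real^2^2"
  assumes "orthogonal_matrix M"
  obtains a where "\<And>b. M *v cpt b = cpt (b + a)" | a where "\<And>b. M *v cpt b = cpt (a - b)"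
proof -
  have o: "transpose M ** M = Finite_Cartesian_Product.mat 1" using assms by (simp add: orthogonal_matrix)
  have e: "(transpose M ** M) $ i $ k = M $ 1 $ i * M $ 1 $ k + M $ 2 $ i * M $ 2 $ k" for i k
    by (simp add: matrix_matrix_mult_def transpose_def sum_2)
  have 1: "(M $ 1 $ 1)\<^sup>2 + (M $ 2 $ 1)\<^sup>2 = 1" "(M $ 1 $ 2)\<^sup>2 + (M $ 2 $ 2)\<^sup>2 = 1"
    and 2: "M $ 1 $ 1 * M $ 1 $ 2 + M $ 2 $ 1 * M $ 2 $ 2 = 0"
    using e[of 1 1] e[of 2 2] e[of 1 2] unfolding o by (simp_all add: Finite_Cartesian_Product.mat_def power2_eq_square)
  obtain a where a: "M $ 1 $ 1 = cos a" "M $ 2 $ 1 = sin a" using sincos_total_2pi[OF 1(1)] by metis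
  define p q where "p = M $ 1 $ 2" and "q = M $ 2 $ 2"
  have z: "cos a * p + sin a * q = 0" using 2 by (simp add: a p_def q_def)
  have cs: "cos a * cos a + sin a * sin a = 1" using sin_cos_squared_add3[of a] by simp
  have "p\<^sup>2 + q\<^sup>2 = 1" using 1(2) by (simp add: p_def q_def)
  from orthonormal_aux[OF z cs this] obtain s where "s = 1 \<or> s = -1" and p: "p = - s * sin a" and q: "q = s * cos a" by blast
  have mv: "M *v cpt b = cpt c" if "cos a * cos b + p * sin b = cos c" "sin a * cos b + q * sin b = sin c" for b c
    using that by (simp add: Finite_Cartesian_Product.vec_eq_iff forall_2 matrix_vector_mult_def sum_2 a p_def q_def)
  from \<open>s = 1 \<or> s = -1\<close> show ?thesis
  proof
    assume "s = 1"
    then have "M *v cpt b = cpt (b + a)" for b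
      by (intro mv) (simp_all add: p q cos_add sin_add)
    then show ?thesis using that(1) by blast
  next
    assume "s = -1"
    then have "M *v cpt b = cpt (a - b)" for b
      by (intro mv) (simp_all add: p q cos_diff sin_diff)
    then show ?thesis using that(2) by blast
  qed
qed

definition rot :: "real \<Rightarrow> real^2^2" where
  "rot a = (\<chi> i k. if i = 1 then (if k = 1 then cos a else - sin a) else (if k = 1 then sin a else cos a))"

lemma rot_cpt: "rot a *v cpt b = cpt (b + a)"
  by (simp add: Finite_Cartesian_Product.vec_eq_iff forall_2 matrix_vector_mult_def sum_2 rot_def cos_add sin_add)

lemma rot_cont: "continuous_on S rot"
  unfolding rot_def
proof (intro continuous_on_vec_lambda)
  show "continuous_on S (\<lambda>x. if i = 1 then (if k = 1 then cos x else - sin x) else (if k = 1 then sin x else cos x))" for i k :: 2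
    by (cases "i = 1"; cases "k = 1") (auto intro!: continuous_intros)
qed

text \<open>If the positive elements have infimum 0, the multiples of small elements are dense, and
  closedness gives the whole line. Otherwise the infimum is attained, and division with remainder
  shows that it generates.\<close>

lemma closed_real_subgroup:
  fixes \<Theta> :: "real set"
  assumes cl: "closed \<Theta>" and add: "\<And>a b. a \<in> \<Theta> \<Longrightarrow> b \<in> \<Theta> \<Longrightarrow> a + b \<in> \<Theta>"
    and neg: "\<And>a. a \<in> \<Theta> \<Longrightarrow> - a \<in> \<Theta>" and p: "p \<in> \<Theta>" "p > 0"
  shows "\<Theta> = UNIV \<or> (\<exists>d>0. d \<in> \<Theta> \<and> (\<forall>a\<in>\<Theta>. \<exists>z::int. a = of_int z * d))"
proof -
  have 0: "0 \<in> \<Theta>" using add[OF p(1) neg[OF p(1)]] by simp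
  have mulnat: "of_nat k * a \<in> \<Theta>" if "a \<in> \<Theta>" for a and k :: nat
    by (induction k) (use 0 add that in \<open>auto simp: algebra_simps\<close>)
  have mul: "of_int z * a \<in> \<Theta>" if "a \<in> \<Theta>" for a and z :: int
    using mulnat[OF that, of "nat z"] neg[OF mulnat[OF that, of "nat (- z)"]]
    by (cases "z \<ge> 0") (auto simp: of_nat_nat)
  define P where "P = {a \<in> \<Theta>. a > 0}"
  define d where "d = Inf P"
  have Pne: "P \<noteq> {}" and Pb: "bdd_below P" using p by (auto simp: P_def intro!: bdd_belowI[of _ 0])
  have dle: "d \<le> a" if "a \<in> P" for a unfolding d_def by (rule cInf_lower[OF that Pb])
  have d0: "d \<ge> 0" unfolding d_def by (rule cInf_greatest[OF Pne]) (auto simp: P_def)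
  show ?thesis
  proof (cases "d = 0")
    case True
    have "x \<in> \<Theta>" for x
    proof -
      have "x \<in> closure \<Theta>" unfolding closure_approachable
      proof (intro allI impI)
        fix e :: real assume "e > 0"
        then obtain q where q: "q \<in> P" "q < e" using cInf_lessD[OF Pne, of e] True by (auto simp: d_def)
        then have q0: "q > 0" "q \<in> \<Theta>" by (auto simp: P_def)
        have "of_int \<lfloor>x / q\<rfloor> * q \<le> x" "x < (of_int \<lfloor>x / q\<rfloor> + 1) * q"
          using q0 by (simp_all add: pos_le_divide_eq[symmetric] pos_divide_less_eq[symmetric])
        then have "dist (of_int \<lfloor>x / q\<rfloor> * q) x < e" using q(2) by (simp add: dist_real_def algebra_simps)
        then show "\<exists>y\<in>\<Theta>. dist y x < e" using mul[OF q0(2)] by blast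
      qed
      then show ?thesis using cl by simp
    qed
    then show ?thesis by blast
  next
    case False
    then have d: "d > 0" using d0 by simp
    have "P = \<Theta> \<inter> {d..}" using dle d by (auto simp: P_def)
    then have "closed P" using cl by auto
    then have "d \<in> P" unfolding d_def using closed_contains_Inf[OF Pne Pb] by simp
    then have dT: "d \<in> \<Theta>" by (simp add: P_def)
    have "\<exists>z::int. a = of_int z * d" if a: "a \<in> \<Theta>" for a
    proof -
      define r where "r = a - of_int \<lfloor>a / d\<rfloor> * d"
      have "r \<in> \<Theta>" using add[OF a neg[OF mul[OF dT, of "\<lfloor>a / d\<rfloor>"]]] by (simp add: r_def)
      moreover have "of_int \<lfloor>a / d\<rfloor> * d \<le> a" "a < (of_int \<lfloor>a / d\<rfloor> + 1) * d"
        using d by (simp_all add: pos_le_divide_eq[symmetric] pos_divide_less_eq[symmetric])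
      then have "0 \<le> r" "r < d" by (auto simp: r_def algebra_simps)
      ultimately have "r = 0" using dle[of r] by (cases "r = 0") (auto simp: P_def)
      then show ?thesis by (intro exI[of _ "\<lfloor>a / d\<rfloor>"]) (simp add: r_def)
    qed
    then show ?thesis using d dT by blast
  qed
qed

section \<open>Every invariant character is realised\<close>

lemma minv_intertwine:
  assumes "P \<in> carrier_mat n n" "det P \<noteq> 0" "A \<in> carrier_mat n n" "B \<in> carrier_mat n n" "A * P = P * B"
  shows "B * minv P = minv P * A"
proof -
  note mi = minv[OF assms(1,2)]
  have "minv P * A = minv P * (A * (P * minv P))" unfolding mi(2) using mi(1) assms(3) by (simp add: sq_one)
  also have "\<dots> = minv P * ((A * P) * minv P)" using sq_assoc[OF assms(3,1) mi(1)] by simp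
  also have "\<dots> = minv P * (P * (B * minv P))" unfolding assms(5) using sq_assoc[OF assms(1,4) mi(1)] by simp
  also have "\<dots> = B * minv P" by (rule sq_cancel[OF mi(3) mi(1) assms(1)]) (use mi(1) assms(4) in simp)
  finally show ?thesis by simp
qed

locale circle_action = compact_group G T for G :: "('g, 'r) monoid_scheme" (structure) and T :: "'g topology" +
  fixes \<rho> :: "'g \<Rightarrow> real^2^2" and n :: nat and \<sigma> :: "'g \<Rightarrow> complex mat"
  assumes Hausdorff: "Hausdorff_space T"
    and rep: "orthogonal_rep G T \<rho>"
    and \<sigma>: "complex_rep (G\<lparr>carrier := kernel G O2 \<rho>\<rparr>) (subtopology T (kernel G O2 \<rho>)) n \<sigma>"
    and inv_char: "invariant_character G (kernel G O2 \<rho>) (character \<sigma>)"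
begin

abbreviation "H \<equiv> kernel G O2 \<rho>"

lemma \<rho>_mult: "g \<in> carrier G \<Longrightarrow> h \<in> carrier G \<Longrightarrow> \<rho> (g \<otimes> h) = \<rho> g ** \<rho> h"
  and \<rho>_orth: "g \<in> carrier G \<Longrightarrow> orthogonal_matrix (\<rho> g)"
  and \<rho>_cont: "continuous_map T euclidean \<rho>"
  using rep by (auto simp: orthogonal_rep_def hom_def O2_def)

lemma \<rho>_one: "\<rho> \<one> = Finite_Cartesian_Product.mat 1"
proof -
  have "\<rho> \<one> = \<rho> \<one> ** \<rho> \<one>" using \<rho>_mult[of \<one> \<one>] by simp
  then have "transpose (\<rho> \<one>) ** \<rho> \<one> = (transpose (\<rho> \<one>) ** \<rho> \<one>) ** \<rho> \<one>"
    by (metis matrix_mul_assoc)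
  then show ?thesis using \<rho>_orth[of \<one>] by (simp add: orthogonal_matrix)
qed

lemma \<rho>_apply_mult: "g \<in> carrier G \<Longrightarrow> h \<in> carrier G \<Longrightarrow> \<rho> (g \<otimes> h) *v x = \<rho> g *v (\<rho> h *v x)"
  by (simp add: \<rho>_mult matrix_vector_mul_assoc)

lemma \<rho>_inv_apply: "g \<in> carrier G \<Longrightarrow> \<rho> g *v x = z \<longleftrightarrow> x = \<rho> (inv g) *v z"
  using \<rho>_apply_mult[of "inv g" g x] \<rho>_apply_mult[of g "inv g" z] by (auto simp: \<rho>_one)

lemma H_iff: "h \<in> H \<longleftrightarrow> h \<in> carrier G \<and> \<rho> h = Finite_Cartesian_Product.mat 1"
  by (auto simp: kernel_def O2_def)

lemma H_carrier: "h \<in> H \<Longrightarrow> h \<in> carrier G"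
  by (simp add: H_iff)

lemma H_cpt_iff: "h \<in> H \<longleftrightarrow> h \<in> carrier G \<and> (\<forall>b. \<rho> h *v cpt b = cpt b)"
  unfolding H_iff using matrix_eq_on_cpt[of "\<rho> h" "Finite_Cartesian_Product.mat 1"] by auto

lemma \<rho>_cases:
  assumes "g \<in> carrier G"
  obtains a where "\<And>b. \<rho> g *v cpt b = cpt (b + a)" | a where "\<And>b. \<rho> g *v cpt b = cpt (a - b)"
proof -
  note R = that
  show thesis
  proof (rule orthogonal_cpt_cases[OF \<rho>_orth[OF assms]])
    fix a assume "\<And>b. \<rho> g *v cpt b = cpt (b + a)"
    then show thesis by (rule R(1))
  next
    fix a assume "\<And>b. \<rho> g *v cpt b = cpt (a - b)"
    then show thesis by (rule R(2))
  qed
qed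

section \<open>Stabilisers and conjugates\<close>

definition "stab x = {g \<in> carrier G. \<rho> g *v x = x}"

lemma stab_subgroup: "subgroup (stab x) G"
proof
  show "stab x \<subseteq> carrier G" by (auto simp: stab_def)
  show "\<one> \<in> stab x" by (simp add: stab_def \<rho>_one)
  show "g \<otimes> h \<in> stab x" if "g \<in> stab x" "h \<in> stab x" for g h
    using that by (auto simp: stab_def \<rho>_apply_mult)
  show "inv g \<in> stab x" if "g \<in> stab x" for g
    using that \<rho>_inv_apply[of g x x] by (auto simp: stab_def)
qed

lemma H_subgroup: "subgroup H G"
proof
  show "H \<subseteq> carrier G" by (auto simp: H_iff)
  show "\<one> \<in> H" by (simp add: H_iff \<rho>_one)
  show "g \<otimes> h \<in> H" if "g \<in> H" "h \<in> H" for g h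
    using that by (auto simp: H_iff \<rho>_mult)
  show "inv g \<in> H" if "g \<in> H" for g
    using that \<rho>_inv_apply[of g] by (auto simp: H_cpt_iff)
qed

lemma H_conj: assumes "g \<in> carrier G" "h \<in> H" shows "inv g \<otimes> h \<otimes> g \<in> H"
proof -
  have "\<rho> (inv g \<otimes> h \<otimes> g) *v cpt b = \<rho> (inv g) *v (\<rho> g *v cpt b)" for b
    using assms by (simp add: \<rho>_apply_mult H_iff)
  also have "\<rho> (inv g) *v (\<rho> g *v cpt b) = cpt b" for b using \<rho>_inv_apply[OF assms(1)] by metis
  finally show ?thesis using assms by (simp add: H_cpt_iff H_iff)
qed

lemma stab_closed: "closedin T (stab x)"
proof -
  have "continuous_map T euclidean (\<lambda>g. \<rho> g *v x)"
    by (rule continuous_map_matrix_vector[OF \<rho>_cont]) simp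
  from closedin_continuous_map_preimage[OF this, of "{x}"]
  show ?thesis by (simp add: stab_def topspace_eq)
qed

lemma H_closed: "closedin T H"
proof -
  have "closedin T {g \<in> topspace T. \<rho> g \<in> {Finite_Cartesian_Product.mat 1}}"
    by (rule closedin_continuous_map_preimage[OF \<rho>_cont]) simp
  moreover have "{g \<in> topspace T. \<rho> g \<in> {Finite_Cartesian_Product.mat 1}} = H" by (auto simp: H_iff topspace_eq)
  ultimately show ?thesis by simp
qed

lemma H_stab: "H \<subseteq> stab x"
  by (auto simp: H_iff stab_def)

lemma \<sigma>_carrier: "h \<in> H \<Longrightarrow> \<sigma> h \<in> carrier_mat n n"
  using complex_repD(1)[OF \<sigma>] by simp

text \<open>Invariance of the character says precisely that \<open>\<sigma>\<close> and its
  conjugate by \<open>g\<close> have the same trace on \<open>H\<close>; equality of characters then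
  provides an invertible intertwiner.\<close>

lemma conj_intertwiner:
  assumes g: "g \<in> carrier G"
  obtains P where "P \<in> carrier_mat n n" "det P \<noteq> 0" "\<And>h. h \<in> H \<Longrightarrow> \<sigma> (inv g \<otimes> h \<otimes> g) * P = P * \<sigma> h"
proof -
  interpret H: compact_group "G\<lparr>carrier := H\<rparr>" "subtopology T H"
    by (rule compact_group_subgroup[OF compact_group_axioms H_subgroup H_closed])
  define \<tau> where "\<tau> h = \<sigma> (inv g \<otimes> h \<otimes> g)" for h
  have tX: "topspace (subtopology T H) = H" using H.topspace_eq by simp
  have \<tau>: "complex_rep (G\<lparr>carrier := H\<rparr>) (subtopology T H) n \<tau>"
    unfolding complex_rep_def
  proof (intro conjI ballI allI impI)
    show "\<tau> h \<in> carrier_mat n n" if "h \<in> carrier (G\<lparr>carrier := H\<rparr>)" for h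
      using that \<sigma>_carrier[OF H_conj[OF g]] by (simp add: \<tau>_def)
    show "\<tau> \<one>\<^bsub>G\<lparr>carrier := H\<rparr>\<^esub> = 1\<^sub>m n" using complex_repD(2)[OF \<sigma>] g by (simp add: \<tau>_def)
    show "\<tau> (h \<otimes>\<^bsub>G\<lparr>carrier := H\<rparr>\<^esub> k) = \<tau> h * \<tau> k"
      if "h \<in> carrier (G\<lparr>carrier := H\<rparr>)" "k \<in> carrier (G\<lparr>carrier := H\<rparr>)" for h k
    proof -
      have hk: "h \<in> H" "k \<in> H" using that by auto
      have "inv g \<otimes> (h \<otimes> k) \<otimes> g = (inv g \<otimes> h \<otimes> g) \<otimes> (inv g \<otimes> k \<otimes> g)"
        using g H_carrier[OF hk(1)] H_carrier[OF hk(2)] by (simp add: m_assoc inv_cancel)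
      then show ?thesis using complex_repD(3)[OF \<sigma>, of "inv g \<otimes> h \<otimes> g" "inv g \<otimes> k \<otimes> g"]
          H_conj[OF g hk(1)] H_conj[OF g hk(2)] by (simp add: \<tau>_def)
    qed
    have "continuous_map T T (\<lambda>h. inv g \<otimes> h \<otimes> g)"
      by (intro continuous_map_mult continuous_map_const_carrier continuous_map_id[unfolded id_def] inv_closed g)
    then have "continuous_map (subtopology T H) (subtopology T H) (\<lambda>h. inv g \<otimes> h \<otimes> g)"
      by (intro continuous_map_into_subtopology continuous_map_from_subtopology) (use H_conj[OF g] tX in auto)
    from cmat_compose[OF this H.complex_rep_cmat[OF \<sigma>]]
    have "cmat (subtopology T H) n \<tau>" by (simp add: \<tau>_def[abs_def])
    then show "continuous_map (subtopology T H) euclidean (\<lambda>h. \<tau> h $$ (i, k))" if "i < n" "k < n" for i k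
      using cmat_entry that by blast
  qed
  have "tr (\<sigma> h) = tr (\<tau> h)" if "h \<in> carrier (G\<lparr>carrier := H\<rparr>)" for h
    using inv_char that g by (simp add: invariant_character_def conj_character_def character_eq_tr \<tau>_def)
  from H.equal_characters_intertwiner[OF \<sigma> \<tau> this]
  obtain P where "intw (G\<lparr>carrier := H\<rparr>) n \<sigma> \<tau> P" "det P \<noteq> 0" by metis
  then show ?thesis using that[of P] by (simp add: intw_def \<tau>_def)
qed

lemma conj_intertwiner':
  assumes g: "g \<in> carrier G"
  obtains P where "P \<in> carrier_mat n n" "det P \<noteq> 0" "\<And>h. h \<in> H \<Longrightarrow> \<sigma> h * P = P * \<sigma> (inv g \<otimes> h \<otimes> g)"
proof -
  obtain P where P: "P \<in> carrier_mat n n" "det P \<noteq> 0" "\<And>h. h \<in> H \<Longrightarrow> \<sigma> (inv g \<otimes> h \<otimes> g) * P = P * \<sigma> h"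
    using conj_intertwiner[OF g] by metis
  note mi = minv[OF P(1,2)]
  have "det (minv P) \<noteq> 0"
  proof -
    have "det P * det (minv P) = 1" using mi P(1) by (simp add: det_mult[of _ n, symmetric])
    then show ?thesis by auto
  qed
  moreover have "\<sigma> h * minv P = minv P * \<sigma> (inv g \<otimes> h \<otimes> g)" if "h \<in> H" for h
    by (rule minv_intertwine[OF P(1,2) \<sigma>_carrier[OF H_conj[OF g that]] \<sigma>_carrier[OF that] P(3)[OF that]])
  ultimately show ?thesis using that[of "minv P"] mi(1) by blast
qed

lemma stab_extension:
  obtains \<tau> where "complex_rep (G\<lparr>carrier := stab (cpt b)\<rparr>) (subtopology T (stab (cpt b))) n \<tau>"
    "\<And>h. h \<in> H \<Longrightarrow> \<tau> h = \<sigma> h"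
proof (cases "stab (cpt b) = H")
  case True
  then show ?thesis using that[of \<sigma>] \<sigma> by simp
next
  case False
  then obtain a where a: "a \<in> stab (cpt b)" "a \<notin> H" using H_stab by blast
  \<comment> \<open>A rotation fixing a point is trivial, so every element of the stabiliser outside
    \<open>H\<close> acts as the reflection in the line through that point. Any two of them
    therefore differ by an element of \<open>H\<close>.\<close>
  have refl: "\<rho> k *v cpt c = cpt (2 * b - c)" if k: "k \<in> stab (cpt b)" "k \<notin> H" for k c
  proof -
    have kc: "k \<in> carrier G" and kb: "\<rho> k *v cpt b = cpt b" using k by (auto simp: stab_def)
    show ?thesis
    proof (rule \<rho>_cases[OF kc])
      fix d assume d: "\<And>c. \<rho> k *v cpt c = cpt (c + d)"
      then obtain z :: int where "b + d = b + 2 * pi * of_int z" using kb cpt_eq_iff by metis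
      then have "cpt (c + d) = cpt c" for c by (auto simp: cpt_eq_iff)
      then have "k \<in> H" using kc d by (simp add: H_cpt_iff)
      then show ?thesis using k by simp
    next
      fix d assume d: "\<And>c. \<rho> k *v cpt c = cpt (d - c)"
      then obtain z :: int where "d - b = b + 2 * pi * of_int z" using kb cpt_eq_iff by metis
      then have "d - c = (2 * b - c) + 2 * pi * of_int z" by simp
      then show ?thesis unfolding d cpt_eq_iff by blast
    qed
  qed
  have ac: "a \<in> carrier G" using a by (simp add: stab_def)
  have ak: "inv a \<otimes> k \<in> H" if k: "k \<in> stab (cpt b)" "k \<notin> H" for k
  proof -
    have kc: "k \<in> carrier G" using k by (simp add: stab_def)
    have "\<rho> (inv a \<otimes> k) *v cpt c = \<rho> (inv a) *v (\<rho> a *v cpt c)" for c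
      using kc ac refl[OF k] refl[OF a] by (simp add: \<rho>_apply_mult)
    also have "\<rho> (inv a) *v (\<rho> a *v cpt c) = cpt c" for c using \<rho>_inv_apply[OF ac] by metis
    finally show ?thesis using kc ac by (simp add: H_cpt_iff)
  qed
  obtain P where P: "P \<in> carrier_mat n n" "det P \<noteq> 0" "\<And>h. h \<in> H \<Longrightarrow> \<sigma> h * P = P * \<sigma> (inv a \<otimes> h \<otimes> a)"
    using conj_intertwiner'[OF ac] by metis
  show ?thesis
    by (rule extend_index_two[OF compact_group_axioms stab_subgroup H_subgroup H_closed H_stab \<sigma> a ak H_conj[OF ac] P]) (assumption | rule that)+
qed

lemma stab_frames:
  obtains m A \<tau> where "\<And>i. i < (m::nat) \<Longrightarrow> cmat T n (A i)"
    "\<And>i g k. i < m \<Longrightarrow> g \<in> carrier G \<Longrightarrow> k \<in> stab (cpt b) \<Longrightarrow> A i (g \<otimes> k) = A i g * \<tau> k"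
    "\<And>k. k \<in> stab (cpt b) \<Longrightarrow> \<tau> k \<in> carrier_mat n n \<and> det (\<tau> k) \<noteq> 0"
    "\<And>h. h \<in> H \<Longrightarrow> \<tau> h = \<sigma> h"
    "\<And>g. g \<in> carrier G \<Longrightarrow> \<exists>i<m. det (A i g) \<noteq> 0"
proof -
  let ?K = "stab (cpt b)"
  obtain \<tau> where \<tau>: "complex_rep (G\<lparr>carrier := ?K\<rparr>) (subtopology T ?K) n \<tau>" "\<And>h. h \<in> H \<Longrightarrow> \<tau> h = \<sigma> h"
    using stab_extension by metis
  obtain m A where A: "\<And>i. i < (m::nat) \<Longrightarrow> cmat T n (A i)"
    "\<And>i g k. i < m \<Longrightarrow> g \<in> carrier G \<Longrightarrow> k \<in> ?K \<Longrightarrow> A i (g \<otimes> k) = A i g * \<tau> k"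
    "\<And>g. g \<in> carrier G \<Longrightarrow> \<exists>i<m. det (A i g) \<noteq> 0"
    by (rule equivariant_frames[OF compact_group_axioms Hausdorff stab_subgroup stab_closed \<tau>(1)]) (rule that)
  have "\<tau> k \<in> carrier_mat n n \<and> det (\<tau> k) \<noteq> 0" if k: "k \<in> ?K" for k
  proof -
    have c: "\<tau> k \<in> carrier_mat n n" "\<tau> (inv k) \<in> carrier_mat n n"
      using complex_repD(1)[OF \<tau>(1)] k subgroup.m_inv_closed[OF stab_subgroup k] by auto
    have "\<tau> k * \<tau> (inv k) = 1\<^sub>m n"
      using complex_rep_inv(1)[OF subgroup_imp_group[OF stab_subgroup] \<tau>(1), of k] k m_inv_consistent[OF stab_subgroup k] by simp
    then have "det (\<tau> k) * det (\<tau> (inv k)) = 1" using c by (simp add: det_mult[of _ n, symmetric])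
    then show ?thesis using c by auto
  qed
  from that[OF A(1,2) this \<tau>(2) A(3)] show ?thesis .
qed

text \<open>Angles of rotations and parameters of reflections, as real numbers and not modulo the
  full turn: \<open>\<Theta>\<close> becomes a closed subgroup of the line containing all full
  turns, and \<open>\<Psi>\<close> is empty or a single coset of it.\<close>

definition "\<Theta> = {a. \<exists>g\<in>carrier G. \<forall>b. \<rho> g *v cpt b = cpt (b + a)}"
definition "\<Psi> = {a. \<exists>g\<in>carrier G. \<forall>b. \<rho> g *v cpt b = cpt (a - b)}"

text \<open>The image of the compact group in the orthogonal matrices is compact, and
  \<open>\<Theta>\<close> is its preimage under the continuous map \<open>rot\<close>.\<close>

lemma \<Theta>_closed: "closed \<Theta>"
proof -
  have "compactin euclidean (\<rho> ` topspace T)"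
    using image_compactin[OF _ \<rho>_cont] compact by (auto simp: compact_space_def)
  then have "closed (\<rho> ` carrier G)" by (simp add: topspace_eq compact_imp_closed)
  then have "closed (rot -` (\<rho> ` carrier G))" by (rule continuous_closed_vimage) (use rot_cont[of UNIV] in \<open>simp add: continuous_on_eq_continuous_at\<close>)
  moreover have "rot -` (\<rho> ` carrier G) = \<Theta>"
  proof (intro equalityI subsetI)
    fix a assume "a \<in> rot -` (\<rho> ` carrier G)"
    then obtain g where g: "g \<in> carrier G" "rot a = \<rho> g" by auto
    have "\<forall>b. \<rho> g *v cpt b = cpt (b + a)" unfolding g(2)[symmetric] rot_cpt by simp
    then show "a \<in> \<Theta>" unfolding \<Theta>_def using g(1) by blast
  next
    fix a assume "a \<in> \<Theta>"
    then obtain g where "g \<in> carrier G" "\<And>b. \<rho> g *v cpt b = cpt (b + a)" unfolding \<Theta>_def by blast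
    then have "\<rho> g = rot a" by (intro matrix_eq_on_cpt) (simp add: rot_cpt)
    then have "rot a = \<rho> g" by simp
    then show "a \<in> rot -` (\<rho> ` carrier G)" using \<open>g \<in> carrier G\<close> by simp
  qed
  ultimately show ?thesis by simp
qed

lemma \<Theta>_add: "a \<in> \<Theta> \<Longrightarrow> b \<in> \<Theta> \<Longrightarrow> a + b \<in> \<Theta>"
proof -
  assume "a \<in> \<Theta>" "b \<in> \<Theta>"
  then obtain g h where gh: "g \<in> carrier G" "\<And>c. \<rho> g *v cpt c = cpt (c + a)" "h \<in> carrier G" "\<And>c. \<rho> h *v cpt c = cpt (c + b)"
    unfolding \<Theta>_def by blast
  then have "\<rho> (g \<otimes> h) *v cpt c = cpt (c + (a + b))" for c by (simp add: \<rho>_apply_mult algebra_simps)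
  then show ?thesis unfolding \<Theta>_def using gh by blast
qed

lemma \<Theta>_neg: "a \<in> \<Theta> \<Longrightarrow> - a \<in> \<Theta>"
proof -
  assume "a \<in> \<Theta>"
  then obtain g where g: "g \<in> carrier G" "\<And>c. \<rho> g *v cpt c = cpt (c + a)" unfolding \<Theta>_def by blast
  then have "\<rho> (inv g) *v cpt c = cpt (c + (- a))" for c using \<rho>_inv_apply[OF g(1), of "cpt (c - a)" "cpt c"] by simp
  then show ?thesis unfolding \<Theta>_def using g(1) by blast
qed

lemma \<Theta>_2pi: "2 * pi * of_int z \<in> \<Theta>"
proof -
  have "\<rho> \<one> *v cpt b = cpt (b + 2 * pi * of_int z)" for b
    unfolding \<rho>_one matrix_vector_mul_lid cpt_eq_iff by (rule exI[of _ "- z"]) simp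
  then show ?thesis unfolding \<Theta>_def using one_closed by blast
qed

lemma \<Psi>_\<Theta>: "a \<in> \<Psi> \<Longrightarrow> b \<in> \<Theta> \<Longrightarrow> a + b \<in> \<Psi>"
proof -
  assume "a \<in> \<Psi>" "b \<in> \<Theta>"
  then obtain g h where gh: "g \<in> carrier G" "\<And>c. \<rho> g *v cpt c = cpt (a - c)" "h \<in> carrier G" "\<And>c. \<rho> h *v cpt c = cpt (c + b)"
    unfolding \<Theta>_def \<Psi>_def by blast
  then have "\<rho> (h \<otimes> g) *v cpt c = cpt ((a + b) - c)" for c by (simp add: \<rho>_apply_mult algebra_simps)
  then show ?thesis unfolding \<Psi>_def using gh by blast
qed

lemma \<Psi>_\<Psi>: "a \<in> \<Psi> \<Longrightarrow> b \<in> \<Psi> \<Longrightarrow> a - b \<in> \<Theta>"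
proof -
  assume "a \<in> \<Psi>" "b \<in> \<Psi>"
  then obtain g h where gh: "g \<in> carrier G" "\<And>c. \<rho> g *v cpt c = cpt (a - c)" "h \<in> carrier G" "\<And>c. \<rho> h *v cpt c = cpt (b - c)"
    unfolding \<Psi>_def by blast
  then have "\<rho> (g \<otimes> h) *v cpt c = cpt (c + (a - b))" for c by (simp add: \<rho>_apply_mult algebra_simps)
  then show ?thesis unfolding \<Theta>_def using gh by blast
qed

lemma rotation_fixing:
  assumes "k \<in> carrier G" "\<And>b. \<rho> k *v cpt b = cpt (b + a)" "\<rho> k *v cpt c = cpt c"
  shows "k \<in> H"
proof -
  have "cpt (c + a) = cpt c" using assms(2,3) by metis
  then obtain z :: int where "a = 2 * pi * of_int z" unfolding cpt_eq_iff by auto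
  then have "cpt (b + a) = cpt b" for b unfolding cpt_eq_iff by blast
  then show ?thesis using assms(1,2) by (simp add: H_cpt_iff)
qed

abbreviation "I \<equiv> top_of_set {0..1::real}"

section \<open>Frames along a fundamental domain\<close>

lemma cmat_scaled:
  assumes "continuous_map I euclideanreal u" "cmat T n A"
  shows "cmat (prod_topology T I) n (\<lambda>(g, t). complex_of_real (u t) \<cdot>\<^sub>m A g)"
proof -
  have "continuous_map (prod_topology T I) euclideanreal (\<lambda>p. u (snd p))"
    using continuous_map_compose[OF continuous_map_snd assms(1)] by (simp add: o_def)
  from cmat_smult[OF continuous_map_of_real[OF this] cmat_compose[OF continuous_map_fst assms(2)]]
  show ?thesis by (simp add: case_prod_unfold)
qed

lemma circle_path: "continuous_on {0..1} (f :: real \<Rightarrow> real) \<Longrightarrow> continuous_map I circle (\<lambda>t. cpt (f t))"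
  unfolding circle_def
  by (rule continuous_map_into_subtopology)
    (auto intro!: continuous_on_compose2[OF cpt_cont[of UNIV]])

text \<open>The circle is one orbit, so the path is constant at \<open>cpt 0\<close>, the frames do
  not depend on \<open>t\<close>, and the only gluing condition is equivariance under the stabiliser
  of that point.\<close>

lemma exists_bundle_data_transitive:
  assumes "\<Theta> = UNIV" and j: "inj (j :: (real^2) \<times> (nat \<Rightarrow> complex vec) \<Rightarrow> 'e)"
  shows "\<exists>y m F. bundle_data G T \<rho> y m n F \<sigma> j"
proof -
  obtain m A \<tau> where A: "\<And>i. i < (m::nat) \<Longrightarrow> cmat T n (A i)"
    "\<And>i g k. i < m \<Longrightarrow> g \<in> carrier G \<Longrightarrow> k \<in> stab (cpt 0) \<Longrightarrow> A i (g \<otimes> k) = A i g * \<tau> k"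
    "\<And>k. k \<in> stab (cpt 0) \<Longrightarrow> \<tau> k \<in> carrier_mat n n \<and> det (\<tau> k) \<noteq> 0"
    "\<And>h. h \<in> H \<Longrightarrow> \<tau> h = \<sigma> h"
    "\<And>g. g \<in> carrier G \<Longrightarrow> \<exists>i<m. det (A i g) \<noteq> 0" by (rule stab_frames[of 0]) (rule that)
  have "bundle_data G T \<rho> (\<lambda>t. cpt 0) m n (\<lambda>i g t. A i g) \<sigma> j"
  proof
    show "Hausdorff_space T" "orthogonal_rep G T \<rho>" "inj j" by (fact Hausdorff rep j)+
    show "continuous_map I circle (\<lambda>t. cpt 0)" using circle_path[of "\<lambda>_. 0"] by simp
    show "cmat (prod_topology T I) n (\<lambda>(g, t). A i g)" if "i < m" for i
      using cmat_compose[OF continuous_map_fst A(1)[OF that]] by (simp add: case_prod_unfold)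
    show "\<exists>i<m. det (A i g) \<noteq> 0" if "g \<in> carrier G" for g by (rule A(5)[OF that])
    show "\<exists>C\<in>carrier_mat n n. det C \<noteq> 0 \<and> (\<forall>i<m. \<forall>g\<in>carrier G. A i (g \<otimes> k) = A i g * C)"
      if "k \<in> carrier G" "\<rho> k *v cpt 0 = cpt 0" for k
    proof -
      have k: "k \<in> stab (cpt 0)" using that by (simp add: stab_def)
      show ?thesis using A(2)[OF _ _ k] A(3)[OF k] by blast
    qed
    show "A i (g \<otimes> h) = A i g * \<sigma> h" if "i < m" "g \<in> carrier G" "h \<in> H" for i g h
      using A(2)[OF that(1,2)] A(4)[OF that(3)] H_stab that(3) by (metis subsetD)
    show "\<exists>g\<in>carrier G. \<exists>t\<in>{0..1::real}. \<rho> g *v cpt 0 = x" if xs: "x \<in> sphere 0 1" for x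
    proof -
      obtain a where x: "x = cpt a" using sphere_cpt[OF xs] by blast
      have "a \<in> \<Theta>" using assms by simp
      then obtain g where "g \<in> carrier G" "\<rho> g *v cpt 0 = cpt (0 + a)" unfolding \<Theta>_def by blast
      then show ?thesis using x by (intro bexI[of _ g] bexI[of _ 0]) auto
    qed
    show "\<sigma> h \<in> carrier_mat n n" if "h \<in> H" for h by (rule \<sigma>_carrier[OF that])
    show "\<exists>P\<in>carrier_mat n n. det P \<noteq> 0 \<and> (\<forall>h\<in>H. inv g \<otimes> h \<otimes> g \<in> H \<and> \<sigma> (inv g \<otimes> h \<otimes> g) * P = P * \<sigma> h)"
      if g: "g \<in> carrier G" for g
      by (rule conj_intertwiner[OF g]) (use H_conj[OF g] in blast)
  qed
  then show ?thesis by blast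
qed

end

lemma smult_zero_factor:
  fixes X Y C :: "complex mat"
  assumes "X \<in> carrier_mat n n" "Y \<in> carrier_mat n n" "C \<in> carrier_mat n n"
  shows "0 \<cdot>\<^sub>m X = 0 \<cdot>\<^sub>m Y * C"
proof -
  have "0 \<cdot>\<^sub>m X = 0\<^sub>m n n" "0 \<cdot>\<^sub>m Y = 0\<^sub>m n n" using assms by (auto intro!: eq_matI)
  then show ?thesis using assms(3) by (simp add: sq_zero)
qed

context circle_action begin

lemma conj_intertwiner_ex:
  assumes g: "g \<in> carrier G"
  shows "\<exists>P\<in>carrier_mat n n. det P \<noteq> 0 \<and> (\<forall>h\<in>H. inv g \<otimes> h \<otimes> g \<in> H \<and> \<sigma> (inv g \<otimes> h \<otimes> g) * P = P * \<sigma> h)"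
  by (rule conj_intertwiner[OF g]) (use H_conj[OF g] in blast)

text \<open>The segment from \<open>cpt \<phi>\<close> to \<open>cpt (\<phi> + d/2)\<close> is a fundamental domain. The frames
  belonging to its two end points are joined linearly along it.\<close>

lemma exists_bundle_data_dihedral:
  assumes d: "d > 0" "d \<in> \<Theta>" "\<And>a. a \<in> \<Theta> \<Longrightarrow> \<exists>z::int. a = of_int z * d" and \<phi>: "2 * \<phi> \<in> \<Psi>"
    and j: "inj (j :: (real^2) \<times> (nat \<Rightarrow> complex vec) \<Rightarrow> 'e)"
  shows "\<exists>y m F. bundle_data G T \<rho> y m n F \<sigma> j"
proof -
  \<comment> \<open>The far end of the arc. It lies on a reflection axis too, because
    \<open>2 * e = 2 * \<phi> + d\<close> and \<open>d\<close> is a rotation angle.\<close>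
  define e where "e = \<phi> + d / 2"
  define y where "y t = cpt (\<phi> + t * (d / 2))" for t :: real
  have y01: "y 0 = cpt \<phi>" "y 1 = cpt e" by (auto simp: y_def e_def)
  obtain m0 A \<tau> where A: "\<And>i. i < (m0::nat) \<Longrightarrow> cmat T n (A i)"
    "\<And>i g k. i < m0 \<Longrightarrow> g \<in> carrier G \<Longrightarrow> k \<in> stab (cpt \<phi>) \<Longrightarrow> A i (g \<otimes> k) = A i g * \<tau> k"
    "\<And>k. k \<in> stab (cpt \<phi>) \<Longrightarrow> \<tau> k \<in> carrier_mat n n \<and> det (\<tau> k) \<noteq> 0"
    "\<And>h. h \<in> H \<Longrightarrow> \<tau> h = \<sigma> h"
    "\<And>g. g \<in> carrier G \<Longrightarrow> \<exists>i<m0. det (A i g) \<noteq> 0" by (rule stab_frames[of \<phi>]) (rule that)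
  obtain m1 B \<upsilon> where B: "\<And>i. i < (m1::nat) \<Longrightarrow> cmat T n (B i)"
    "\<And>i g k. i < m1 \<Longrightarrow> g \<in> carrier G \<Longrightarrow> k \<in> stab (cpt e) \<Longrightarrow> B i (g \<otimes> k) = B i g * \<upsilon> k"
    "\<And>k. k \<in> stab (cpt e) \<Longrightarrow> \<upsilon> k \<in> carrier_mat n n \<and> det (\<upsilon> k) \<noteq> 0"
    "\<And>h. h \<in> H \<Longrightarrow> \<upsilon> h = \<sigma> h"
    "\<And>g. g \<in> carrier G \<Longrightarrow> \<exists>i<m1. det (B i g) \<noteq> 0" by (rule stab_frames[of e]) (rule that)
  define F where "F i g t = (if i < m0 then complex_of_real (1 - t) \<cdot>\<^sub>m A i g else complex_of_real t \<cdot>\<^sub>m B (i - m0) g)"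
    for i :: nat and g and t :: real
  have Ac: "A i g \<in> carrier_mat n n" if "i < m0" "g \<in> carrier G" for i g
    using cmat_carrier[OF A(1)] that by (simp add: topspace_eq)
  have Bc: "B i g \<in> carrier_mat n n" if "i < m1" "g \<in> carrier G" for i g
    using cmat_carrier[OF B(1)] that by (simp add: topspace_eq)
  have FH: "F i (g \<otimes> h) t = F i g t * \<sigma> h" if "i < m0 + m1" "g \<in> carrier G" "h \<in> H" for i g h t
  proof (cases "i < m0")
    case True
    have "A i (g \<otimes> h) = A i g * \<sigma> h" using A(2)[OF True that(2)] A(4)[OF that(3)] H_stab that(3) by (metis subsetD)
    then show ?thesis using True Ac[OF True that(2)] \<sigma>_carrier[OF that(3)] by (simp add: F_def sq_distribs[of _ n])
  next
    case False
    then have i: "i - m0 < m1" using that(1) by simp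
    have "B (i - m0) (g \<otimes> h) = B (i - m0) g * \<sigma> h" using B(2)[OF i that(2)] B(4)[OF that(3)] H_stab that(3) by (metis subsetD)
    then show ?thesis using False Bc[OF i that(2)] \<sigma>_carrier[OF that(3)] by (simp add: F_def sq_distribs[of _ n])
  qed
  have half: "\<exists>z::int. s = 2 * of_int z" if s: "s * (d / 2) \<in> \<Theta>" for s
  proof -
    obtain z :: int where "s * (d / 2) = of_int z * d" using d(3)[OF s] by blast
    then have "s = 2 * of_int z" using d(1) by (simp add: field_simps)
    then show ?thesis by blast
  qed
  \<comment> \<open>Rotations change the parameter by an even integer, hence not at all. A
    reflection makes \<open>t + t'\<close> an even integer between 0 and 2, so both parameters are 0
    or both are 1. Thus distinct points of the arc lie in distinct orbits, and inside the arc the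
    stabiliser is \<open>H\<close>.\<close>
  have fix_pt: "t = t' \<and> (0 < t \<and> t < 1 \<longrightarrow> k \<in> H)"
    if k: "k \<in> carrier G" and t: "t \<in> {0..1}" "t' \<in> {0..1}" and eq: "\<rho> k *v y t' = y t" for k t t'
  proof (rule \<rho>_cases[OF k])
    fix a assume a: "\<And>b. \<rho> k *v cpt b = cpt (b + a)"
    then have "a \<in> \<Theta>" using k by (auto simp: \<Theta>_def)
    have "cpt (\<phi> + t' * (d / 2) + a) = cpt (\<phi> + t * (d / 2))" using eq a by (simp add: y_def)
    then obtain z :: int where "\<phi> + t' * (d / 2) + a = \<phi> + t * (d / 2) + 2 * pi * of_int z"
      unfolding cpt_eq_iff by blast
    then have eq': "(t - t') * (d / 2) = a + - (2 * pi * of_int z)" by (simp add: field_simps)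
    have "(t - t') * (d / 2) \<in> \<Theta>" unfolding eq' by (rule \<Theta>_add[OF \<open>a \<in> \<Theta>\<close> \<Theta>_neg[OF \<Theta>_2pi]])
    then obtain w :: int where "t - t' = 2 * of_int w" using half by blast
    then have "w = 0" using t by (auto simp: abs_if)
    then have tt: "t = t'" using \<open>t - t' = 2 * of_int w\<close> by simp
    then have "k \<in> H" using rotation_fixing[OF k a] eq by (simp add: y_def)
    then show ?thesis using tt by simp
  next
    fix a assume a: "\<And>b. \<rho> k *v cpt b = cpt (a - b)"
    then have "a \<in> \<Psi>" using k by (auto simp: \<Psi>_def)
    then have a\<phi>: "a - 2 * \<phi> \<in> \<Theta>" using \<Psi>_\<Psi> \<phi> by blast
    have "cpt (a - (\<phi> + t' * (d / 2))) = cpt (\<phi> + t * (d / 2))" using eq a by (simp add: y_def)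
    then obtain z :: int where "a - (\<phi> + t' * (d / 2)) = \<phi> + t * (d / 2) + 2 * pi * of_int z"
      unfolding cpt_eq_iff by blast
    then have eq': "(t + t') * (d / 2) = (a - 2 * \<phi>) + - (2 * pi * of_int z)" by (simp add: field_simps)
    have "(t + t') * (d / 2) \<in> \<Theta>" unfolding eq' by (rule \<Theta>_add[OF a\<phi> \<Theta>_neg[OF \<Theta>_2pi]])
    then obtain w :: int where w: "t + t' = 2 * of_int w" using half by blast
    then have "0 \<le> w" "w \<le> 1" using t by auto
    then have "w = 0 \<or> w = 1" by linarith
    then show ?thesis using w t by auto
  qed
  have "bundle_data G T \<rho> y (m0 + m1) n F \<sigma> j"
  proof
    show "Hausdorff_space T" "orthogonal_rep G T \<rho>" "inj j" by (fact Hausdorff rep j)+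
    show "continuous_map I circle y" unfolding y_def by (intro circle_path continuous_intros)
    show "cmat (prod_topology T I) n (\<lambda>(g, t). F i g t)" if "i < m0 + m1" for i
    proof (cases "i < m0")
      case True
      have "cmat (prod_topology T I) n (\<lambda>(g, t). complex_of_real (1 - t) \<cdot>\<^sub>m A i g)"
        by (rule cmat_scaled[OF _ A(1)[OF True]]) (auto intro!: continuous_intros)
      then show ?thesis using True by (simp add: F_def)
    next
      case False
      then have i: "i - m0 < m1" using that by simp
      have "cmat (prod_topology T I) n (\<lambda>(g, t). complex_of_real t \<cdot>\<^sub>m B (i - m0) g)"
        by (rule cmat_scaled[OF _ B(1)[OF i]]) (auto intro!: continuous_intros)
      then show ?thesis using False by (simp add: F_def)
    qed
    show "\<exists>i<m0 + m1. det (F i g t) \<noteq> 0" if g: "g \<in> carrier G" for g t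
    proof (cases "t = 1")
      case True
      obtain i where i: "i < m1" "det (B i g) \<noteq> 0" using B(5)[OF g] by blast
      then have "det (F (m0 + i) g t) \<noteq> 0" using True by (simp add: F_def)
      then show ?thesis using i(1) by (intro exI[of _ "m0 + i"]) simp
    next
      case False
      obtain i where i: "i < m0" "det (A i g) \<noteq> 0" using A(5)[OF g] by blast
      have "complex_of_real (1 - t) \<noteq> 0" using False unfolding of_real_eq_0_iff by simp
      then have "det (F i g t) \<noteq> 0" using i by (simp add: F_def del: of_real_diff)
      then show ?thesis using i(1) by (intro exI[of _ i]) simp
    qed
    show "\<exists>C\<in>carrier_mat n n. det C \<noteq> 0 \<and> (\<forall>i<m0 + m1. \<forall>g\<in>carrier G. F i (g \<otimes> k) t' = F i g t * C)"
      if k: "k \<in> carrier G" and t: "t \<in> {0..1}" "t' \<in> {0..1}" and eq: "\<rho> k *v y t' = y t" for k t t'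
    proof -
      have tt: "t = t'" and int: "0 < t \<Longrightarrow> t < 1 \<Longrightarrow> k \<in> H" using fix_pt[OF k t eq] by auto
      consider "t = 0" | "t = 1" | "0 < t" "t < 1" using t(1) by fastforce
      then show ?thesis
      proof cases
        case 1
        have ks: "k \<in> stab (cpt \<phi>)" using k eq tt 1 y01 by (simp add: stab_def)
        note C = A(3)[OF ks]
        \<comment> \<open>At this end all blocks coming from the other end are zero, so they satisfy
          the equation with \<open>\<tau> k\<close> although they were built from the unrelated
          extension \<open>\<upsilon>\<close>.\<close>
        have "F i (g \<otimes> k) t' = F i g t * \<tau> k" if "i < m0 + m1" "g \<in> carrier G" for i g
        proof (cases "i < m0")
          case True
          then show ?thesis using A(2)[OF True that(2) ks] Ac[OF True that(2)] C tt 1 by (simp add: F_def sq_distribs[of _ n])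
        next
          case False
          then have i: "i - m0 < m1" using that(1) by simp
          show ?thesis using False tt 1 smult_zero_factor[OF Bc[OF i m_closed[OF that(2) k]] Bc[OF i that(2)]] C by (simp add: F_def)
        qed
        then show ?thesis using C by blast
      next
        case 2
        have ks: "k \<in> stab (cpt e)" using k eq tt 2 y01 by (simp add: stab_def)
        note C = B(3)[OF ks]
        have "F i (g \<otimes> k) t' = F i g t * \<upsilon> k" if "i < m0 + m1" "g \<in> carrier G" for i g
        proof (cases "i < m0")
          case True
          show ?thesis using True tt 2 smult_zero_factor[OF Ac[OF True m_closed[OF that(2) k]] Ac[OF True that(2)]] C by (simp add: F_def)
        next
          case False
          then have i: "i - m0 < m1" using that(1) by simp
          then show ?thesis using False B(2)[OF i that(2) ks] Bc[OF i that(2)] C tt 2 by (simp add: F_def sq_distribs[of _ n])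
        qed
        then show ?thesis using C by blast
      next
        case 3
        then have kH: "k \<in> H" using int by blast
        then have "k \<in> stab (cpt \<phi>)" using H_stab by blast
        then have "\<sigma> k \<in> carrier_mat n n \<and> det (\<sigma> k) \<noteq> 0" using A(3) A(4)[OF kH] by metis
        then show ?thesis using FH[OF _ _ kH] tt by blast
      qed
    qed
    show "F i (g \<otimes> h) t = F i g t * \<sigma> h" if "i < m0 + m1" "g \<in> carrier G" "h \<in> H" for i g h t
      by (rule FH[OF that])
    show "\<exists>g\<in>carrier G. \<exists>t\<in>{0..1}. \<rho> g *v y t = x" if xs: "x \<in> sphere 0 1" for x
    proof -
      obtain b where x: "x = cpt b" using sphere_cpt[OF xs] by blast
      \<comment> \<open>Rounding \<open>u\<close> to the nearest integer \<open>z\<close> leaves a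
        parameter \<open>t\<close> between -1 and 1. A rotation handles nonnegative
        \<open>t\<close>; for negative \<open>t\<close> the reflection with parameter
        \<open>2 * \<phi> + of_int z * d\<close> takes the point with parameter \<open>- t\<close>
        to \<open>x\<close>.\<close>
      define u where "u = (b - \<phi>) / d"
      define z where "z = \<lfloor>u + 1/2\<rfloor>"
      define t where "t = 2 * (u - of_int z)"
      have "of_int z \<le> u + 1/2" "u + 1/2 < of_int z + 1" unfolding z_def by linarith+
      then have t: "-1 \<le> t" "t \<le> 1" unfolding t_def by auto
      have b: "b = \<phi> + t * (d / 2) + of_int z * d" using d(1) by (simp add: t_def u_def field_simps)
      have zd: "of_int z * d \<in> \<Theta>"
      proof -
        have "of_nat k * d \<in> \<Theta>" for k :: nat
          using \<Theta>_2pi[of 0] by (induction k) (auto simp: algebra_simps intro: \<Theta>_add d(2))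
        then have "of_nat (nat z) * d \<in> \<Theta>" "- (of_nat (nat (- z)) * d) \<in> \<Theta>" using \<Theta>_neg by blast+
        then show ?thesis by (cases "z \<ge> 0") auto
      qed
      show ?thesis
      proof (cases "t \<ge> 0")
        case True
        obtain g where g: "g \<in> carrier G" "\<And>b. \<rho> g *v cpt b = cpt (b + of_int z * d)" using zd unfolding \<Theta>_def by blast
        have "\<rho> g *v y t = x" unfolding y_def g(2) x b ..
        then show ?thesis using g(1) True t by (intro bexI[of _ g] bexI[of _ t]) auto
      next
        case False
        have "2 * \<phi> + of_int z * d \<in> \<Psi>" by (rule \<Psi>_\<Theta>[OF \<phi> zd])
        then obtain g where g: "g \<in> carrier G" "\<And>b. \<rho> g *v cpt b = cpt (2 * \<phi> + of_int z * d - b)" unfolding \<Psi>_def by blast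
        have "\<rho> g *v y (- t) = x" unfolding y_def g(2) x b by (rule arg_cong[where f = cpt]) (simp add: algebra_simps)
        then show ?thesis using g(1) False t by (intro bexI[of _ g] bexI[of _ "- t"]) auto
      qed
    qed
    show "\<sigma> h \<in> carrier_mat n n" if "h \<in> H" for h by (rule \<sigma>_carrier[OF that])
  qed (rule conj_intertwiner_ex)
  then show ?thesis by blast
qed

text \<open>Without reflections the arc from \<open>cpt 0\<close> to \<open>cpt d\<close> is a fundamental domain up to the
  identification of its end points by the rotation \<open>\<alpha>\<close>; the last \<open>m\<close> blocks keep the frame
  injective inside the arc.\<close>

lemma exists_bundle_data_cyclic:
  assumes d: "d > 0" "d \<in> \<Theta>" "\<And>a. a \<in> \<Theta> \<Longrightarrow> \<exists>z::int. a = of_int z * d" and no_refl: "\<Psi> = {}"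
    and j: "inj (j :: (real^2) \<times> (nat \<Rightarrow> complex vec) \<Rightarrow> 'e)"
  shows "\<exists>y m F. bundle_data G T \<rho> y m n F \<sigma> j"
proof -
  obtain \<alpha> where \<alpha>: "\<alpha> \<in> carrier G" "\<And>b. \<rho> \<alpha> *v cpt b = cpt (b + d)" using d(2) unfolding \<Theta>_def by blast
  obtain P where P: "P \<in> carrier_mat n n" "det P \<noteq> 0" "\<And>h. h \<in> H \<Longrightarrow> \<sigma> h * P = P * \<sigma> (inv \<alpha> \<otimes> h \<otimes> \<alpha>)"
    by (rule conj_intertwiner'[OF \<alpha>(1)]) (rule that)
  note mi = minv[OF P(1,2)]
  have dmi: "det (minv P) \<noteq> 0"
  proof -
    have "det P * det (minv P) = 1" using mi P(1) by (simp add: det_mult[of _ n, symmetric])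
    then show ?thesis by auto
  qed
  obtain m A \<tau> where A: "\<And>i. i < (m::nat) \<Longrightarrow> cmat T n (A i)"
    "\<And>i g k. i < m \<Longrightarrow> g \<in> carrier G \<Longrightarrow> k \<in> stab (cpt 0) \<Longrightarrow> A i (g \<otimes> k) = A i g * \<tau> k"
    "\<And>k. k \<in> stab (cpt 0) \<Longrightarrow> \<tau> k \<in> carrier_mat n n \<and> det (\<tau> k) \<noteq> 0"
    "\<And>h. h \<in> H \<Longrightarrow> \<tau> h = \<sigma> h"
    "\<And>g. g \<in> carrier G \<Longrightarrow> \<exists>i<m. det (A i g) \<noteq> 0" by (rule stab_frames[of 0]) (rule that)
  have Ac: "A i g \<in> carrier_mat n n" if "i < m" "g \<in> carrier G" for i g
    using cmat_carrier[OF A(1)] that by (simp add: topspace_eq)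
  have AH: "A i (g \<otimes> h) = A i g * \<sigma> h" if "i < m" "g \<in> carrier G" "h \<in> H" for i g h
    using A(2)[OF that(1,2)] A(4)[OF that(3)] H_stab that(3) by (metis subsetD)
  have \<sigma>_inv: "det (\<sigma> h) \<noteq> 0" if h: "h \<in> H" for h
  proof -
    have "h \<in> stab (cpt 0)" using H_stab h by blast
    then show ?thesis using A(3) A(4)[OF h] by metis
  qed
  \<comment> \<open>The frame seen from the other end of the arc. Translation by
    \<open>\<alpha>\<close> alone would make \<open>H\<close> act through the conjugate of
    \<open>\<sigma>\<close>; the factor \<open>minv P\<close> restores \<open>\<sigma>\<close>
    itself.\<close>
  define A' where "A' i g = A i (g \<otimes> \<alpha>) * minv P" for i g
  have A'c: "A' i g \<in> carrier_mat n n" if "i < m" "g \<in> carrier G" for i g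
    using Ac[OF that(1) m_closed[OF that(2) \<alpha>(1)]] mi(1) by (simp add: A'_def)
  have A'H: "A' i (g \<otimes> h) = A' i g * \<sigma> h" if "i < m" "g \<in> carrier G" "h \<in> H" for i g h
  proof -
    let ?h = "inv \<alpha> \<otimes> h \<otimes> \<alpha>"
    note c = Ac[OF that(1) m_closed[OF that(2) \<alpha>(1)]] \<sigma>_carrier[OF H_conj[OF \<alpha>(1) that(3)]] \<sigma>_carrier[OF that(3)]
    have "g \<otimes> h \<otimes> \<alpha> = (g \<otimes> \<alpha>) \<otimes> ?h" using that \<alpha>(1) H_carrier[OF that(3)] by (simp add: m_assoc inv_cancel)
    then have "A' i (g \<otimes> h) = A i (g \<otimes> \<alpha>) * \<sigma> ?h * minv P"
      unfolding A'_def using AH[OF that(1) m_closed[OF that(2) \<alpha>(1)] H_conj[OF \<alpha>(1) that(3)]] by simp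
    also have "\<dots> = A i (g \<otimes> \<alpha>) * (\<sigma> ?h * minv P)" by (rule sq_assoc[OF c(1,2) mi(1)])
    also have "\<sigma> ?h * minv P = minv P * \<sigma> h" by (rule minv_intertwine[OF P(1,2) c(3,2) P(3)[OF that(3)]])
    also have "A i (g \<otimes> \<alpha>) * (minv P * \<sigma> h) = A' i g * \<sigma> h" unfolding A'_def by (rule sq_assoc[OF c(1) mi(1) c(3), symmetric])
    finally show ?thesis .
  qed
  \<comment> \<open>The values of \<open>(u0, u1, u2)\<close> are \<open>(1, 0, 0)\<close> at 0 and
    \<open>(0, 1, 0)\<close> at 1, so the first blocks carry \<open>A\<close> at one end and
    \<open>A'\<close> at the other. Between them \<open>u2\<close> is positive, and the separate
    blocks it scales spare any question whether combinations of \<open>A\<close> and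
    \<open>A'\<close> are singular.\<close>
  define u0 u1 u2 :: "real \<Rightarrow> real" where "u0 t = max 0 (1 - 2 * t)" and "u1 t = max 0 (2 * t - 1)" and "u2 t = t * (1 - t)" for t
  define F where "F i g t = (if i < m then complex_of_real (u0 t) \<cdot>\<^sub>m A i g + complex_of_real (u1 t) \<cdot>\<^sub>m A' i g
      else complex_of_real (u2 t) \<cdot>\<^sub>m A (i - m) g)" for i :: nat and g and t :: real
  have F0: "F i g 0 = (if i < m then A i g else 0 \<cdot>\<^sub>m A (i - m) g)" if "i < m + m" "g \<in> carrier G" for i g
  proof -
    have "1 \<cdot>\<^sub>m A i g + 0 \<cdot>\<^sub>m A' i g = A i g" if "i < m"
      using Ac[OF that \<open>g \<in> carrier G\<close>] A'c[OF that \<open>g \<in> carrier G\<close>] by (intro eq_matI) auto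
    then show ?thesis by (simp add: F_def u0_def u1_def u2_def)
  qed
  have F1: "F i g 1 = (if i < m then A' i g else 0 \<cdot>\<^sub>m A (i - m) g)" if "i < m + m" "g \<in> carrier G" for i g
  proof -
    have "0 \<cdot>\<^sub>m A i g + 1 \<cdot>\<^sub>m A' i g = A' i g" if "i < m"
      using Ac[OF that \<open>g \<in> carrier G\<close>] A'c[OF that \<open>g \<in> carrier G\<close>] by (intro eq_matI) auto
    then show ?thesis by (simp add: F_def u0_def u1_def u2_def)
  qed
  have FH: "F i (g \<otimes> h) t = F i g t * \<sigma> h" if "i < m + m" "g \<in> carrier G" "h \<in> H" for i g h t
  proof (cases "i < m")
    case True
    then show ?thesis using AH[OF True that(2,3)] A'H[OF True that(2,3)] Ac[OF True that(2)] A'c[OF True that(2)] \<sigma>_carrier[OF that(3)]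
      by (simp add: F_def sq_distribs[of _ n])
  next
    case False
    then have i: "i - m < m" using that(1) by simp
    then show ?thesis using False AH[OF i that(2,3)] Ac[OF i that(2)] \<sigma>_carrier[OF that(3)] by (simp add: F_def sq_distribs[of _ n])
  qed
  define y where "y t = cpt (t * d)" for t :: real
  have glue10: "\<exists>C\<in>carrier_mat n n. det C \<noteq> 0 \<and> (\<forall>i<m + m. \<forall>g\<in>carrier G. F i (g \<otimes> k) 0 = F i g 1 * C)"
    if k: "k \<in> carrier G" and eq: "\<rho> k *v y 0 = y 1" for k
  proof -
    define h where "h = inv \<alpha> \<otimes> k"
    have hc: "h \<in> carrier G" using k \<alpha>(1) by (simp add: h_def)
    have k': "k = \<alpha> \<otimes> h" using k \<alpha>(1) by (simp add: h_def inv_cancel)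
    have "\<rho> \<alpha> *v y 0 = y 1" using \<alpha>(2)[of 0] by (simp add: y_def)
    then have "y 0 = \<rho> (inv \<alpha>) *v y 1" using \<rho>_inv_apply[OF \<alpha>(1)] by blast
    then have fx: "\<rho> h *v cpt 0 = cpt 0" unfolding h_def using k \<alpha>(1) eq by (simp add: \<rho>_apply_mult y_def)
    have "h \<in> H"
    proof (rule \<rho>_cases[OF hc])
      show "h \<in> H" if "\<And>b. \<rho> h *v cpt b = cpt (b + a)" for a by (rule rotation_fixing[OF hc that fx])
      show "h \<in> H" if "\<And>b. \<rho> h *v cpt b = cpt (a - b)" for a using no_refl hc that unfolding \<Psi>_def by blast
    qed
    note s = \<sigma>_carrier[OF this]
    \<comment> \<open>The factor \<open>P\<close> cancels the \<open>minv P\<close> inside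
      \<open>A'\<close>, and \<open>\<sigma> h\<close> accounts for the difference between
      \<open>k\<close> and \<open>\<alpha>\<close>.\<close>
    define C where "C = P * \<sigma> h"
    have C: "C \<in> carrier_mat n n" "det C \<noteq> 0" using P s \<sigma>_inv[OF \<open>h \<in> H\<close>] by (auto simp: C_def det_mult[of _ n])
    have "F i (g \<otimes> k) 0 = F i g 1 * C" if i: "i < m + m" and g: "g \<in> carrier G" for i g
    proof (cases "i < m")
      case True
      note a = Ac[OF True m_closed[OF g \<alpha>(1)]]
      have "A' i g * C = A i (g \<otimes> \<alpha>) * (minv P * (P * \<sigma> h))" unfolding A'_def C_def
        by (rule sq_assoc[OF a mi(1)]) (use P(1) s in simp)
      also have "minv P * (P * \<sigma> h) = \<sigma> h" by (rule sq_cancel[OF mi(3,1) P(1) s])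
      also have "A i (g \<otimes> \<alpha>) * \<sigma> h = A i (g \<otimes> k)"
        using AH[OF True m_closed[OF g \<alpha>(1)] \<open>h \<in> H\<close>] g \<alpha>(1) hc by (simp add: k' m_assoc)
      finally show ?thesis using F0[OF i m_closed[OF g k]] F1[OF i g] True by simp
    next
      case False
      then have i': "i - m < m" using i by simp
      show ?thesis using F0[OF i m_closed[OF g k]] F1[OF i g] False
          smult_zero_factor[OF Ac[OF i' m_closed[OF g k]] Ac[OF i' g] C(1)] by simp
    qed
    then show ?thesis using C by blast
  qed
  have "bundle_data G T \<rho> y (m + m) n F \<sigma> j"
  proof
    show "Hausdorff_space T" "orthogonal_rep G T \<rho>" "inj j" by (fact Hausdorff rep j)+
    show "continuous_map I circle y" unfolding y_def by (intro circle_path continuous_intros)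
    show "cmat (prod_topology T I) n (\<lambda>(g, t). F i g t)" if "i < m + m" for i
    proof (cases "i < m")
      case True
      have "continuous_map T T (\<lambda>g. g \<otimes> \<alpha>)"
        by (intro continuous_map_mult continuous_map_const_carrier continuous_map_id[unfolded id_def] \<alpha>)
      from cmat_mult[OF cmat_compose[OF this A(1)[OF True]] cmat_const[OF mi(1)]]
      have A': "cmat T n (A' i)" by (simp add: A'_def[abs_def])
      have 0: "cmat (prod_topology T I) n (\<lambda>(g, t). complex_of_real (u0 t) \<cdot>\<^sub>m A i g)"
        by (rule cmat_scaled[OF _ A(1)[OF True]]) (auto intro!: continuous_intros simp: u0_def)
      have 1: "cmat (prod_topology T I) n (\<lambda>(g, t). complex_of_real (u1 t) \<cdot>\<^sub>m A' i g)"
        by (rule cmat_scaled[OF _ A']) (auto intro!: continuous_intros simp: u1_def)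
      from cmat_add[OF 0 1] show ?thesis using True by (simp add: F_def case_prod_unfold)
    next
      case False
      then have i: "i - m < m" using that by simp
      have "cmat (prod_topology T I) n (\<lambda>(g, t). complex_of_real (u2 t) \<cdot>\<^sub>m A (i - m) g)"
        by (rule cmat_scaled[OF _ A(1)[OF i]]) (auto intro!: continuous_intros simp: u2_def)
      then show ?thesis using False by (simp add: F_def)
    qed
    show "\<exists>i<m + m. det (F i g t) \<noteq> 0" if g: "g \<in> carrier G" and t: "t \<in> {0..1}" for g t
    proof -
      consider "t = 0" | "t = 1" | "0 < t" "t < 1" using t by fastforce
      then show ?thesis
      proof cases
        case 1
        obtain i where i: "i < m" "det (A i g) \<noteq> 0" using A(5)[OF g] by blast
        then show ?thesis using F0[of i g] g 1 by (intro exI[of _ i]) simp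
      next
        case 2
        obtain i where i: "i < m" "det (A i (g \<otimes> \<alpha>)) \<noteq> 0" using A(5)[OF m_closed[OF g \<alpha>(1)]] by blast
        then have "det (A' i g) \<noteq> 0"
          using det_mult[OF Ac[OF i(1) m_closed[OF g \<alpha>(1)]] mi(1)] dmi by (simp add: A'_def)
        then show ?thesis using F1[of i g] g 2 i(1) by (intro exI[of _ i]) simp
      next
        case 3
        obtain i where i: "i < m" "det (A i g) \<noteq> 0" using A(5)[OF g] by blast
        have "complex_of_real (u2 t) \<noteq> 0" using 3 unfolding u2_def of_real_eq_0_iff by simp
        then have "det (F (m + i) g t) \<noteq> 0" using i by (simp add: F_def)
        then show ?thesis using i(1) by (intro exI[of _ "m + i"]) simp
      qed
    qed
    show "\<exists>C\<in>carrier_mat n n. det C \<noteq> 0 \<and> (\<forall>i<m + m. \<forall>g\<in>carrier G. F i (g \<otimes> k) t' = F i g t * C)"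
      if k: "k \<in> carrier G" and t: "t \<in> {0..1}" "t' \<in> {0..1}" and eq: "\<rho> k *v y t' = y t" for k t t'
    proof (rule \<rho>_cases[OF k])
      fix a assume "\<And>b. \<rho> k *v cpt b = cpt (a - b)"
      then show ?thesis using no_refl k unfolding \<Psi>_def by blast
    next
      fix a assume a: "\<And>b. \<rho> k *v cpt b = cpt (b + a)"
      then have "a \<in> \<Theta>" using k by (auto simp: \<Theta>_def)
      have "cpt (t' * d + a) = cpt (t * d)" using eq a by (simp add: y_def)
      then obtain z :: int where "t' * d + a = t * d + 2 * pi * of_int z" unfolding cpt_eq_iff by blast
      then have eq': "(t - t') * d = a + - (2 * pi * of_int z)" by (simp add: algebra_simps)
      have "(t - t') * d \<in> \<Theta>" unfolding eq' by (rule \<Theta>_add[OF \<open>a \<in> \<Theta>\<close> \<Theta>_neg[OF \<Theta>_2pi]])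
      then obtain w :: int where "(t - t') * d = of_int w * d" using d(3) by blast
      then have w: "t - t' = of_int w" using d(1) by simp
      then have "real_of_int w \<le> 1" "-1 \<le> real_of_int w" using t by auto
      then have "w = 0 \<or> w = 1 \<or> w = -1" by linarith
      then consider "t = t'" | "t = 1" "t' = 0" | "t = 0" "t' = 1" using w t by fastforce
      then show ?thesis
      proof cases
        case 1
        have kH: "k \<in> H" using rotation_fixing[OF k a, of "t * d"] eq 1 by (simp add: y_def)
        then show ?thesis using FH[OF _ _ kH] \<sigma>_carrier[OF kH] \<sigma>_inv[OF kH] 1 by blast
      next
        case 2
        then show ?thesis using glue10[OF k] eq by simp
      next
        case 3
        \<comment> \<open>The reverse identification of the ends is obtained from
          \<open>glue10\<close> for the inverse of \<open>k\<close>, by inverting its matrix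
          \<open>C\<close>.\<close>
        have "\<rho> (inv k) *v y 0 = y 1" using \<rho>_inv_apply[OF k, of "y 1" "y 0"] eq 3 by simp
        from glue10[OF inv_closed[OF k] this]
        obtain C where C: "C \<in> carrier_mat n n" "det C \<noteq> 0"
          and FC: "\<And>i g. i < m + m \<Longrightarrow> g \<in> carrier G \<Longrightarrow> F i (g \<otimes> inv k) 0 = F i g 1 * C" by blast
        note ci = minv[OF C]
        have "F i (g \<otimes> k) 1 = F i g 0 * minv C" if i: "i < m + m" and g: "g \<in> carrier G" for i g
        proof -
          have Fc: "F i (g \<otimes> k) 1 \<in> carrier_mat n n"
            using F1[OF i m_closed[OF g k]] Ac[of "i - m"] A'c[of i] i g k by (cases "i < m") auto
          have "F i g 0 = F i (g \<otimes> k) 1 * C" using FC[OF i m_closed[OF g k]] g k by (simp add: m_assoc)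
          then have "F i g 0 * minv C = F i (g \<otimes> k) 1 * (C * minv C)" using sq_assoc[OF Fc C(1) ci(1)] by simp
          then show ?thesis unfolding ci(2) using Fc by (simp add: sq_one)
        qed
        moreover have "det (minv C) \<noteq> 0"
        proof -
          have "det C * det (minv C) = 1" using ci C(1) by (simp add: det_mult[of _ n, symmetric])
          then show ?thesis by auto
        qed
        ultimately show ?thesis using ci(1) 3 by blast
      qed
    qed
    show "F i (g \<otimes> h) t = F i g t * \<sigma> h" if "i < m + m" "g \<in> carrier G" "h \<in> H" for i g h t
      by (rule FH[OF that])
    show "\<exists>g\<in>carrier G. \<exists>t\<in>{0..1}. \<rho> g *v y t = x" if xs: "x \<in> sphere 0 1" for x
    proof -
      obtain b where x: "x = cpt b" using sphere_cpt[OF xs] by blast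
      \<comment> \<open>Reduction modulo \<open>d\<close>: the integer part of \<open>b / d\<close>
        is a rotation, and the fractional part is the parameter on the arc.\<close>
      define z where "z = \<lfloor>b / d\<rfloor>"
      define t where "t = b / d - of_int z"
      have t: "0 \<le> t" "t \<le> 1" unfolding t_def z_def by linarith+
      have b: "b = t * d + of_int z * d" using d(1) by (simp add: t_def field_simps)
      have zd: "of_int z * d \<in> \<Theta>"
      proof -
        have "of_nat k * d \<in> \<Theta>" for k :: nat
          using \<Theta>_2pi[of 0] by (induction k) (auto simp: algebra_simps intro: \<Theta>_add d(2))
        then have "of_nat (nat z) * d \<in> \<Theta>" "- (of_nat (nat (- z)) * d) \<in> \<Theta>" using \<Theta>_neg by blast+
        then show ?thesis by (cases "z \<ge> 0") auto
      qed
      obtain g where g: "g \<in> carrier G" "\<And>b. \<rho> g *v cpt b = cpt (b + of_int z * d)" using zd unfolding \<Theta>_def by blast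
      have "\<rho> g *v y t = x" unfolding y_def g(2) x b ..
      then show ?thesis using g(1) t by (intro bexI[of _ g] bexI[of _ t]) auto
    qed
    show "\<sigma> h \<in> carrier_mat n n" if "h \<in> H" for h by (rule \<sigma>_carrier[OF that])
  qed (rule conj_intertwiner_ex)
  then show ?thesis by blast
qed

lemma exists_bundle:
  assumes j: "inj (j :: (real^2) \<times> (nat \<Rightarrow> complex vec) \<Rightarrow> 'e)"
  shows "\<exists>E :: ('g, 'e) equivariant_bundle. G_vector_bundle G T \<rho> E \<and> is_fiber_module H E n \<sigma>"
proof -
  have "2 * pi \<in> \<Theta>" using \<Theta>_2pi[of 1] by simp
  from closed_real_subgroup[OF \<Theta>_closed \<Theta>_add \<Theta>_neg this]
  consider "\<Theta> = UNIV" | d where "d > 0" "d \<in> \<Theta>" "\<And>a. a \<in> \<Theta> \<Longrightarrow> \<exists>z::int. a = of_int z * d" by auto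
  then have "\<exists>y m F. bundle_data G T \<rho> y m n F \<sigma> j"
  proof cases
    case 1 then show ?thesis by (rule exists_bundle_data_transitive[OF _ j])
  next
    case d: 2
    show ?thesis
    proof (cases "\<Psi> = {}")
      case True then show ?thesis using exists_bundle_data_cyclic[OF d(1,2) _ _ j] d(3) by blast
    next
      case False
      then obtain a where "a \<in> \<Psi>" by blast
      \<comment> \<open>The axis of the reflection with parameter \<open>a\<close> has angle
        \<open>a / 2\<close>, which becomes the initial point of the arc.\<close>
      then have "2 * (a / 2) \<in> \<Psi>" by simp
      then show ?thesis using exists_bundle_data_dihedral[OF d(1,2) _ _ j] d(3) by blast
    qed
  qed
  then obtain y m F where "bundle_data G T \<rho> y m n F \<sigma> j" by blast
  then interpret b: bundle_data G T \<rho> y m n F \<sigma> j .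
  show ?thesis using b.E_G_bundle b.E_fiber_module by blast
qed

end

text \<open>A base point with a sequence of vectors is a countable family of reals. Each real is
  coded by a set of naturals, the family of these sets by one set of naturals via pairing, and this
  again by a real.\<close>

lemma inj_into_continuum:
  assumes "(UNIV :: real set) \<lesssim> (UNIV :: 'e set)"
  shows "\<exists>j :: (real^2) \<times> (nat \<Rightarrow> complex vec) \<Rightarrow> 'e. inj j"
proof -
  obtain i :: "real \<Rightarrow> 'e" where i: "inj i" using assms unfolding lepoll_def by auto
  obtain r :: "real \<Rightarrow> nat set" where r: "inj r"
    using eqpoll_imp_lepoll[OF eqpoll_sym[OF nat_sets_eqpoll_reals]] unfolding lepoll_def by auto
  obtain s :: "nat set \<Rightarrow> real" where s: "inj s"
    using eqpoll_imp_lepoll[OF nat_sets_eqpoll_reals] unfolding lepoll_def by auto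
  \<comment> \<open>Tags 0 and 1 store the base point, 2 the length of a vector, 3 and 4 the real
    and imaginary parts of its entries. The length is stored because vectors of different dimensions
    share one type; positions beyond it hold 0.\<close>
  define c :: "(real^2) \<times> (nat \<Rightarrow> complex vec) \<Rightarrow> nat \<times> nat \<times> nat \<Rightarrow> real" where
    "c = (\<lambda>(x, f) (a, k, l).
      if a = 0 then x $ 1 else if a = 1 then x $ 2 else if a = 2 then real (dim_vec (f k))
      else if l < dim_vec (f k) then if a = 3 then Re (f k $ l) else Im (f k $ l) else 0)"
  have c: "inj c"
  proof (rule injI)
    fix p q :: "(real^2) \<times> (nat \<Rightarrow> complex vec)" assume eq: "c p = c q"
    obtain x f where p: "p = (x, f)" by fastforce
    obtain y g where q: "q = (y, g)" by fastforce
    have e: "c (x, f) (a, k, l) = c (y, g) (a, k, l)" for a k l using eq p q by simp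
    have "x $ 1 = y $ 1" "x $ 2 = y $ 2" using e[of 0] e[of 1] by (auto simp: c_def)
    then have xy: "x = y" by (simp add: Finite_Cartesian_Product.vec_eq_iff forall_2)
    have dim: "dim_vec (f k) = dim_vec (g k)" for k using e[of 2 k] by (simp add: c_def)
    have "f k $ l = g k $ l" if "l < dim_vec (g k)" for k l
      using e[of 3 k l] e[of 4 k l] that dim by (simp add: c_def complex_eq_iff)
    then have "f k = g k" for k using dim by (intro eq_vecI) auto
    then show "p = q" using p q xy by auto
  qed
  \<comment> \<open>The disjoint union of the sets \<open>r (f q)\<close> remembers each of them,
    and its index set is countable.\<close>
  define t where "t f = to_nat ` (SIGMA q:UNIV. r (f q))" for f :: "nat \<times> nat \<times> nat \<Rightarrow> real"
  have t: "inj t"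
  proof (rule injI)
    fix f g assume "t f = t g"
    then have "(SIGMA q:UNIV. r (f q)) = (SIGMA q:UNIV. r (g q))" unfolding t_def by (simp add: inj_image_eq_iff)
    then have "r (f q) = r (g q)" for q by blast
    then show "f = g" using r by (auto simp: inj_def)
  qed
  have "inj (i \<circ> s \<circ> t \<circ> c)" using i s t c by (simp add: inj_compose)
  then show ?thesis by blast
qed

section \<open>Linear maps as matrices, and the invariance of the fiber character\<close>

lemma linear_matrix:
  fixes t :: "complex vec \<Rightarrow> complex vec"
  assumes t: "\<And>v. v \<in> carrier_vec n \<Longrightarrow> t v \<in> carrier_vec n"
    and add: "\<And>v w. v \<in> carrier_vec n \<Longrightarrow> w \<in> carrier_vec n \<Longrightarrow> t (v + w) = t v + t w"
    and smult: "\<And>c v. v \<in> carrier_vec n \<Longrightarrow> t (c \<cdot>\<^sub>v v) = c \<cdot>\<^sub>v t v"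
  obtains P where "P \<in> carrier_mat n n" "\<And>v. v \<in> carrier_vec n \<Longrightarrow> P *\<^sub>v v = t v"
proof
  define P where "P = Matrix.mat n n (\<lambda>(i, k). t (unit_vec n k) $ i)"
  show P: "P \<in> carrier_mat n n" by (simp add: P_def)
  fix v :: "complex vec" assume v: "v \<in> carrier_vec n"
  \<comment> \<open>Truncations of \<open>v\<close>, growing by one multiple of a unit vector at a
    time; the induction on \<open>k\<close> takes the place of a finite sum of vectors.\<close>
  define w where "w k = vec n (\<lambda>i. if i < k then v $ i else 0)" for k
  have wc: "w k \<in> carrier_vec n" for k by (simp add: w_def)
  have "P *\<^sub>v w k = t (w k)" if "k \<le> n" for k using that
  proof (induction k)
    case 0
    have "w 0 = 0 \<cdot>\<^sub>v v" using v by (intro eq_vecI) (auto simp: w_def)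
    then have "t (w 0) = 0 \<cdot>\<^sub>v t v" using smult[OF v] by simp
    moreover have "0 \<cdot>\<^sub>v t v = 0\<^sub>v n" using t[OF v] by (intro eq_vecI) auto
    ultimately have t0: "t (w 0) = 0\<^sub>v n" by simp
    have P0: "P *\<^sub>v 0\<^sub>v n = 0\<^sub>v n" using P by (intro eq_vecI) auto
    have "w 0 = 0\<^sub>v n" by (intro eq_vecI) (auto simp: w_def)
    then show ?case using t0 P0 by simp
  next
    case (Suc k)
    let ?u = "unit_vec n k :: complex vec"
    have u: "?u \<in> carrier_vec n" by simp
    have eq: "w (Suc k) = w k + v $ k \<cdot>\<^sub>v ?u" using Suc.prems by (intro eq_vecI) (auto simp: w_def less_Suc_eq unit_vec_def)
    have Pu: "P *\<^sub>v ?u = t ?u" using Suc.prems t[OF u] P by (intro eq_vecI) (auto simp: P_def)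
    have "P *\<^sub>v w (Suc k) = P *\<^sub>v w k + v $ k \<cdot>\<^sub>v (P *\<^sub>v ?u)"
      unfolding eq using P wc u by (simp add: mult_add_distrib_mat_vec[of _ n n] mult_mat_vec[of _ n n])
    also have "\<dots> = t (w (Suc k))" unfolding eq Pu using Suc add[OF wc smult_carrier_vec[THEN iffD2, OF u]] smult[OF u] by simp
    finally show ?case .
  qed
  from this[of n] have "P *\<^sub>v w n = t (w n)" by simp
  moreover have "w n = v" using v by (intro eq_vecI) (auto simp: w_def)
  ultimately show "P *\<^sub>v v = t v" by simp
qed

lemma mat_eq_on_vecs:
  fixes M N :: "complex mat"
  assumes M: "M \<in> carrier_mat n n" and N: "N \<in> carrier_mat n n"
    and eq: "\<And>v. v \<in> carrier_vec n \<Longrightarrow> M *\<^sub>v v = N *\<^sub>v v"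
  shows "M = N"
proof (rule eq_matI)
  fix i k assume "i < dim_row N" "k < dim_col N"
  then have ik: "i < n" "k < n" using N by auto
  have "(M *\<^sub>v unit_vec n k) $ i = (N *\<^sub>v unit_vec n k) $ i" using eq by simp
  then show "M $$ (i, k) = N $$ (i, k)" using M N ik by (simp add: scalar_prod_right_unit)
qed (use M N in auto)

text \<open>Written in bases adapted to \<open>\<sigma>\<close> over \<open>x\<close> and over its
  translate by \<open>g\<close>, the map \<open>act E g\<close> becomes a matrix \<open>P\<close>.
  From \<open>g \<otimes> h' = h \<otimes> g\<close> it satisfies
  \<open>P * \<sigma> h' = \<sigma> h * P\<close>, so the two matrices are similar and have the same
  trace.\<close>

lemma (in group) fiber_character_invariant:
  assumes rep: "orthogonal_rep G T \<rho>"
    and \<sigma>: "\<And>h. h \<in> kernel G O2 \<rho> \<Longrightarrow> \<sigma> h \<in> carrier_mat n n"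
    and E: "G_vector_bundle G T \<rho> E" and fiber: "is_fiber_module (kernel G O2 \<rho>) E n \<sigma>"
  shows "invariant_character G (kernel G O2 \<rho>) (character \<sigma>)"
  unfolding invariant_character_def conj_character_def
proof (intro ballI)
  let ?H = "kernel G O2 \<rho>" and ?V = "module_vec TYPE(complex) n"
  fix g h assume g: "g \<in> carrier G" and hH: "h \<in> ?H"
  define h' where "h' = inv g \<otimes> h \<otimes> g"
  have h: "h \<in> carrier G" using hH by (simp add: kernel_def)
  have h'c: "h' \<in> carrier G" using g h by (simp add: h'_def)
  have mult: "\<rho> (a \<otimes> b) = \<rho> a ** \<rho> b" and orth: "orthogonal_matrix (\<rho> a)" if "a \<in> carrier G" "b \<in> carrier G" for a b
    using rep that by (auto simp: orthogonal_rep_def hom_def O2_def)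
  have "h' \<in> ?H"
  proof -
    have \<rho>h: "\<rho> h = Finite_Cartesian_Product.mat 1" using hH by (simp add: kernel_def O2_def)
    have "\<rho> h' = \<rho> (inv g) ** \<rho> g" using g h by (simp add: h'_def mult \<rho>h)
    also have "\<dots> = \<rho> \<one>" using g by (simp flip: mult)
    also have "\<rho> \<one> = Finite_Cartesian_Product.mat 1"
    proof -
      have "\<rho> \<one> ** \<rho> \<one> = \<rho> \<one>" using mult[OF one_closed one_closed] by simp
      then have "transpose (\<rho> \<one>) ** (\<rho> \<one> ** \<rho> \<one>) = transpose (\<rho> \<one>) ** \<rho> \<one>" by simp
      then show ?thesis using orth[OF one_closed one_closed] by (simp add: matrix_mul_assoc orthogonal_matrix)
    qed
    finally show ?thesis using h'c by (simp add: kernel_def O2_def)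
  qed
  have act: "act E \<one> e = e" "\<And>a b. a \<in> carrier G \<Longrightarrow> b \<in> carrier G \<Longrightarrow> act E (a \<otimes> b) e = act E a (act E b e)"
    if "e \<in> topspace (total_space E)" for e using E that unfolding G_vector_bundle_def by blast+
  note E' = E[unfolded G_vector_bundle_def complex_vector_bundle_def]
  define x :: "real^2" where "x = axis 1 1"
  have x: "x \<in> topspace circle" by (simp add: x_def topspace_circle)
  have x': "\<rho> g *v x \<in> topspace circle"
    using orthogonal_transformation_matrix[of "(*v) (\<rho> g)"] orth[OF g g] x
    by (auto simp: topspace_circle orthogonal_transformation_norm)
  obtain f where f: "linear_map class_ring ?V (fiber E x) f" "bij_betw f (carrier_vec n) (carrier (fiber E x))"
    "\<And>h v. h \<in> ?H \<Longrightarrow> v \<in> carrier_vec n \<Longrightarrow> f (\<sigma> h *\<^sub>v v) = act E h (f v)"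
    using fiber x unfolding is_fiber_module_def by blast
  obtain f' where f': "linear_map class_ring ?V (fiber E (\<rho> g *v x)) f'" "bij_betw f' (carrier_vec n) (carrier (fiber E (\<rho> g *v x)))"
    "\<And>h v. h \<in> ?H \<Longrightarrow> v \<in> carrier_vec n \<Longrightarrow> f' (\<sigma> h *\<^sub>v v) = act E h (f' v)"
    using fiber x' unfolding is_fiber_module_def by blast
  interpret f: linear_map class_ring ?V "fiber E x" f by (fact f(1))
  interpret f': linear_map class_ring ?V "fiber E (\<rho> g *v x)" f' by (fact f'(1))
  interpret ag: linear_map class_ring "fiber E x" "fiber E (\<rho> g *v x)" "act E g" using E' g x by blast
  have fc: "f v \<in> carrier (fiber E x)" if "v \<in> carrier_vec n" for v using f(2) that by (rule bij_betwE[THEN bspec])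
  have f'c: "f' v \<in> carrier (fiber E (\<rho> g *v x))" if "v \<in> carrier_vec n" for v using f'(2) that by (rule bij_betwE[THEN bspec])
  have inj': "v = w" if "f' v = f' w" "v \<in> carrier_vec n" "w \<in> carrier_vec n" for v w
    using f'(2) that unfolding bij_betw_def inj_on_def by blast
  have total: "e \<in> topspace (total_space E)" if "e \<in> carrier (fiber E z)" "z \<in> topspace circle" for e z
    using E' that by blast
  \<comment> \<open>The action of \<open>g\<close> in the coordinates \<open>f\<close> at the source
    and \<open>f'\<close> at the target.\<close>
  define t where "t v = inv_into (carrier_vec n) f' (act E g (f v))" for v
  have t: "t v \<in> carrier_vec n" "f' (t v) = act E g (f v)" if "v \<in> carrier_vec n" for v
  proof -
    have "act E g (f v) \<in> f' ` carrier_vec n" using ag.f_im[OF fc[OF that]] f'(2) by (simp add: bij_betw_def)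
    then show "t v \<in> carrier_vec n" "f' (t v) = act E g (f v)" unfolding t_def by (rule inv_into_into, rule f_inv_into_f)
  qed
  obtain P where P: "P \<in> carrier_mat n n" and Pt: "\<And>v. v \<in> carrier_vec n \<Longrightarrow> P *\<^sub>v v = t v"
  proof (rule linear_matrix[of n t])
    fix v w :: "complex vec" assume v: "v \<in> carrier_vec n" and w: "w \<in> carrier_vec n"
    have "f' (t (v + w)) = f' (t v + t w)"
      using f.f_add[of v w] f'.f_add[of "t v" "t w"] ag.f_add[OF fc[OF v] fc[OF w]] t v w by (simp add: module_vec_simps)
    then show "t (v + w) = t v + t w" by (rule inj') (use t v w in auto)
  next
    fix c and v :: "complex vec" assume v: "v \<in> carrier_vec n"
    have "f' (t (c \<cdot>\<^sub>v v)) = f' (c \<cdot>\<^sub>v t v)"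
      using f.f_smult[of c v] f'.f_smult[of c "t v"] ag.f_smult[of c, OF _ fc[OF v]] t v by (simp add: module_vec_simps)
    then show "t (c \<cdot>\<^sub>v v) = c \<cdot>\<^sub>v t v" by (rule inj') (use t v in auto)
  qed (use t that in auto)
  have inter: "P * \<sigma> h' = \<sigma> h * P"
  proof -
    have "(P * \<sigma> h') *\<^sub>v v = (\<sigma> h * P) *\<^sub>v v" if v: "v \<in> carrier_vec n" for v
    proof -
      have s: "\<sigma> h' *\<^sub>v v \<in> carrier_vec n" using \<sigma>[OF \<open>h' \<in> ?H\<close>] v by simp
      note e = total[OF fc[OF v] x]
      have "f' (t (\<sigma> h' *\<^sub>v v)) = act E (g \<otimes> h') (f v)" using t(2)[OF s] f(3)[OF \<open>h' \<in> ?H\<close> v] act(2)[OF e] g h'c by simp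
      also have "g \<otimes> h' = h \<otimes> g" using g h by (simp add: h'_def inv_cancel m_assoc)
      also have "act E (h \<otimes> g) (f v) = f' (\<sigma> h *\<^sub>v t v)" using f'(3)[OF hH t(1)[OF v]] t(2)[OF v] act(2)[OF e] g h by simp
      finally have "t (\<sigma> h' *\<^sub>v v) = \<sigma> h *\<^sub>v t v" by (rule inj') (use t s v \<sigma>[OF hH] in auto)
      then show ?thesis using Pt s v P \<sigma>[OF hH] \<sigma>[OF \<open>h' \<in> ?H\<close>] by (simp add: assoc_mult_mat_vec[of _ n n _ n])
    qed
    then show ?thesis using mat_eq_on_vecs[of "P * \<sigma> h'" n "\<sigma> h * P"] P \<sigma>[OF hH] \<sigma>[OF \<open>h' \<in> ?H\<close>] by simp
  qed
  \<comment> \<open>A vector in the kernel of \<open>P\<close> would have the same image under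
    \<open>act E g\<close> as zero, but this map is undone by the action of
    \<open>inv g\<close>.\<close>
  have "det P \<noteq> 0"
  proof
    assume "det P = 0"
    then obtain v where v: "v \<in> carrier_vec n" "v \<noteq> 0\<^sub>v n" "P *\<^sub>v v = 0\<^sub>v n"
      using det_0_iff_vec_prod_zero[OF P] by blast
    have z: "0\<^sub>v n \<in> carrier_vec n" by simp
    have "P *\<^sub>v 0\<^sub>v n = 0\<^sub>v n" using P by (intro eq_vecI) auto
    then have "t v = t (0\<^sub>v n)" using v Pt z by metis
    then have "act E g (f v) = act E g (f (0\<^sub>v n))" using t(2) v z by metis
    moreover have "act E (inv g) (act E g e) = e" if "e \<in> topspace (total_space E)" for e
    proof -
      have "act E (inv g) (act E g e) = act E (inv g \<otimes> g) e" by (rule act(2)[OF that inv_closed[OF g] g, symmetric])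
      then show ?thesis using act(1)[OF that] g by simp
    qed
    ultimately have "f v = f (0\<^sub>v n)" using total[OF fc x] v z by metis
    then have "v = 0\<^sub>v n" using f(2) v z unfolding bij_betw_def inj_on_def by blast
    then show False using v by blast
  qed
  note mi = minv[OF P this]
  have "P * \<sigma> h' * minv P = \<sigma> h" unfolding inter using sq_assoc[OF \<sigma>[OF hH] P mi(1)] mi \<sigma>[OF hH] by (simp add: sq_one)
  then show "character \<sigma> (inv g \<otimes> h \<otimes> g) = character \<sigma> h"
    using tr_similar[OF P \<sigma>[OF \<open>h' \<in> ?H\<close>] mi(1,3)] by (simp add: character_eq_tr h'_def)
qed

theorem theorem1:
  fixes G :: "('g, 'r) monoid_scheme"
    and T :: "'g topology"
    and A :: "('g set \<times> ('g \<Rightarrow> 'm::real_normed_vector)) set"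
    and \<rho> :: "'g \<Rightarrow> real^2^2"
    and n :: nat
    and \<sigma> :: "'g \<Rightarrow> complex mat"
  assumes "compact_lie_group G T A"
    and "orthogonal_rep G T \<rho>"
    and "complex_rep (G\<lparr>carrier := kernel G O2 \<rho>\<rparr>) (subtopology T (kernel G O2 \<rho>)) n \<sigma>"
    and "(UNIV :: real set) \<lesssim> (UNIV :: 'e set)"
  shows "(\<exists>E :: ('g, 'e) equivariant_bundle.
            G_vector_bundle G T \<rho> E \<and> is_fiber_module (kernel G O2 \<rho>) E n \<sigma>)
         \<longleftrightarrow> invariant_character G (kernel G O2 \<rho>) (character \<sigma>)"
proof
  interpret L: compact_lie_group G T A by (fact assms(1))
  have \<sigma>: "\<sigma> h \<in> carrier_mat n n" if "h \<in> kernel G O2 \<rho>" for h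
    using assms(3) that by (simp add: complex_rep_def)
  show "invariant_character G (kernel G O2 \<rho>) (character \<sigma>)"
    if "\<exists>E :: ('g, 'e) equivariant_bundle. G_vector_bundle G T \<rho> E \<and> is_fiber_module (kernel G O2 \<rho>) E n \<sigma>"
    using that by (elim exE conjE) (rule L.fiber_character_invariant[OF assms(2) \<sigma>])
  assume inv: "invariant_character G (kernel G O2 \<rho>) (character \<sigma>)"
  interpret C: circle_action G T \<rho> n \<sigma>
    by unfold_locales (fact L.topspace_eq L.compact L.mult_continuous L.inv_continuous L.hausdorff assms(2,3) inv)+
  \<comment> \<open>The cardinality assumption enters here: it provides an injection of the model of
    the total space into the type of bundle points.\<close>
  obtain j :: "(real^2) \<times> (nat \<Rightarrow> complex vec) \<Rightarrow> 'e" where "inj j" using inj_into_continuum[OF assms(4)] by blast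
  then show "\<exists>E :: ('g, 'e) equivariant_bundle. G_vector_bundle G T \<rho> E \<and> is_fiber_module (kernel G O2 \<rho>) E n \<sigma>"
    by (rule C.exists_bundle)
qed

end
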